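(* Let $n,d$ be integers with $1\le d<n-2$ and let $\alpha>0$ with $\alpha\neq n-d-2$. Then there is no non-trivial one-parameter differentiable family of graph perturbations (as defined in the context) of the flat solution $D_{\alpha,\mu}$, with $\mu=\mathcal{H}^d|_E$ and $E=\mathbb{R}^d$, of the equation $L_{\alpha,\mu}D_{\alpha,\mu}=0$ in $\mathbb{R}^n\setminus E$.
   Context: Identify $\mathbb{R}^d$ with $\mathbb{R}^d\times\{0\}\subset\mathbb{R}^n=\mathbb{R}^d\times\mathbb{R}^{n-d}$; $\mathcal{H}^d$ is $d$-dimensional Hausdorff measure. A measure $\mu$ is a $d$-Ahlfors regular measure on a closed set $E$ if its closed support is $E$ and there is $C_0\ge1$ with $C_0^{-1}r^d\le\mu(B(x,r))\le C_0r^d$ for all $x\in E$ and $0<r<\mathrm{diam}(E)$. For such $\mu$ and $x\in\Omega=\mathbb{R}^n\setminus E$ set $$D_{\alpha,\mu}(x)=\left(\int_E|x-y|^{-d-\alpha}\,d\mu(y)\right)^{-1/\alpha},\qquad L_{\alpha,\mu}=-\mathrm{div}\,\big(D_{\alpha,\mu}^{-n+d+1}\nabla\,\cdot\,\big).$$ All measures $\mu$ considered are assumed to be $d$-Ahlfors regular on their supports $E$. For $f$ locally integrable on $\mathbb{R}^d$, $\|f\|_{BMO}=\sup_B\frac1{|B|}\int_B|f-m_Bf|\,dy$, the supremum being over balls $B\subset\mathbb{R}^d$, with $m_Bf=\frac1{|B|}\int_Bf\,dy$. When a bound is stated for a norm or modulus of a vector-valued quantity, it means that the bound holds for every component. Definition.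 A non-trivial one-parameter differentiable family of graph perturbations of the flat solution is a family $\{D_{\alpha,\mu_t}\}_{t\in[0,t_0)}$, $t_0>0$, such that for every $t$, with $E_t$ the support of $\mu_t$, one has $L_{\alpha,\mu_t}D_{\alpha,\mu_t}=0$ in $\mathbb{R}^n\setminus E_t$; $E_t$ is the image of the Lipschitz map $\mathrm{Id}+\psi_t:\mathbb{R}^d\to\mathbb{R}^n$, $y\mapsto(y,\psi_t(y))$, where $\psi_t:\mathbb{R}^d\to\mathbb{R}^{n-d}$ is Lipschitz with constant $Ct$ ($C$ independent of $t$); $\mu_t$ is the image (push-forward) under $\mathrm{Id}+\psi_t$ of the measure $(1+\phi_t)\,d\mathcal{H}^d$ on $\mathbb{R}^d$, with $\phi_t\in L^\infty(\mathbb{R}^d)$; and: 1. $\phi_0=0$ and $\psi_0=0$; 2. the families $\{\phi_t\}$ and $\{\psi_t\}$ are Fréchet differentiable at zero in $BMO(\mathbb{R}^d)$: there are functions $\frac{\partial\phi_t}{\partial t}(0,\cdot)$ and $\frac{\partial\psi_t}{\partial t}(0,\cdot)$ in $BMO(\mathbb{R}^d)\cap L^1(\mathbb{R}^d)$ with $\big\|\phi_t-t\frac{\partial\phi_t}{\partial t}(0,\cdot)\big\|_{BMO}=o(t)$ and $\big\|\psi_t-t\frac{\partial\psi_t}{\partial t}(0,\cdot)\big\|_{BMO}=o(t)$ as $t\to0$; 3. $\frac{\partial\psi_t}{\partial t}(0,\cdot)$ is not constant; 4. for $F_t=\phi_t$ and for $F_t=\psi_t$, with a constant $C$ independent of $t$,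 $\|F_t\|_{BMO}\le Ct$ and $\big|\int_{B(0,1)}F_t(y)\,dy\big|\le Ct$, and $\big|\int_{B(0,1)}\big(F_t(y)-t\frac{\partial F_t}{\partial t}(0,y)\big)dy\big|=o(t)$ as $t\to0$ (here $B(0,1)$ is the unit ball of $\mathbb{R}^d$). *)

theory Defs
  imports "HOL-Analysis.Analysis"
begin

section \<open>Hausdorff measure\<close>

text \<open>The covering sets are required to be bounded because \<^const>\<open>diameter\<close> is unspecified on
  unbounded sets, and the dimension \<open>s\<close> is meant to be positive. With the factor \<^term>\<open>unit_ball_vol s\<close>, the \<open>d\<close>-dimensional Hausdorff measure
  of \<open>\<real>\<^sup>d\<close> is Lebesgue measure.\<close>

definition hausdorff_content :: "real \<Rightarrow> real \<Rightarrow> 'a::metric_space set \<Rightarrow> ennreal" where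
  "hausdorff_content s \<delta> A =
     (INF U \<in> {U :: nat \<Rightarrow> 'a set. A \<subseteq> (\<Union>i. U i) \<and> (\<forall>i. bounded (U i) \<and> diameter (U i) \<le> \<delta>)}.
        \<Sum>i. ennreal (unit_ball_vol s * (diameter (U i) / 2) powr s))"

definition hausdorff_outer :: "real \<Rightarrow> 'a::metric_space set \<Rightarrow> ennreal" where
  "hausdorff_outer s A = (SUP \<delta> \<in> {0<..}. hausdorff_content s \<delta> A)"

definition hausdorff_measure :: "real \<Rightarrow> 'a::metric_space measure" where
  "hausdorff_measure s = measure_of UNIV (sets borel) (hausdorff_outer s)"


section \<open>Ahlfors regular measures\<close>

definition closed_support :: "'a::metric_space measure \<Rightarrow> 'a set" where
  "closed_support \<mu> = {x. \<forall>r>0. emeasure \<mu> (ball x r) > 0}"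

text \<open>The radius ranges over \<open>0 < r < diam E\<close>, where \<open>diam E = \<infinity>\<close> if \<open>E\<close> is unbounded.\<close>

definition ahlfors_regular :: "nat \<Rightarrow> 'a::metric_space measure \<Rightarrow> 'a set \<Rightarrow> bool" where
  "ahlfors_regular d \<mu> E \<longleftrightarrow>
     sets \<mu> = sets borel \<and> closed E \<and> closed_support \<mu> = E \<and>
     (\<exists>C0\<ge>1. \<forall>x\<in>E. \<forall>r>0. (bounded E \<longrightarrow> r < diameter E) \<longrightarrow>
        ennreal (inverse C0 * r ^ d) \<le> emeasure \<mu> (ball x r) \<and>
        emeasure \<mu> (ball x r) \<le> ennreal (C0 * r ^ d))"


section \<open>The regularized distance and the degenerate elliptic operator\<close>

definition reg_dist :: "nat \<Rightarrow> real \<Rightarrow> 'a::euclidean_space measure \<Rightarrow> 'a \<Rightarrow> real" where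
  "reg_dist d \<alpha> \<mu> x =
     (LINT y:closed_support \<mu>|\<mu>. norm (x - y) powr (- real d - \<alpha>)) powr (- 1 / \<alpha>)"

definition gradient :: "('a::euclidean_space \<Rightarrow> real) \<Rightarrow> 'a \<Rightarrow> 'a" where
  "gradient u x = (\<Sum>b\<in>Basis. frechet_derivative u (at x) b *\<^sub>R b)"

definition divergence :: "('a::euclidean_space \<Rightarrow> 'a) \<Rightarrow> 'a \<Rightarrow> real" where
  "divergence V x = (\<Sum>b\<in>Basis. frechet_derivative V (at x) b \<bullet> b)"

text \<open>Derivatives are classical: \<^term>\<open>reg_dist d \<alpha> \<mu>\<close> is positive and smooth off the support.\<close>

definition elliptic_op ::
  "nat \<Rightarrow> real \<Rightarrow> 'a::euclidean_space measure \<Rightarrow> ('a \<Rightarrow> real) \<Rightarrow> 'a \<Rightarrow> real" where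
  "elliptic_op d \<alpha> \<mu> u x =
     - divergence
         (\<lambda>z. reg_dist d \<alpha> \<mu> z powr (- real DIM('a) + real d + 1) *\<^sub>R gradient u z) x"


section \<open>Function spaces\<close>

text \<open>Elements of \<open>L\<^sup>\<infinity>\<close>, \<open>L\<^sup>1\<close> and BMO are given by Borel representatives.\<close>

definition L_infinity :: "('a::euclidean_space \<Rightarrow> real) \<Rightarrow> bool" where
  "L_infinity f \<longleftrightarrow> f \<in> borel_measurable borel \<and> (\<exists>M. AE y in lborel. \<bar>f y\<bar> \<le> M)"

definition locally_integrable :: "('a::euclidean_space \<Rightarrow> real) \<Rightarrow> bool" where
  "locally_integrable f \<longleftrightarrow> (\<forall>K. compact K \<longrightarrow> set_integrable lborel K f)"

definition ball_mean :: "'a::euclidean_space \<Rightarrow> real \<Rightarrow> ('a \<Rightarrow> real) \<Rightarrow> real" where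
  "ball_mean x r f = (LINT y:ball x r|lborel. f y) / measure lborel (ball x r)"

definition bmo_norm :: "('a::euclidean_space \<Rightarrow> real) \<Rightarrow> ennreal" where
  "bmo_norm f = (SUP x. SUP r\<in>{0<..}. ennreal (ball_mean x r (\<lambda>y. \<bar>f y - ball_mean x r f\<bar>)))"

definition BMO :: "('a::euclidean_space \<Rightarrow> real) \<Rightarrow> bool" where
  "BMO f \<longleftrightarrow> locally_integrable f \<and> bmo_norm f < \<infinity>"


section \<open>Graph perturbations of the flat solution\<close>

text \<open>Conditions 2 and 4 of the definition for a scalar family \<open>F\<close> with derivative \<open>F'\<close> at zero;
  vector-valued families satisfy them componentwise.\<close>

definition bmo_differentiable_at_0 ::
  "(real \<Rightarrow> 'a::euclidean_space \<Rightarrow> real) \<Rightarrow> ('a \<Rightarrow> real) \<Rightarrow> bool" where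
  "bmo_differentiable_at_0 F F' \<longleftrightarrow>
     BMO F' \<and> integrable lborel F' \<and>
     (\<forall>\<epsilon>>0. \<forall>\<^sub>F t in at_right 0. bmo_norm (\<lambda>y. F t y - t * F' y) \<le> ennreal (\<epsilon> * t))"

definition linearly_controlled ::
  "real \<Rightarrow> (real \<Rightarrow> 'a::euclidean_space \<Rightarrow> real) \<Rightarrow> ('a \<Rightarrow> real) \<Rightarrow> bool" where
  "linearly_controlled t0 F F' \<longleftrightarrow>
     (\<exists>C. \<forall>t\<in>{0..<t0}. bmo_norm (F t) \<le> ennreal (C * t) \<and>
        \<bar>LINT y:ball 0 1|lborel. F t y\<bar> \<le> C * t) \<and>
     (\<forall>\<epsilon>>0. \<forall>\<^sub>F t in at_right 0.
        \<bar>LINT y:ball 0 1|lborel. F t y - t * F' y\<bar> \<le> \<epsilon> * t)"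

definition graph_map :: "('a \<Rightarrow> 'b) \<Rightarrow> 'a \<Rightarrow> 'a \<times> 'b" where
  "graph_map \<psi> y = (y, \<psi> y)"

text \<open>\<open>\<real>\<^sup>n = \<real>\<^sup>d \<times> \<real>\<^sup>n\<^sup>-\<^sup>d\<close> is \<^typ>\<open>(real^'d) \<times> (real^'m)\<close>. The condition \<open>1 + \<phi> t \<ge> 0\<close> makes
  \<open>(1 + \<phi> t) d\<H>\<^sup>d\<close> a measure, since \<^const>\<open>ennreal\<close> truncates. As \<open>\<psi>'\<close> is an element of
  BMO, non-constancy is understood up to null sets.\<close>

definition nontrivial_graph_perturbations ::
  "real \<Rightarrow> real \<Rightarrow> (real \<Rightarrow> ((real^'d) \<times> (real^'m)) measure) \<Rightarrow> bool" where
  "nontrivial_graph_perturbations \<alpha> t0 \<mu> \<longleftrightarrow>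
     t0 > 0 \<and>
     (\<exists>(\<phi> :: real \<Rightarrow> real^'d \<Rightarrow> real) (\<psi> :: real \<Rightarrow> real^'d \<Rightarrow> real^'m) \<phi>' \<psi>'.
        (\<exists>C. \<forall>t\<in>{0..<t0}. (C * t)-lipschitz_on UNIV (\<psi> t)) \<and>
        (\<forall>t\<in>{0..<t0}.
           L_infinity (\<phi> t) \<and> (AE y in lborel. 0 \<le> 1 + \<phi> t y) \<and>
           \<mu> t = distr (density (hausdorff_measure (real CARD('d))) (\<lambda>y. ennreal (1 + \<phi> t y)))
                    borel (graph_map (\<psi> t)) \<and>
           ahlfors_regular CARD('d) (\<mu> t) (range (graph_map (\<psi> t))) \<and>
           (\<forall>x \<in> - closed_support (\<mu> t).
              elliptic_op CARD('d) \<alpha> (\<mu> t) (reg_dist CARD('d) \<alpha> (\<mu> t)) x = 0)) \<and>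
        (AE y in lborel. \<phi> 0 y = 0) \<and> (\<forall>y. \<psi> 0 y = 0) \<and>
        bmo_differentiable_at_0 \<phi> \<phi>' \<and>
        (\<forall>i. bmo_differentiable_at_0 (\<lambda>t y. \<psi> t y $ i) (\<lambda>y. \<psi>' y $ i)) \<and>
        \<not> (\<exists>c. AE y in lborel. \<psi>' y = c) \<and>
        linearly_controlled t0 \<phi> \<phi>' \<and>
        (\<forall>i. linearly_controlled t0 (\<lambda>t y. \<psi> t y $ i) (\<lambda>y. \<psi>' y $ i)))"

end

theory Submission
  imports Defs
begin

text \<open>
  Write \<open>a = d + \<alpha>\<close> and \<open>R\<^sub>t x = \<integral> (1 + \<phi>\<^sub>t y) |x - (y, \<psi>\<^sub>t y)| powr (- a) dy\<close>. The Hausdorff measure of \<open>\<real>\<^sup>d\<close> is a constant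
  multiple of Lebesgue measure, so the regularized distance is a constant multiple of \<open>R\<^sub>t powr (- 1 / \<alpha>)\<close>, and the
  equation says that the power \<open>(n - d - 2) / \<alpha>\<close> of \<open>R\<^sub>t\<close> is harmonic. The Laplacian of \<open>|v| powr (- a)\<close> is a multiple of
  \<open>|v| powr (- a - 2)\<close>. Hence, if \<open>\<alpha> \<noteq> n - d - 2\<close>, the equation at \<open>x\<close> is equivalent to the identity
  \<open>a |V\<^sub>t|\<^sup>2 = \<alpha> R\<^sub>t J\<^sub>t\<close>, where \<open>V\<^sub>t\<close> and \<open>J\<^sub>t\<close> are the integrals of the kernels \<open>|v| powr (- a - 2) v\<close> and
  \<open>|v| powr (- a - 2)\<close> over the same graph (\<open>graph_identity\<close>).

  Fix \<open>x = (p, z)\<close> with \<open>z \<noteq> 0\<close> and differentiate this identity at \<open>t = 0\<close>. All three integrals have first-order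
  expansions (\<open>family_expansion\<close>): BMO functions with controlled mean are controlled in \<open>L\<^sup>1\<close> with weight
  \<open>(1 + |y|) powr (- s)\<close>, \<open>s > d\<close> (\<open>BMO_weighted_bound\<close>), and the Lipschitz bound gives \<open>|\<psi>\<^sub>t y| = O(t (1 + |y|))\<close>, which makes the
  quadratic errors \<open>O(t\<^sup>2)\<close>. The derivative \<open>\<phi>'\<close> enters evenly in \<open>z\<close> and \<open>\<psi>'\<close> oddly. Taking the odd part for
  \<open>z = r e\<^sub>i\<close> and writing \<open>q\<close> for the \<open>i\<close>-th component of \<open>\<psi>'\<close> leaves

  \<open>(a + 2) r\<^sup>2 \<integral> q(y) |(p - y, r)| powr (- a - 4) dy = (\<alpha> + 2) \<integral> q(y) |(p - y, r)| powr (- a - 2) dy\<close>,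

  which states that \<open>r powr (\<alpha> + 2) \<integral> q(y) |(p - y, r)| powr (- a - 2) dy\<close> does not depend on \<open>r > 0\<close>. It tends to \<open>0\<close> as
  \<open>r \<rightarrow> \<infinity>\<close> because \<open>q\<close> is integrable, so it is \<open>0\<close>. Since these kernels form an approximate identity as \<open>r \<rightarrow> 0\<close>,
  up to a constant factor, \<open>q = 0\<close> almost everywhere (\<open>AE_zero_if_first_order_equation\<close>). Thus \<open>\<psi>'\<close> is constant, a
  contradiction.
\<close>

section \<open>Notation\<close>

text \<open>The weight in the \<open>L\<^sup>1\<close> spaces below. It is integrable over \<open>\<real>\<^sup>d\<close> if and only if \<open>s > d\<close>.\<close>

abbreviation weight :: "real \<Rightarrow> 'a::real_normed_vector \<Rightarrow> real" where
  "weight s y \<equiv> (1 + norm y) powr (- s)"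

abbreviation weighted_integrable :: "real \<Rightarrow> ('a::euclidean_space \<Rightarrow> 'c::euclidean_space) \<Rightarrow> bool" where
  "weighted_integrable s f \<equiv> integrable lborel (\<lambda>y. norm (f y) * weight s y)"

abbreviation weighted_norm :: "real \<Rightarrow> ('a::euclidean_space \<Rightarrow> 'c::euclidean_space) \<Rightarrow> real" where
  "weighted_norm s f \<equiv> LBINT y. norm (f y) * weight s y"

text \<open>The integral of \<open>|v| powr (- s)\<close> against a density on \<open>\<real>\<^sup>d\<close>, and the integrals of \<open>|v| powr (- s)\<close> and
  \<open>|v| powr (- s) *\<^sub>R v\<close> over the graph of \<open>\<psi>\<close> with density \<open>1 + \<phi>\<close>.\<close>

abbreviation potential :: "real \<Rightarrow> ('a::euclidean_space \<Rightarrow> real) \<Rightarrow> 'a \<Rightarrow> 'b::euclidean_space \<Rightarrow> real" where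
  "potential s f p z \<equiv> LBINT y. f y * norm (p - y, z) powr (- s)"

abbreviation graph_potential ::
  "real \<Rightarrow> ('a::euclidean_space \<Rightarrow> real) \<Rightarrow> ('a \<Rightarrow> 'b::euclidean_space) \<Rightarrow> 'a \<times> 'b \<Rightarrow> real" where
  "graph_potential s \<phi> \<psi> x \<equiv> LBINT y. (1 + \<phi> y) * norm (x - (y, \<psi> y)) powr (- s)"

abbreviation graph_field ::
  "real \<Rightarrow> ('a::euclidean_space \<Rightarrow> real) \<Rightarrow> ('a \<Rightarrow> 'b::euclidean_space) \<Rightarrow> 'a \<times> 'b \<Rightarrow> 'a \<times> 'b" where
  "graph_field s \<phi> \<psi> x \<equiv> LBINT y. (1 + \<phi> y) *\<^sub>R (norm (x - (y, \<psi> y)) powr (- s) *\<^sub>R (x - (y, \<psi> y)))"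

section \<open>Homogeneous kernels and their Taylor expansion\<close>

lemma powr_taylor:
  fixes \<sigma> u :: real
  assumes "\<sigma> \<ge> 0" "u \<ge> -3/4"
  shows "\<bar>(1 + u) powr (-\<sigma>) - 1 + \<sigma> * u\<bar> \<le> \<sigma> * (\<sigma> + 1) * 4 powr (\<sigma> + 2) * u\<^sup>2"
proof (cases "u = 0")
  case False
  define df :: "nat \<Rightarrow> real \<Rightarrow> real" where
    "df m = (if m = 0 then (\<lambda>u. (1 + u) powr (-\<sigma>))
       else if m = 1 then (\<lambda>u. -\<sigma> * (1 + u) powr (-\<sigma> - 1))
       else (\<lambda>u. \<sigma> * (\<sigma> + 1) * (1 + u) powr (-\<sigma> - 2)))" for m
  have der: "DERIV (df m) t :> df (Suc m) t" if "m < 2" "-3/4 \<le> t" for m t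
  proof -
    have "m = 0 \<or> m = 1" using that by auto
    moreover have "DERIV (\<lambda>u. (1 + u) powr (-\<sigma>)) t :> -\<sigma> * (1 + t) powr (-\<sigma> - 1)"
      using that by (auto intro!: derivative_eq_intros)
    moreover have "DERIV (\<lambda>u. -\<sigma> * (1 + u) powr (-\<sigma> - 1)) t :> \<sigma> * (\<sigma> + 1) * (1 + t) powr (-\<sigma> - 2)"
      using that by (auto intro!: derivative_eq_intros simp: algebra_simps)
    ultimately show ?thesis by (auto simp: df_def)
  qed
  have "\<exists>t. (if u < 0 then u < t \<and> t < 0 else 0 < t \<and> t < u) \<and>
      df 0 u = (\<Sum>m<2. (df m 0 / fact m) * (u - 0) ^ m) + (df 2 t / fact 2) * (u - 0) ^ 2"
    using Taylor[of 2 df "df 0" "-3/4" "max u 0" 0 u] der assms False by auto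
  then obtain t where t: "if u < 0 then u < t \<and> t < 0 else 0 < t \<and> t < u"
    and eq: "df 0 u = (\<Sum>m<2. (df m 0 / fact m) * (u - 0) ^ m) + (df 2 t / fact 2) * (u - 0) ^ 2"
    by blast
  have "(1 + t) powr (-\<sigma> - 2) \<le> 4 powr (\<sigma> + 2)"
  proof -
    have t4: "1 + t \<ge> 1 / 4" using t assms by (auto split: if_splits)
    have "(1 + t) powr (-\<sigma> - 2) \<le> (1/4) powr (-\<sigma> - 2)"
      using t4 assms by (intro powr_mono2') auto
    also have "\<dots> = 4 powr (\<sigma> + 2)"
      by (simp add: powr_divide powr_minus_divide[symmetric] add.commute)
    finally show ?thesis .
  qed
  then have "\<sigma> * (\<sigma> + 1) * ((1 + t) powr (-\<sigma> - 2) / 2) * u\<^sup>2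
      \<le> \<sigma> * (\<sigma> + 1) * 4 powr (\<sigma> + 2) * u\<^sup>2"
    using assms powr_ge_zero[of "1 + t" "-\<sigma> - 2"]
    by (intro mult_right_mono mult_left_mono) (linarith | simp)+
  moreover have "(1 + u) powr (-\<sigma>) - 1 + \<sigma> * u = \<sigma> * (\<sigma> + 1) * ((1 + t) powr (-\<sigma> - 2) / 2) * u\<^sup>2"
    using eq by (simp add: df_def numeral_2_eq_2)
  moreover have "0 \<le> \<sigma> * (\<sigma> + 1) * ((1 + t) powr (-\<sigma> - 2) / 2) * u\<^sup>2" using assms by simp
  ultimately show ?thesis by simp
qed auto

lemma power2_powr_half:
  fixes x s :: real
  assumes "x \<ge> 0"
  shows "(x\<^sup>2) powr (s / 2) = x powr s"
proof -
  have "x\<^sup>2 = x powr 2" using assms by simp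
  then show ?thesis by (simp only: powr_powr) simp
qed

lemma powr_times_self:
  fixes x s :: real
  assumes "x > 0"
  shows "x powr s * x = x powr (s + 1)"
  using assms by (simp add: powr_add)

text \<open>A kernel \<open>k\<close> on \<open>v \<noteq> 0\<close> that behaves like a homogeneous function of degree \<open>- s\<close>: it has size
  \<open>|v| powr (- s)\<close>, and \<open>k' v\<close> is its derivative at \<open>v\<close>, with the matching bounds for \<open>k'\<close> and for the second-order
  Taylor remainder at increments of length at most \<open>|v| / 2\<close>. The values at \<open>v = 0\<close> play no role.\<close>

definition taylor_kernel ::
  "real \<Rightarrow> ('v::euclidean_space \<Rightarrow> 'c::euclidean_space) \<Rightarrow> ('v \<Rightarrow> 'v \<Rightarrow> 'c) \<Rightarrow> bool" where
  "taylor_kernel s k k' \<longleftrightarrow>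
     k \<in> borel_measurable borel \<and> (\<lambda>(v, h). k' v h) \<in> borel_measurable (borel \<Otimes>\<^sub>M borel) \<and>
     (\<forall>v. linear (k' v)) \<and>
     (\<exists>C\<ge>0. \<forall>v. v \<noteq> 0 \<longrightarrow>
        norm (k v) \<le> C * norm v powr (- s) \<and>
        (\<forall>h. norm (k' v h) \<le> C * norm h * norm v powr (- s - 1)) \<and>
        (\<forall>h. norm h \<le> norm v / 2 \<longrightarrow>
           norm (k (v + h) - k v - k' v h) \<le> C * (norm h)\<^sup>2 * norm v powr (- s - 2)))"

lemma taylor_kernelI:
  assumes "k \<in> borel_measurable borel" "(\<lambda>(v, h). k' v h) \<in> borel_measurable (borel \<Otimes>\<^sub>M borel)"
    and "\<And>v. linear (k' v)" and "C \<ge> 0"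
    and "\<And>v. v \<noteq> 0 \<Longrightarrow> norm (k v) \<le> C * norm v powr (- s)"
    and "\<And>v h. v \<noteq> 0 \<Longrightarrow> norm (k' v h) \<le> C * norm h * norm v powr (- s - 1)"
    and "\<And>v h. v \<noteq> 0 \<Longrightarrow> norm h \<le> norm v / 2 \<Longrightarrow>
           norm (k (v + h) - k v - k' v h) \<le> C * (norm h)\<^sup>2 * norm v powr (- s - 2)"
  shows "taylor_kernel s k k'"
  unfolding taylor_kernel_def using assms by blast

lemma taylor_kernel_norm_powr:
  assumes "s \<ge> 0"
  shows "taylor_kernel s (\<lambda>v::'v::euclidean_space. norm v powr (- s))
           (\<lambda>v h. - s * norm v powr (- s - 2) * (v \<bullet> h))"
proof -
  define M where "M = (s/2) * (s/2 + 1) * 4 powr (s/2 + 2)"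
  define C where "C = 1 + s + 7 * M"
  have M: "M \<ge> 0" using assms by (simp add: M_def)
  have rem: "norm (norm (v + h) powr (- s) - norm v powr (- s) - (- s * norm v powr (- s - 2) * (v \<bullet> h)))
      \<le> C * (norm h)\<^sup>2 * norm v powr (- s - 2)" if v: "v \<noteq> 0" and h: "norm h \<le> norm v / 2" for v h :: 'v
  proof -
    define q where "q = (norm v)\<^sup>2"
    define u where "u = (2 * (v \<bullet> h) + (norm h)\<^sup>2) / q"
    have q: "q > 0" using v by (simp add: q_def)
    have sq: "(norm (v + h))\<^sup>2 = q * (1 + u)"
      using q by (simp add: u_def q_def field_simps power2_norm_eq_inner inner_commute inner_add)
    have "norm (v + h) \<ge> norm v / 2" using h norm_diff_ineq[of v h] by linarith
    then have "(norm (v + h))\<^sup>2 \<ge> (norm v / 2)\<^sup>2" by (intro power_mono) auto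
    then have "q * (1 + u) \<ge> q * (1/4)" using sq by (simp add: q_def power_divide)
    then have u1: "1 + u \<ge> 1 / 4" using q mult_le_cancel_left_pos by blast
    have vh: "\<bar>v \<bullet> h\<bar> \<le> norm v * norm h" by (rule Cauchy_Schwarz_ineq2)
    have hh: "(norm h)\<^sup>2 \<le> norm v / 2 * norm h"
      using mult_right_mono[OF h norm_ge_zero[of h]] by (simp add: power2_eq_square)
    have "\<bar>2 * (v \<bullet> h) + (norm h)\<^sup>2\<bar> \<le> 5/2 * (norm v * norm h)"
      using vh hh zero_le_power2[of "norm h"] by linarith
    then have "\<bar>u\<bar> \<le> (5/2 * (norm v * norm h)) / q" unfolding u_def
      unfolding abs_divide abs_of_pos[OF q] using q by (intro divide_right_mono) auto
    then have "u\<^sup>2 \<le> ((5/2 * (norm v * norm h)) / q)\<^sup>2"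
      by (metis abs_ge_zero power2_abs power_mono)
    also have "\<dots> = 25/4 * (norm h)\<^sup>2 / q"
      using q by (simp add: q_def power2_eq_square field_simps)
    finally have u2: "u\<^sup>2 \<le> 25/4 * (norm h)\<^sup>2 / q" .
    have "norm (v + h) powr (- s) = ((norm (v + h))\<^sup>2) powr (- s/2)"
      using power2_powr_half[of "norm (v + h)" "- s"] by simp
    also have "\<dots> = q powr (- s/2) * (1 + u) powr (- s/2)"
      using q u1 by (simp add: sq powr_mult)
    also have "q powr (- s/2) = norm v powr (- s)" unfolding q_def
      using power2_powr_half[of "norm v" "- s"] by simp
    finally have e1: "norm (v + h) powr (- s) = norm v powr (- s) * (1 + u) powr (- (s/2))" by simp
    have e2: "norm v powr (- s - 2) = norm v powr (- s) / q"
      using v by (simp add: q_def powr_diff)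
    have tay: "\<bar>(1 + u) powr (- (s/2)) - 1 + s/2 * u\<bar> \<le> M * u\<^sup>2"
      unfolding M_def using powr_taylor[of "s/2" u] assms u1 by auto
    have "norm (v + h) powr (- s) - norm v powr (- s) - (- s * norm v powr (- s - 2) * (v \<bullet> h))
      = norm v powr (- s) * (((1 + u) powr (- (s/2)) - 1 + s/2 * u) - s/2 * (norm h)\<^sup>2 / q)"
      unfolding e1 e2 u_def using q by (simp add: field_simps)
    also have "\<bar>\<dots>\<bar> \<le> norm v powr (- s) * (M * (25/4 * (norm h)\<^sup>2 / q) + s/2 * (norm h)\<^sup>2 / q)"
    proof -
      have "M * u\<^sup>2 \<le> M * (25/4 * (norm h)\<^sup>2 / q)" using u2 M by (rule mult_left_mono)
      moreover have "0 \<le> s/2 * (norm h)\<^sup>2 / q" using assms q by auto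
      ultimately show ?thesis using tay unfolding abs_mult by (intro mult_mono) auto
    qed
    also have "\<dots> = (M * 25/4 + s/2) * (norm h)\<^sup>2 * norm v powr (- s - 2)"
      unfolding e2 by (simp add: algebra_simps add_divide_distrib)
    also have "\<dots> \<le> C * (norm h)\<^sup>2 * norm v powr (- s - 2)"
      using M assms by (intro mult_right_mono) (auto simp: C_def)
    finally show ?thesis by simp
  qed
  have aux: "- s - 2 + 1 = - s - 1" by simp
  have lin: "norm (- s * norm v powr (- s - 2) * (v \<bullet> h)) \<le> C * norm h * norm v powr (- s - 1)"
    if "v \<noteq> 0" for v h :: 'v
  proof -
    have e: "norm v powr (- s - 1) = norm v powr (- s - 2) * norm v"
      using that powr_times_self[of "norm v" "- s - 2"] by (metis aux zero_less_norm_iff)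
    have "norm (- s * norm v powr (- s - 2) * (v \<bullet> h)) \<le> s * norm v powr (- s - 2) * (norm v * norm h)"
      using assms Cauchy_Schwarz_ineq2[of v h] by (auto simp: abs_mult intro!: mult_left_mono)
    also have "\<dots> \<le> C * norm v powr (- s - 2) * (norm v * norm h)"
      using M assms by (intro mult_right_mono) (auto simp: C_def)
    finally show ?thesis unfolding e by (simp add: algebra_simps)
  qed
  have C: "C \<ge> 1" using M assms by (simp add: C_def)
  have "(\<lambda>(v::'v, h). - s * norm v powr (- s - 2) * (v \<bullet> h)) \<in> borel_measurable (borel \<Otimes>\<^sub>M borel)"
    unfolding case_prod_beta by measurable
  moreover have "linear (\<lambda>h. - s * norm v powr (- s - 2) * (v \<bullet> h))" for v :: 'v
    by (intro linearI) (auto simp: inner_add algebra_simps)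
  moreover have "(\<lambda>v::'v. norm v powr (- s)) \<in> borel_measurable borel" by measurable
  moreover have "norm (norm v powr (- s)) \<le> C * norm v powr (- s)" for v :: 'v
    using C mult_right_mono[of 1 C "norm v powr (- s)"] by simp
  ultimately show ?thesis using rem lin C by (intro taylor_kernelI[of _ _ C]) auto
qed

text \<open>Multiplying a kernel by the vector \<open>v\<close> raises the degree by one. Together with the powers of the norm, this
  covers the kernels of \<open>R\<close>, of \<open>\<nabla>R\<close> and of \<open>\<Delta>R\<close>.\<close>

lemma taylor_kernel_scaleR:
  fixes k :: "'v::euclidean_space \<Rightarrow> real"
  assumes "taylor_kernel s k k'"
  shows "taylor_kernel (s - 1) (\<lambda>v. k v *\<^sub>R v) (\<lambda>v h. k v *\<^sub>R h + k' v h *\<^sub>R v)"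
proof -
  obtain C where C: "C \<ge> 0"
    and k: "\<And>v. v \<noteq> 0 \<Longrightarrow> \<bar>k v\<bar> \<le> C * norm v powr (- s)"
    and k': "\<And>v h. v \<noteq> 0 \<Longrightarrow> \<bar>k' v h\<bar> \<le> C * norm h * norm v powr (- s - 1)"
    and rem: "\<And>v h. v \<noteq> 0 \<Longrightarrow> norm h \<le> norm v / 2 \<Longrightarrow>
        \<bar>k (v + h) - k v - k' v h\<bar> \<le> C * (norm h)\<^sup>2 * norm v powr (- s - 2)"
    using assms unfolding taylor_kernel_def real_norm_def by blast
  have [measurable]: "k \<in> borel_measurable borel"
    "(\<lambda>(v, h). k' v h) \<in> borel_measurable (borel \<Otimes>\<^sub>M borel)" and lin: "\<And>v. linear (k' v)"
    using assms unfolding taylor_kernel_def by auto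
  have aux: "- s - 1 + 1 = - s" "- s - 2 + 1 = - s - 1" by simp_all
  have p1: "norm v powr (- s + 1) = norm v powr (- s) * norm v"
    and p2: "norm v powr (- s) = norm v powr (- s - 1) * norm v"
    and p3: "norm v powr (- s - 1) = norm v powr (- s - 2) * norm v" if "v \<noteq> 0" for v :: 'v
    using powr_times_self[of "norm v" "- s"] powr_times_self[of "norm v" "- s - 1"]
      powr_times_self[of "norm v" "- s - 2"] that unfolding aux by (metis zero_less_norm_iff)+
  have 1: "norm (k v *\<^sub>R v) \<le> (3 * C) * norm v powr (- s + 1)" if "v \<noteq> 0" for v
  proof -
    have "norm (k v *\<^sub>R v) \<le> C * norm v powr (- s) * norm v"
      using k[OF that] by (simp add: mult_right_mono)
    also have "\<dots> \<le> (3 * C) * norm v powr (- s) * norm v"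
      using C by (intro mult_right_mono) auto
    finally show ?thesis using p1[OF that] by simp
  qed
  have 2: "norm (k v *\<^sub>R h + k' v h *\<^sub>R v) \<le> (3 * C) * norm h * norm v powr (- s)"
    if "v \<noteq> 0" for v h
  proof -
    have "norm (k v *\<^sub>R h + k' v h *\<^sub>R v) \<le> \<bar>k v\<bar> * norm h + \<bar>k' v h\<bar> * norm v"
      by (metis norm_scaleR norm_triangle_ineq)
    also have "\<dots> \<le> C * norm v powr (- s) * norm h + C * norm h * norm v powr (- s - 1) * norm v"
      using k[OF that] k'[OF that, of h] by (intro add_mono mult_right_mono) auto
    also have "\<dots> = (2 * C) * norm h * norm v powr (- s)"
      using p2[OF that] by simp
    also have "\<dots> \<le> (3 * C) * norm h * norm v powr (- s)"
      using C by (intro mult_right_mono) auto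
    finally show ?thesis .
  qed
  have 3: "norm (k (v + h) *\<^sub>R (v + h) - k v *\<^sub>R v - (k v *\<^sub>R h + k' v h *\<^sub>R v))
      \<le> (3 * C) * (norm h)\<^sup>2 * norm v powr (- s - 1)"
    if v: "v \<noteq> 0" and h: "norm h \<le> norm v / 2" for v h
  proof -
    let ?e = "k (v + h) - k v - k' v h"
    have "k (v + h) *\<^sub>R (v + h) - k v *\<^sub>R v - (k v *\<^sub>R h + k' v h *\<^sub>R v)
        = ?e *\<^sub>R v + (?e + k' v h) *\<^sub>R h"
      by (simp add: algebra_simps)
    also have "norm \<dots> \<le> \<bar>?e\<bar> * norm v + \<bar>?e + k' v h\<bar> * norm h"
      by (metis norm_scaleR norm_triangle_ineq)
    also have "\<dots> \<le> \<bar>?e\<bar> * norm v + (\<bar>?e\<bar> + \<bar>k' v h\<bar>) * norm h"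
      by (intro add_left_mono mult_right_mono) auto
    also have "\<dots> \<le> \<bar>?e\<bar> * norm v + (\<bar>?e\<bar> * norm v + \<bar>k' v h\<bar> * norm h)"
    proof -
      have "norm h \<le> norm v" using h norm_ge_zero[of v] by linarith
      then have "\<bar>?e\<bar> * norm h \<le> \<bar>?e\<bar> * norm v" by (intro mult_left_mono) auto
      then show ?thesis unfolding distrib_right by linarith
    qed
    also have "\<dots> \<le> 2 * (C * (norm h)\<^sup>2 * norm v powr (- s - 2) * norm v)
        + C * norm h * norm v powr (- s - 1) * norm h"
    proof -
      have "\<bar>?e\<bar> * norm v \<le> C * (norm h)\<^sup>2 * norm v powr (- s - 2) * norm v"
        using rem[OF v h] by (intro mult_right_mono) auto
      moreover have "\<bar>k' v h\<bar> * norm h \<le> C * norm h * norm v powr (- s - 1) * norm h"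
        using k'[OF v, of h] by (intro mult_right_mono) auto
      ultimately show ?thesis by linarith
    qed
    also have "\<dots> = (3 * C) * (norm h)\<^sup>2 * norm v powr (- s - 1)"
      using p3[OF v] by (simp add: power2_eq_square)
    finally show ?thesis .
  qed
  have m: "(\<lambda>(v, h). k v *\<^sub>R h + k' v h *\<^sub>R v) \<in> borel_measurable (borel \<Otimes>\<^sub>M borel)"
    unfolding case_prod_beta by measurable
  have l: "linear (\<lambda>h. k v *\<^sub>R h + k' v h *\<^sub>R v)" for v
    using lin[of v] by (intro linearI) (auto simp: linear_add linear_scale algebra_simps)
  have e: "- (s - 1) = - s + 1" "- s + 1 - 1 = - s" "- s + 1 - 2 = - s - 1" by simp_all
  have m': "(\<lambda>v. k v *\<^sub>R v) \<in> borel_measurable borel" by measurable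
  show ?thesis
    by (rule taylor_kernelI[where C = "3 * C"]) (use 1 2 3 C m m' l in \<open>simp_all only: e\<close>, simp)
qed

section \<open>Weighted integrals of BMO functions\<close>

text \<open>Growth of integrals over dyadic balls like the volume times the logarithm of the radius, as for BMO functions.\<close>

abbreviation dyadic_growth :: "real \<Rightarrow> ('a::euclidean_space \<Rightarrow> real) \<Rightarrow> bool" where
  "dyadic_growth A f \<equiv> (\<forall>k::nat. (\<integral>\<^sup>+y\<in>ball 0 (2 ^ k). ennreal \<bar>f y\<bar> \<partial>lborel) \<le> ennreal (A * real (Suc k) * (2 ^ k) ^ DIM('a)))"

text \<open>Dyadic decomposition: growth of the integrals over \<open>ball 0 (2 ^ k)\<close> by at most a factor \<open>k + 1\<close> more than
  the volume is compensated by the weight, because \<open>\<Sum>k. (k + 1) * 2 powr (k * (d - s))\<close> converges.\<close>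

lemma nn_integral_weight_bound:
  fixes s :: real
  assumes "s > real DIM('a::euclidean_space)"
  shows "\<exists>K\<ge>0. \<forall>(f::'a \<Rightarrow> real) A. f \<in> borel_measurable borel \<longrightarrow> A \<ge> 0 \<longrightarrow>
       dyadic_growth A f \<longrightarrow>
       (\<integral>\<^sup>+y. ennreal (\<bar>f y\<bar> * weight s y) \<partial>lborel) \<le> ennreal (K * A)"
proof -
  define x :: real where "x = 2 powr (real DIM('a) - s)"
  have "x < 2 powr 0" unfolding x_def using assms by (intro powr_less_mono) auto
  then have x: "0 < x" "x < 1" unfolding x_def by auto
  have sm: "summable (\<lambda>k. real (Suc k) * x ^ k)"
    using geometric_deriv_sums[of x] x by (auto intro: sums_summable)
  define K where "K = 2 powr s * (\<Sum>k. real (Suc k) * x ^ k)"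
  have K: "K \<ge> 0" unfolding K_def using x sm by (intro mult_nonneg_nonneg suminf_nonneg) auto
  have xk: "(2 powr (- s)) ^ k * (2 ^ k) ^ DIM('a) = x ^ k" for k
  proof -
    have "(2 ^ k) ^ DIM('a) = ((2::real) ^ DIM('a)) ^ k" by (metis power_mult mult.commute)
    then show ?thesis unfolding x_def
      by (simp add: power_mult_distrib[symmetric] powr_diff powr_realpow powr_minus divide_inverse mult.commute)
  qed
  have pw: "ennreal (weight s y)
      \<le> (\<Sum>k. ennreal (2 powr s * (2 powr (- s)) ^ k) * indicator (ball 0 (2 ^ k)) y)" for y :: 'a
  proof -
    obtain n :: nat where n: "norm y < 2 ^ n" using real_arch_pow[of 2 "norm y"] by auto
    define k where "k = (LEAST n. norm y < 2 ^ n)"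
    have k: "norm y < 2 ^ k" unfolding k_def by (rule LeastI[of _ n]) (rule n)
    have kk: "2 ^ k \<le> 2 * (1 + norm y)"
    proof (cases k)
      case (Suc j)
      have "\<not> norm y < 2 ^ j" using not_less_Least[of j "\<lambda>n. norm y < 2 ^ n"] Suc by (simp add: k_def)
      then show ?thesis using Suc by simp
    qed auto
    have "weight s y \<le> (2 ^ k / 2) powr (- s)"
      using kk assms by (intro powr_mono2') auto
    also have "\<dots> = 2 powr s * (2 powr (- s)) ^ k"
      by (simp add: powr_divide powr_minus_divide powr_power powr_realpow[symmetric] powr_powr mult.commute)
    finally have "ennreal (weight s y) \<le> ennreal (2 powr s * (2 powr (- s)) ^ k) * indicator (ball 0 (2 ^ k)) y"
      using k by (simp add: ennreal_leI)
    also have "\<dots> = (\<Sum>k\<in>{k}. ennreal (2 powr s * (2 powr (- s)) ^ k) * indicator (ball 0 (2 ^ k)) y)"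
      by (simp only: sum.insert finite.emptyI empty_iff sum.empty simp_thms if_False add_0_right)
    also have "\<dots> \<le> (\<Sum>k. ennreal (2 powr s * (2 powr (- s)) ^ k) * indicator (ball 0 (2 ^ k)) y)"
      by (intro sum_le_suminf) auto
    finally show ?thesis .
  qed
  show ?thesis
  proof (intro exI[of _ K] conjI[OF K] allI impI)
    fix f :: "'a \<Rightarrow> real" and A :: real
    assume [measurable]: "f \<in> borel_measurable borel" and A: "A \<ge> 0"
      and b: "dyadic_growth A f"
    have "(\<integral>\<^sup>+y. ennreal (\<bar>f y\<bar> * weight s y) \<partial>lborel)
       \<le> (\<integral>\<^sup>+y. (\<Sum>k. ennreal (2 powr s * (2 powr (- s)) ^ k) * (ennreal \<bar>f y\<bar> * indicator (ball 0 (2 ^ k)) y)) \<partial>lborel)"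
    proof (rule nn_integral_mono)
      fix y :: 'a
      have "ennreal (\<bar>f y\<bar> * weight s y) \<le> ennreal \<bar>f y\<bar> *
          (\<Sum>k. ennreal (2 powr s * (2 powr (- s)) ^ k) * indicator (ball 0 (2 ^ k)) y)"
        using pw[of y] by (simp add: ennreal_mult mult_left_mono)
      then show "ennreal (\<bar>f y\<bar> * weight s y) \<le>
          (\<Sum>k. ennreal (2 powr s * (2 powr (- s)) ^ k) * (ennreal \<bar>f y\<bar> * indicator (ball 0 (2 ^ k)) y))"
        unfolding ennreal_suminf_cmult[symmetric] by (simp only: ac_simps)
    qed
    also have "\<dots> = (\<Sum>k. (\<integral>\<^sup>+y. ennreal (2 powr s * (2 powr (- s)) ^ k) * (ennreal \<bar>f y\<bar> * indicator (ball 0 (2 ^ k)) y) \<partial>lborel))"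
      by (rule nn_integral_suminf) (intro borel_measurable_times_ennreal borel_measurable_const borel_measurable_indicator; simp)
    also have "\<dots> = (\<Sum>k. ennreal (2 powr s * (2 powr (- s)) ^ k) * (\<integral>\<^sup>+y\<in>ball 0 (2 ^ k). ennreal \<bar>f y\<bar> \<partial>lborel))"
      by (intro suminf_cong nn_integral_cmult borel_measurable_times_ennreal borel_measurable_indicator; simp)
    also have "\<dots> \<le> (\<Sum>k. ennreal (2 powr s * (2 powr (- s)) ^ k) * ennreal (A * real (Suc k) * (2 ^ k) ^ DIM('a)))"
      by (intro suminf_le mult_left_mono b[rule_format]) auto
    also have "\<dots> = (\<Sum>k. ennreal (2 powr s * A * (real (Suc k) * x ^ k)))"
      by (intro suminf_cong) (simp add: ennreal_mult'[symmetric] xk[symmetric] ac_simps A)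
    also have "\<dots> = ennreal (K * A)"
    proof (subst suminf_ennreal2)
      show "summable (\<lambda>k. 2 powr s * A * (real (Suc k) * x ^ k))" using sm by (rule summable_mult)
      show "ennreal (\<Sum>k. 2 powr s * A * (real (Suc k) * x ^ k)) = ennreal (K * A)"
        unfolding K_def using sm by (subst suminf_mult) (auto simp: ac_simps)
    qed (use x A in auto)
    finally show "(\<integral>\<^sup>+y. ennreal (\<bar>f y\<bar> * weight s y) \<partial>lborel) \<le> ennreal (K * A)" .
  qed
qed

lemma integrable_of_nn_integral_le:
  assumes "f \<in> borel_measurable M" "\<And>x. f x \<ge> (0::real)" "(\<integral>\<^sup>+x. ennreal (f x) \<partial>M) \<le> ennreal K"
  shows "integrable M f"
  using assms le_less_trans[OF assms(3) ennreal_less_top] by (intro integrableI_nonneg) auto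

lemma integrable_weight:
  fixes s :: real
  assumes "s > real DIM('a::euclidean_space)"
  shows "integrable lborel (\<lambda>y::'a. weight s y)"
proof -
  obtain K where "K \<ge> 0" and K: "\<forall>(f::'a \<Rightarrow> real) A. f \<in> borel_measurable borel \<longrightarrow> A \<ge> 0 \<longrightarrow>
       dyadic_growth A f \<longrightarrow>
       (\<integral>\<^sup>+y. ennreal (\<bar>f y\<bar> * weight s y) \<partial>lborel) \<le> ennreal (K * A)"
    using nn_integral_weight_bound[OF assms] by blast
  define V where "V = measure lborel (ball (0::'a) 1)"
  have le: "(\<integral>\<^sup>+y\<in>ball (0::'a) (2 ^ k). ennreal \<bar>1\<bar> \<partial>lborel) \<le> ennreal (V * real (Suc k) * (2 ^ k) ^ DIM('a))" for k
  proof -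
    have "(\<integral>\<^sup>+y\<in>ball (0::'a) (2 ^ k). ennreal \<bar>1\<bar> \<partial>lborel) = emeasure lborel (ball (0::'a) (2 ^ k))"
      by (simp add: nn_integral_indicator)
    also have "\<dots> = ennreal (measure lborel (ball (0::'a) (2 ^ k)))"
      using emeasure_lborel_ball_finite[of "0::'a" "2 ^ k"] by (intro emeasure_eq_ennreal_measure) auto
    also have "\<dots> = ennreal ((2 ^ k) ^ DIM('a) * V)"
      by (subst content_ball_conv_unit_ball) (auto simp: V_def)
    also have "\<dots> \<le> ennreal (V * real (Suc k) * (2 ^ k) ^ DIM('a))"
      by (intro ennreal_leI) (auto simp: V_def algebra_simps)
    finally show ?thesis .
  qed
  have "(\<integral>\<^sup>+y. ennreal (\<bar>1\<bar> * weight s (y::'a)) \<partial>lborel) \<le> ennreal (K * V)"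
    by (rule K[rule_format, of "\<lambda>_. 1" V, OF _ _ le]) (auto simp: V_def)
  then show ?thesis
    by (intro integrable_of_nn_integral_le) auto
qed

lemma set_integrable_ball:
  "locally_integrable f \<Longrightarrow> set_integrable lborel (ball x r) f"
  unfolding locally_integrable_def
  by (rule set_integrable_subset[of _ "cball x r"]) auto

text \<open>A function with BMO norm at most \<open>A\<close> and mean over the unit ball controlled by \<open>A\<close> has means of size
  \<open>O(A k)\<close> on the ball of radius \<open>2 ^ k\<close>.\<close>

lemma BMO_dyadic_bound:
  fixes f :: "'a::euclidean_space \<Rightarrow> real"
  assumes li: "locally_integrable f" and bmo: "bmo_norm f \<le> ennreal A" and A: "A \<ge> 0"
    and unit: "\<bar>LINT y:ball 0 1|lborel. f y\<bar> \<le> A"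
  shows "(\<integral>\<^sup>+y\<in>ball 0 (2 ^ k). ennreal \<bar>f y\<bar> \<partial>lborel)
    \<le> ennreal ((measure lborel (ball (0::'a) 1) * (1 + 2 ^ DIM('a)) + 1) * A * real (Suc k) * (2 ^ k) ^ DIM('a))"
proof -
  define V where "V k = measure lborel (ball (0::'a) (2 ^ k))" for k :: nat
  define m where "m k = ball_mean 0 (2 ^ k) f" for k :: nat
  have V: "V k = (2 ^ k) ^ DIM('a) * V 0" for k
    unfolding V_def by (subst content_ball_conv_unit_ball) auto
  have V0: "V 0 > 0" by (simp add: V_def)
  have Vpos: "V k > 0" for k by (simp add: V_def)
  have Vs: "V (Suc k) = 2 ^ DIM('a) * V k" for k
    by (simp add: V[of "Suc k"] V[of k] power_mult_distrib)
  have int: "set_integrable lborel (ball (0::'a) (2 ^ k)) f" for k :: nat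
    by (rule set_integrable_ball[OF li])
  have cint: "set_integrable lborel (ball (0::'a) (2 ^ k)) (\<lambda>_. c)" for k :: nat and c :: real
    unfolding set_integrable_def
    using emeasure_lborel_ball_finite[of "0::'a" "2 ^ k"]
    by (intro integrable_scaleR_left integrable_real_indicator) auto
  have fint: "set_integrable lborel (ball (0::'a) (2 ^ k)) (\<lambda>y. f y - c)" for k :: nat and c :: real
    using int cint by (rule set_integral_diff)
  have cval: "(LINT y:ball (0::'a) (2 ^ k)|lborel. c) = V k * c" for k :: nat and c :: real
    unfolding set_lebesgue_integral_def V_def by simp
  have osc: "(LINT y:ball 0 (2 ^ k)|lborel. \<bar>f y - m k\<bar>) \<le> V k * A" for k :: nat
  proof -
    have "ennreal (ball_mean 0 (2 ^ k) (\<lambda>y. \<bar>f y - m k\<bar>)) \<le> bmo_norm f"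
      unfolding bmo_norm_def m_def
      by (rule order_trans[OF _ SUP_upper[of "0::'a"]]) (auto intro: SUP_upper)
    then have "ball_mean 0 (2 ^ k) (\<lambda>y. \<bar>f y - m k\<bar>) \<le> A" using bmo A
      by (meson ennreal_le_iff order_trans)
    then show ?thesis using Vpos[of k] unfolding ball_mean_def V_def[symmetric]
      by (simp add: field_simps)
  qed
  have step: "\<bar>m k - m (Suc k)\<bar> \<le> 2 ^ DIM('a) * A" for k
  proof -
    have sub: "norm y < 2 ^ k \<Longrightarrow> norm y < 2 * 2 ^ k" for y :: 'a by (rule less_le_trans) auto
    have "V k * (m k - m (Suc k)) = (LINT y:ball 0 (2 ^ k)|lborel. f y - m (Suc k))"
      using Vpos[of k] int cint
      by (simp add: set_integral_diff cval) (simp add: m_def ball_mean_def V_def[symmetric] algebra_simps)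
    also have "\<bar>\<dots>\<bar> \<le> (LINT y:ball 0 (2 ^ k)|lborel. \<bar>f y - m (Suc k)\<bar>)"
      using set_integral_norm_bound[OF fint, of k "m (Suc k)"] by simp
    also have "\<dots> \<le> (LINT y:ball 0 (2 ^ Suc k)|lborel. \<bar>f y - m (Suc k)\<bar>)"
      unfolding set_lebesgue_integral_def
      using set_integrable_abs[OF fint, of k "m (Suc k)"] set_integrable_abs[OF fint, of "Suc k" "m (Suc k)"]
      by (intro integral_mono) (auto simp: set_integrable_def indicator_def sub)
    also have "\<dots> \<le> V (Suc k) * A" by (rule osc)
    finally have "V k * \<bar>m k - m (Suc k)\<bar> \<le> V k * (2 ^ DIM('a) * A)"
      using Vpos[of k] unfolding Vs by (simp add: abs_mult ac_simps)
    then show ?thesis using Vpos[of k] by simp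
  qed
  have m0: "\<bar>m 0\<bar> \<le> A / V 0"
    using unit V0 by (simp add: m_def ball_mean_def V_def divide_right_mono)
  have mk: "\<bar>m k\<bar> \<le> A / V 0 + real k * (2 ^ DIM('a) * A)" for k
  proof (induction k)
    case (Suc k)
    have "\<bar>m (Suc k)\<bar> \<le> \<bar>m k\<bar> + 2 ^ DIM('a) * A" using step[of k] by linarith
    then show ?case using Suc by (simp add: algebra_simps)
  qed (use m0 in simp)
  have "(LINT y:ball 0 (2 ^ k)|lborel. \<bar>f y\<bar>) \<le> (LINT y:ball 0 (2 ^ k)|lborel. \<bar>f y - m k\<bar> + \<bar>m k\<bar>)"
    using set_integrable_abs[OF int, of k] set_integral_add(1)[OF set_integrable_abs[OF fint, of k "m k"] cint]
    by (intro set_integral_mono) auto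
  also have "\<dots> = (LINT y:ball 0 (2 ^ k)|lborel. \<bar>f y - m k\<bar>) + V k * \<bar>m k\<bar>"
    by (simp add: set_integral_add(2)[OF set_integrable_abs[OF fint] cint] cval)
  also have "\<dots> \<le> V k * A + V k * (A / V 0 + real k * (2 ^ DIM('a) * A))"
    using osc[of k] mk[of k] Vpos[of k] by (intro add_mono mult_left_mono) auto
  also have "\<dots> = (2 ^ k) ^ DIM('a) * A * (V 0 + 1 + real k * (2 ^ DIM('a) * V 0))"
    using V0 unfolding V[of k] by (simp add: field_simps)
  also have "\<dots> \<le> (2 ^ k) ^ DIM('a) * A * ((V 0 * (1 + 2 ^ DIM('a)) + 1) * real (Suc k))"
  proof (intro mult_left_mono)
    have "0 \<le> V 0 * 2 ^ DIM('a) + V 0 * real k + real k" using V0 by simp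
    then show "V 0 + 1 + real k * (2 ^ DIM('a) * V 0) \<le> (V 0 * (1 + 2 ^ DIM('a)) + 1) * real (Suc k)"
      by (simp add: algebra_simps)
  qed (use A in auto)
  finally have "(LINT y:ball 0 (2 ^ k)|lborel. \<bar>f y\<bar>)
      \<le> (V 0 * (1 + 2 ^ DIM('a)) + 1) * A * real (Suc k) * (2 ^ k) ^ DIM('a)"
    by (simp only: ac_simps)
  moreover have "(\<integral>\<^sup>+y\<in>ball 0 (2 ^ k). ennreal \<bar>f y\<bar> \<partial>lborel) = ennreal (LINT y:ball 0 (2 ^ k)|lborel. \<bar>f y\<bar>)"
    using set_integrable_abs[OF int, of k]
    unfolding set_lebesgue_integral_def set_integrable_def
    by (subst nn_integral_eq_integral[symmetric])
       (auto intro!: nn_integral_cong simp: indicator_def)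
  ultimately show ?thesis by (simp add: V_def ennreal_leI)
qed

text \<open>The weighted \<open>L\<^sup>1\<close> norm is controlled by the BMO norm and the mean over the unit ball, with a constant that
  depends only on the weight. This is how conditions on BMO norms turn into statements about potentials.\<close>

lemma BMO_weighted_bound:
  fixes s :: real
  assumes "s > real DIM('a::euclidean_space)"
  shows "\<exists>K\<ge>0. \<forall>(f::'a \<Rightarrow> real) A. f \<in> borel_measurable borel \<longrightarrow> locally_integrable f \<longrightarrow> A \<ge> 0 \<longrightarrow>
       bmo_norm f \<le> ennreal A \<longrightarrow> \<bar>LINT y:ball 0 1|lborel. f y\<bar> \<le> A \<longrightarrow>
       integrable lborel (\<lambda>y. \<bar>f y\<bar> * weight s y) \<and>
       (LBINT y. \<bar>f y\<bar> * weight s y) \<le> K * A"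
proof -
  obtain K where K0: "K \<ge> 0" and K: "\<forall>(f::'a \<Rightarrow> real) A. f \<in> borel_measurable borel \<longrightarrow> A \<ge> 0 \<longrightarrow>
       dyadic_growth A f \<longrightarrow>
       (\<integral>\<^sup>+y. ennreal (\<bar>f y\<bar> * weight s y) \<partial>lborel) \<le> ennreal (K * A)"
    using nn_integral_weight_bound[OF assms] by blast
  define c where "c = measure lborel (ball (0::'a) 1) * (1 + 2 ^ DIM('a)) + 1"
  have c: "c \<ge> 0" by (simp add: c_def)
  show ?thesis
  proof (intro exI[of _ "K * c"] conjI[OF mult_nonneg_nonneg[OF K0 c]] allI impI)
    fix f :: "'a \<Rightarrow> real" and A :: real
    assume f[measurable]: "f \<in> borel_measurable borel" and li: "locally_integrable f" and A: "A \<ge> 0"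
      and b: "bmo_norm f \<le> ennreal A" "\<bar>LINT y:ball 0 1|lborel. f y\<bar> \<le> A"
    have le: "(\<integral>\<^sup>+y. ennreal (\<bar>f y\<bar> * weight s y) \<partial>lborel) \<le> ennreal (K * (c * A))"
    proof (rule K[rule_format, OF f])
      show "(\<integral>\<^sup>+y\<in>ball 0 (2 ^ k). ennreal \<bar>f y\<bar> \<partial>lborel) \<le> ennreal (c * A * real (Suc k) * (2 ^ k) ^ DIM('a))" for k
        using BMO_dyadic_bound[OF li b(1) A b(2), of k] unfolding c_def .
    qed (use A c in simp)
    have int: "integrable lborel (\<lambda>y. \<bar>f y\<bar> * weight s y)"
      using le by (intro integrable_of_nn_integral_le) auto
    moreover have "(LBINT y. \<bar>f y\<bar> * weight s y) \<le> K * c * A"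
      using le unfolding nn_integral_eq_integral[OF int, simplified] using K0 c A
      by (subst (asm) ennreal_le_iff) (auto simp: mult.assoc)
    ultimately show "integrable lborel (\<lambda>y. \<bar>f y\<bar> * weight s y) \<and>
       (LBINT y. \<bar>f y\<bar> * weight s y) \<le> K * c * A" by blast
  qed
qed

section \<open>Potentials of homogeneous kernels\<close>

lemma norm_integral_le:
  fixes f :: "'a \<Rightarrow> 'c::euclidean_space"
  assumes "integrable M f" "integrable M g" "\<And>x. norm (f x) \<le> g x"
  shows "norm (integral\<^sup>L M f) \<le> integral\<^sup>L M g"
proof -
  have "norm (integral\<^sup>L M f) \<le> (\<integral>x. norm (f x) \<partial>M)" by (rule integral_norm_bound)
  also have "\<dots> \<le> integral\<^sup>L M g" using assms by (intro integral_mono) auto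
  finally show ?thesis .
qed

lemma integrable_dominated:
  fixes f :: "'a \<Rightarrow> 'c::euclidean_space"
  assumes "f \<in> borel_measurable M" "integrable M g" "\<And>x. norm (f x) \<le> g x"
  shows "integrable M f"
proof (rule Bochner_Integration.integrable_bound[OF assms(2,1)])
  show "AE x in M. norm (f x) \<le> norm (g x)"
    using order_trans[OF assms(3) abs_ge_self] by (intro AE_I2) simp
qed

lemma powr_le_weight:
  fixes r w c s :: real
  assumes "c > 0" "w \<ge> 1" "r \<ge> c * w" "s \<ge> 0"
  shows "r powr (- s) \<le> c powr (- s) * w powr (- s)"
proof -
  have "r powr (- s) \<le> (c * w) powr (- s)" using assms by (intro powr_mono2') auto
  then show ?thesis using assms by (simp add: powr_mult)
qed

lemma powr_diff_le:
  fixes r c s :: real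
  assumes "c > 0" "r \<ge> c"
  shows "r powr (- s - 1) \<le> r powr (- s) / c" "r powr (- s - 2) \<le> r powr (- s) / c\<^sup>2"
proof -
  have "r powr (- s) / r \<le> r powr (- s) / c" using assms by (intro divide_left_mono) auto
  then show "r powr (- s - 1) \<le> r powr (- s) / c" using assms by (simp add: powr_diff)
  have "r powr (- s) / r\<^sup>2 \<le> r powr (- s) / c\<^sup>2" using assms by (intro divide_left_mono power_mono) auto
  then show "r powr (- s - 2) \<le> r powr (- s) / c\<^sup>2" using assms by (simp add: powr_diff)
qed

lemma
  fixes g :: "'a::euclidean_space \<Rightarrow> 'v::euclidean_space" and f :: "'a \<Rightarrow> real"
    and k :: "'v \<Rightarrow> 'c::euclidean_space"
  assumes tk: "taylor_kernel s k k'" and s: "s \<ge> 0"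
    and g[measurable]: "g \<in> borel_measurable borel" and f[measurable]: "f \<in> borel_measurable borel"
    and c: "c > 0" and low: "\<And>y. norm (x - g y) \<ge> c * (1 + norm y)"
    and int: "integrable lborel (\<lambda>y. \<bar>f y\<bar> * weight s y)"
  shows integrable_kernel: "integrable lborel (\<lambda>y. f y *\<^sub>R k (x - g y))"
    and integrable_kernel_deriv: "integrable lborel (\<lambda>y. f y *\<^sub>R k' (x - g y) h)"
proof -
  obtain C where [measurable]: "k \<in> borel_measurable borel"
    "(\<lambda>(v, h). k' v h) \<in> borel_measurable (borel \<Otimes>\<^sub>M borel)"
    and C: "C \<ge> 0" and b0: "\<And>v. v \<noteq> 0 \<Longrightarrow> norm (k v) \<le> C * norm v powr (- s)"
    and b1: "\<And>v h. v \<noteq> 0 \<Longrightarrow> norm (k' v h) \<le> C * norm h * norm v powr (- s - 1)"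
    using tk unfolding taylor_kernel_def by blast
  have lc: "norm (x - g y) \<ge> c" for y
    using order_trans[OF _ low, of c y] c by (simp add: distrib_left)
  have nz: "x - g y \<noteq> 0" for y using lc[of y] c by auto
  have w: "norm (x - g y) powr (- s) \<le> c powr (- s) * weight s y" for y
    using c low s by (intro powr_le_weight) auto
  have p0: "norm (k (x - g y)) \<le> C * c powr (- s) * weight s y" for y
    using b0[OF nz[of y]] mult_left_mono[OF w[of y] C] by (simp add: mult.assoc)
  have p1: "norm (k' (x - g y) h) \<le> (C * norm h / c) * c powr (- s) * weight s y" for y
  proof -
    have "norm (k' (x - g y) h) \<le> C * norm h * (norm (x - g y) powr (- s) / c)"
      using b1[OF nz[of y], of h] mult_left_mono[OF powr_diff_le(1)[OF c lc[of y], of s], of "C * norm h"] C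
      by simp
    also have "\<dots> \<le> C * norm h * (c powr (- s) * weight s y / c)"
      using C c w[of y] by (intro mult_left_mono divide_right_mono) auto
    finally show ?thesis by (simp add: ac_simps)
  qed
  have dom: "integrable lborel (\<lambda>y. K * (\<bar>f y\<bar> * weight s y))" for K
    using int by simp
  show "integrable lborel (\<lambda>y. f y *\<^sub>R k (x - g y))"
  proof (rule integrable_dominated[OF _ dom[of "C * c powr (- s)"]])
    show "norm (f y *\<^sub>R k (x - g y)) \<le> C * c powr (- s) * (\<bar>f y\<bar> * weight s y)" for y
      using mult_left_mono[OF p0[of y] abs_ge_zero[of "f y"]] by (simp add: ac_simps)
  qed measurable
  have "(\<lambda>y. (\<lambda>(v, h). k' v h) (x - g y, h)) \<in> borel_measurable borel" by measurable
  then have [measurable]: "(\<lambda>y. k' (x - g y) h) \<in> borel_measurable borel" by simp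
  show "integrable lborel (\<lambda>y. f y *\<^sub>R k' (x - g y) h)"
  proof (rule integrable_dominated[OF _ dom[of "(C * norm h / c) * c powr (- s)"]])
    show "norm (f y *\<^sub>R k' (x - g y) h) \<le> (C * norm h / c) * c powr (- s) * (\<bar>f y\<bar> * weight s y)" for y
      using mult_left_mono[OF p1[of y] abs_ge_zero[of "f y"]] by (simp add: ac_simps)
  qed measurable
qed

text \<open>Differentiation under the integral sign. The hypothesis \<open>norm (x - g y) \<ge> c * (1 + norm y)\<close> both keeps \<open>x\<close> away
  from the range of \<open>g\<close> and makes the kernel decay like the weight.\<close>

lemma has_derivative_kernel_integral:
  fixes g :: "'a::euclidean_space \<Rightarrow> 'v::euclidean_space" and f :: "'a \<Rightarrow> real"
    and k :: "'v \<Rightarrow> 'c::euclidean_space"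
  assumes tk: "taylor_kernel s k k'" and s: "s \<ge> 0"
    and g[measurable]: "g \<in> borel_measurable borel" and f[measurable]: "f \<in> borel_measurable borel"
    and c: "c > 0" and low: "\<And>y. norm (x - g y) \<ge> c * (1 + norm y)"
    and int: "integrable lborel (\<lambda>y. \<bar>f y\<bar> * weight s y)"
  shows "((\<lambda>x. LBINT y. f y *\<^sub>R k (x - g y)) has_derivative
           (\<lambda>h. LBINT y. f y *\<^sub>R k' (x - g y) h)) (at x)"
proof -
  obtain C where lin: "\<And>v. linear (k' v)"
    and C: "C \<ge> 0" 
    and b2: "\<And>v h. v \<noteq> 0 \<Longrightarrow> norm h \<le> norm v / 2 \<Longrightarrow>
       norm (k (v + h) - k v - k' v h) \<le> C * (norm h)\<^sup>2 * norm v powr (- s - 2)"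
    using tk unfolding taylor_kernel_def by blast
  define F where "F x = (LBINT y. f y *\<^sub>R k (x - g y))" for x
  define D where "D h = (LBINT y. f y *\<^sub>R k' (x - g y) h)" for h
  have i0: "integrable lborel (\<lambda>y. f y *\<^sub>R k (x - g y))"
    by (rule integrable_kernel[OF tk s g f c low int])
  have i1: "integrable lborel (\<lambda>y. f y *\<^sub>R k' (x - g y) h)" for h
    by (rule integrable_kernel_deriv[OF tk s g f c low int])
  have lc: "norm (x - g y) \<ge> c" for y
    using order_trans[OF _ low, of c y] c by (simp add: distrib_left)
  have nz: "x - g y \<noteq> 0" for y using lc[of y] c by auto
  have "linear D"
  proof (rule linearI)
    show "D (a + b) = D a + D b" for a b
      unfolding D_def linear_add[OF lin] scaleR_add_right by (rule Bochner_Integration.integral_add[OF i1 i1])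
    show "D (r *\<^sub>R a) = r *\<^sub>R D a" for r a
      unfolding D_def linear_scale[OF lin] scaleR_left_commute[of _ r] by (rule integral_scaleR_right)
  qed
  then have bl: "bounded_linear D" by (simp add: linear_conv_bounded_linear)
  define K where "K = C * (c powr (- s) / c\<^sup>2) * (LBINT y. \<bar>f y\<bar> * weight s y)"
  have rem: "norm (F (x + h) - F x - D h) \<le> K * (norm h)\<^sup>2" if h: "norm h \<le> c / 2" for h
  proof -
    have "norm (x + h - g y) \<ge> (c / 2) * (1 + norm y)" for y
    proof -
      have "norm (x + h - g y) \<ge> norm (x - g y) - norm h"
        using norm_diff_ineq[of "x - g y" h] by (simp add: algebra_simps)
      moreover have "c / 2 \<le> c / 2 * (1 + norm y)" using c by (simp add: distrib_left)
      ultimately show ?thesis using low[of y] h by (simp add: algebra_simps)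
    qed
    then have i2: "integrable lborel (\<lambda>y. f y *\<^sub>R k (x + h - g y))"
      using c by (intro integrable_kernel[OF tk s g f _ _ int, of "c / 2"]) auto
    have "F (x + h) - F x - D h = (LBINT y. f y *\<^sub>R k (x + h - g y) - f y *\<^sub>R k (x - g y) - f y *\<^sub>R k' (x - g y) h)"
      unfolding F_def D_def using i0 i1 i2 by simp
    also have "norm \<dots> \<le> (LBINT y. C * (norm h)\<^sup>2 * (c powr (- s) / c\<^sup>2) * (\<bar>f y\<bar> * weight s y))"
    proof (rule norm_integral_le)
      fix y :: 'a
      have "norm h \<le> norm (x - g y) / 2" using h lc[of y] by simp
      then have "norm (k ((x - g y) + h) - k (x - g y) - k' (x - g y) h)
          \<le> C * (norm h)\<^sup>2 * norm (x - g y) powr (- s - 2)" by (rule b2[OF nz])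
      also have "\<dots> \<le> C * (norm h)\<^sup>2 * (norm (x - g y) powr (- s) / c\<^sup>2)"
        using C powr_diff_le(2)[OF c lc] by (intro mult_left_mono) auto
      also have "\<dots> \<le> C * (norm h)\<^sup>2 * (c powr (- s) * weight s y / c\<^sup>2)"
        using C c powr_le_weight[OF c _ low s, of y] by (intro mult_left_mono divide_right_mono) auto
      finally have "\<bar>f y\<bar> * norm (k ((x - g y) + h) - k (x - g y) - k' (x - g y) h)
          \<le> \<bar>f y\<bar> * (C * (norm h)\<^sup>2 * (c powr (- s) * weight s y / c\<^sup>2))"
        by (rule mult_left_mono) simp
      moreover have "f y *\<^sub>R k (x + h - g y) - f y *\<^sub>R k (x - g y) - f y *\<^sub>R k' (x - g y) h
          = f y *\<^sub>R (k ((x - g y) + h) - k (x - g y) - k' (x - g y) h)"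
        by (simp add: scaleR_diff_right algebra_simps)
      ultimately show "norm (f y *\<^sub>R k (x + h - g y) - f y *\<^sub>R k (x - g y) - f y *\<^sub>R k' (x - g y) h)
          \<le> C * (norm h)\<^sup>2 * (c powr (- s) / c\<^sup>2) * (\<bar>f y\<bar> * weight s y)"
        by (simp add: ac_simps)
    qed (use i0 i1 i2 int in simp_all)
    also have "\<dots> = K * (norm h)\<^sup>2" by (simp add: K_def)
    finally show ?thesis .
  qed
  have "((\<lambda>h. norm (F (x + h) - F x - D h) / norm h) \<longlongrightarrow> 0) (at 0)"
  proof (rule tendsto_sandwich[where f = "\<lambda>_. 0" and h = "\<lambda>h. K * norm h"])
    show "((\<lambda>h. K * norm h) \<longlongrightarrow> 0) (at (0::'v))"
      by (rule tendsto_eq_intros refl | simp)+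
    have "eventually (\<lambda>h. norm h < c / 2) (at (0::'v))"
      unfolding eventually_at by (rule exI[of _ "c / 2"]) (use c in auto)
    then show "eventually (\<lambda>h. norm (F (x + h) - F x - D h) / norm h \<le> K * norm h) (at 0)"
    proof eventually_elim
      case (elim h)
      show ?case
      proof (cases "h = 0")
        case False
        then show ?thesis using rem[of h] elim by (simp add: divide_simps power2_eq_square)
      qed simp
    qed
  qed auto
  then have "(F has_derivative D) (at x)" unfolding has_derivative_at using bl by blast
  then show ?thesis unfolding F_def D_def .
qed

section \<open>First-order expansion along a family of graphs\<close>

text \<open>Off \<open>\<real>\<^sup>d\<close> the distance to \<open>(y, 0)\<close> is comparable to \<open>1 + norm y\<close>, and this persists for the points of a graph
  of small slope.\<close>

lemma base_point_weight:
  fixes p y :: "'a::euclidean_space" and z :: "'b::euclidean_space"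
  assumes "z \<noteq> 0"
  defines "c \<equiv> norm z / (1 + norm p + norm z)"
  shows "c > 0" "c * (1 + norm y) \<le> norm (p - y, z)"
proof -
  have D: "1 + norm p + norm z > 0" by (intro add_pos_nonneg) auto
  then show "c > 0" using assms by (simp add: c_def)
  define r where "r = norm (p - y, z)"
  have r: "norm z \<le> r" "norm (p - y) \<le> r"
    unfolding r_def using norm_snd_le[of z "p - y"] norm_fst_le[of "p - y" z] by auto
  have "norm y \<le> norm p + norm (p - y)" by (metis norm_triangle_sub norm_minus_commute)
  then have "norm z * (1 + norm y) \<le> norm z * (1 + norm p + r)"
    using r by (intro mult_left_mono) auto
  also have "\<dots> = norm z * (1 + norm p) + norm z * r" by (simp add: algebra_simps)
  also have "\<dots> \<le> r * (1 + norm p) + norm z * r"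
    using r by (intro add_right_mono mult_right_mono) auto
  also have "\<dots> = r * (1 + norm p + norm z)" by (simp add: algebra_simps)
  finally show "c * (1 + norm y) \<le> norm (p - y, z)"
    unfolding c_def r_def[symmetric] using D by (simp add: divide_simps)
qed

lemma graph_point_weight:
  fixes p y :: "'a::euclidean_space" and z v :: "'b::euclidean_space"
  assumes c: "c > 0" "c * (1 + norm y) \<le> norm (p - y, z)" and v: "norm v \<le> \<delta> * (1 + norm y)" and "2 * \<delta> \<le> c"
  shows "norm v \<le> (\<delta> / c) * norm (p - y, z)" "norm v \<le> norm (p - y, z) / 2"
    "(c / 2) * (1 + norm y) \<le> norm ((p, z) - (y, v))"
proof -
  have w: "1 + norm y > 0" by (intro add_pos_nonneg) auto
  have "0 \<le> \<delta> * (1 + norm y)" using v norm_ge_zero order_trans by blast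
  then have d: "\<delta> \<ge> 0" using w by (simp add: zero_le_mult_iff)
  have "\<delta> / c * (c * (1 + norm y)) \<le> \<delta> / c * norm (p - y, z)"
    using c d by (intro mult_left_mono) auto
  then show 1: "norm v \<le> (\<delta> / c) * norm (p - y, z)" using v c by simp
  also have "\<dots> \<le> (1 / 2) * norm (p - y, z)"
    using c assms(4) by (intro mult_right_mono) (auto simp: divide_simps)
  finally show 2: "norm v \<le> norm (p - y, z) / 2" by simp
  have "norm (p - y, z) - norm v \<le> norm ((p - y, z) - (0, v))"
    using norm_triangle_ineq2[of "(p - y, z)" "(0::'a, v)"] by (simp add: norm_Pair)
  then show "(c / 2) * (1 + norm y) \<le> norm ((p, z) - (y, v))"
    using 2 c(2) by simp
qed

lemma integrable_norm_diff_weight: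
  fixes f g :: "'a::euclidean_space \<Rightarrow> 'b::euclidean_space" and w :: "'a \<Rightarrow> real"
  assumes [measurable]: "f \<in> borel_measurable borel" "g \<in> borel_measurable borel" "w \<in> borel_measurable borel"
    and f: "integrable lborel (\<lambda>y. norm (f y) * w y)" and g: "integrable lborel (\<lambda>y. norm (g y) * w y)"
    and w: "\<And>y. w y \<ge> 0"
  shows "integrable lborel (\<lambda>y. norm (f y - t *\<^sub>R g y) * w y)"
proof (rule integrable_dominated)
  show "integrable lborel (\<lambda>y. norm (f y) * w y + \<bar>t\<bar> * (norm (g y) * w y))" using f g by simp
  fix y
  have "norm (f y - t *\<^sub>R g y) * w y \<le> (norm (f y) + \<bar>t\<bar> * norm (g y)) * w y"
    using norm_triangle_ineq4[of "f y" "t *\<^sub>R g y"] w by (intro mult_right_mono) auto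
  then show "norm (norm (f y - t *\<^sub>R g y) * w y) \<le> norm (f y) * w y + \<bar>t\<bar> * (norm (g y) * w y)"
    using w[of y] by (simp add: distrib_right mult.assoc)
qed measurable

text \<open>The form in which the hypotheses on \<open>\<phi>\<close> and \<open>\<psi>\<close> are used: \<open>F t = O(t)\<close> and \<open>F t = t F' + o(t)\<close> as \<open>t \<rightarrow> 0\<close> from the right, in every
  weighted space \<open>L\<^sup>1((1 + |y|) powr (- s) dy)\<close> with \<open>s > d\<close>.\<close>

definition weighted_derivative ::
  "real \<Rightarrow> (real \<Rightarrow> 'a::euclidean_space \<Rightarrow> 'c::euclidean_space) \<Rightarrow> ('a \<Rightarrow> 'c) \<Rightarrow> bool" where
  "weighted_derivative t0 F F' \<longleftrightarrow>
     (\<forall>t\<in>{0<..<t0}. F t \<in> borel_measurable borel) \<and> F' \<in> borel_measurable borel \<and>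
     (\<forall>s > real DIM('a).
        (\<exists>M. \<forall>t\<in>{0<..<t0}. weighted_integrable s (F t) \<and>
           weighted_norm s (F t) \<le> M * t) \<and>
        weighted_integrable s F' \<and>
        ((\<lambda>t. weighted_norm s (\<lambda>y. F t y - t *\<^sub>R F' y) / t) \<longlongrightarrow> 0) (at_right 0))"

text \<open>First-order expansion in \<open>t\<close> of the integral of a kernel over the graph of \<open>\<psi> t\<close> with density \<open>1 + \<phi> t\<close>. Since
  \<open>\<psi> t\<close> has size \<open>O(t (1 + |y|))\<close>, the Taylor remainder of the kernel and the product of \<open>\<phi> t\<close> with the increment of the
  kernel are \<open>O(t\<^sup>2)\<close> in total; the two linear terms are handled by the weighted \<open>L\<^sup>1\<close> differentiability.\<close>

lemma
  fixes p :: "'a::euclidean_space" and z :: "'b::euclidean_space"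
    and \<phi> :: "real \<Rightarrow> 'a \<Rightarrow> real" and \<psi> :: "real \<Rightarrow> 'a \<Rightarrow> 'b" and k :: "'a \<times> 'b \<Rightarrow> 'c::euclidean_space"
  assumes tk: "taylor_kernel s k k'" and sd: "s > real DIM('a)" and z: "z \<noteq> 0" and t0: "t0 > 0" and B: "B \<ge> 0"
    and w\<phi>: "weighted_derivative t0 \<phi> \<phi>'" and w\<psi>: "weighted_derivative t0 \<psi> \<psi>'"
    and growth: "\<forall>t\<in>{0<..<t0}. \<forall>y. norm (\<psi> t y) \<le> B * t * (1 + norm y)"
  shows integrable_linear_term: "integrable lborel (\<lambda>y. k' ((p, z) - (y, 0)) (0, \<psi>' y))" (is ?int)
    and family_expansion: "((\<lambda>t. ((LBINT y. (1 + \<phi> t y) *\<^sub>R k ((p, z) - (y, \<psi> t y))) - (LBINT y. k ((p, z) - (y, 0)))) /\<^sub>R t)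
     \<longlongrightarrow> (LBINT y. \<phi>' y *\<^sub>R k ((p, z) - (y, 0))) - (LBINT y. k' ((p, z) - (y, 0)) (0, \<psi>' y))) (at_right 0)" (is ?lim)
proof -
  have s: "s \<ge> 0" using sd by simp
  have w: "integrable lborel (\<lambda>y::'a. weight s y)" using sd by (rule integrable_weight)
  have [measurable]: "\<phi>' \<in> borel_measurable borel" "\<psi>' \<in> borel_measurable borel"
    using w\<phi> w\<psi> unfolding weighted_derivative_def by simp_all
  have \<phi>m: "\<phi> t \<in> borel_measurable borel" and \<psi>m: "\<psi> t \<in> borel_measurable borel" if "t \<in> {0<..<t0}" for t
    using w\<phi> w\<psi> that unfolding weighted_derivative_def by simp_all
  obtain M where M: "\<forall>t\<in>{0<..<t0}. weighted_integrable s (\<phi> t) \<and>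
           weighted_norm s (\<phi> t) \<le> M * t"
    using w\<phi> sd unfolding weighted_derivative_def by blast
  have \<phi>int: "integrable lborel (\<lambda>y. \<bar>\<phi> t y\<bar> * weight s y)" and \<phi>M: "(LBINT y. \<bar>\<phi> t y\<bar> * weight s y) \<le> M * t"
    if "t \<in> {0<..<t0}" for t
    using M that by simp_all
  have "\<forall>t\<in>{0<..<t0}. weighted_integrable s (\<psi> t)"
    using w\<psi> sd unfolding weighted_derivative_def by blast
  then have \<psi>int: "weighted_integrable s (\<psi> t)" if "t \<in> {0<..<t0}" for t using that by blast
  have \<psi>B: "norm (\<psi> t y) \<le> B * t * (1 + norm y)" if "t \<in> {0<..<t0}" for t y using growth that by blast
  have \<phi>'int: "integrable lborel (\<lambda>y. \<bar>\<phi>' y\<bar> * weight s y)"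
    and \<psi>'int: "weighted_integrable s \<psi>'"
    and \<phi>lim: "((\<lambda>t. (LBINT y. \<bar>\<phi> t y - t * \<phi>' y\<bar> * weight s y) / t) \<longlongrightarrow> 0) (at_right 0)"
    and \<psi>lim: "((\<lambda>t. weighted_norm s (\<lambda>y. \<psi> t y - t *\<^sub>R \<psi>' y) / t) \<longlongrightarrow> 0) (at_right 0)"
    using w\<phi> w\<psi> sd unfolding weighted_derivative_def by simp_all
  obtain C where [measurable]: "k \<in> borel_measurable borel"
    "(\<lambda>(v, h). k' v h) \<in> borel_measurable (borel \<Otimes>\<^sub>M borel)" and lin: "\<And>v. linear (k' v)"
    and C: "C \<ge> 0" and b0: "\<And>v. v \<noteq> 0 \<Longrightarrow> norm (k v) \<le> C * norm v powr (- s)"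
    and b1: "\<And>v h. v \<noteq> 0 \<Longrightarrow> norm (k' v h) \<le> C * norm h * norm v powr (- s - 1)"
    and b2: "\<And>v h. v \<noteq> 0 \<Longrightarrow> norm h \<le> norm v / 2 \<Longrightarrow>
       norm (k (v + h) - k v - k' v h) \<le> C * (norm h)\<^sup>2 * norm v powr (- s - 2)"
    using tk unfolding taylor_kernel_def by blast
  define c where "c = norm z / (1 + norm p + norm z)"
  define u where "u y = (p - y, z)" for y
  have c: "c > 0" and low: "\<And>y. c * (1 + norm y) \<le> norm (u y)"
    unfolding c_def u_def using base_point_weight[OF z] by auto
  have lc: "c \<le> norm (u y)" for y
    using order_trans[OF _ low, of c y] c by (simp add: distrib_left)
  have nz: "u y \<noteq> 0" and nu: "norm (u y) > 0" for y using lc[of y] c by auto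
  have um[measurable]: "u \<in> borel_measurable borel" unfolding u_def by measurable
  have wu: "norm (u y) powr (- s) \<le> c powr (- s) * weight s y" for y
    using c low s by (intro powr_le_weight) auto
  have k'm: "(\<lambda>y. k' (u y) (0, h y)) \<in> borel_measurable borel" if [measurable]: "h \<in> borel_measurable borel" for h
  proof -
    have "(\<lambda>y. (\<lambda>(v, h). k' v h) (u y, (0, h y))) \<in> borel_measurable borel" by measurable
    then show ?thesis by simp
  qed
  define K where "K = C * c powr (- s)"
  have K: "K \<ge> 0" using C by (simp add: K_def)
  define W where "W = (LBINT y. weight s (y::'a))"
  define N1 where "N1 t = (LBINT y. \<bar>\<phi> t y - t * \<phi>' y\<bar> * weight s y)" for t
  define N2 where "N2 t = weighted_norm s (\<lambda>y. \<psi> t y - t *\<^sub>R \<psi>' y)" for t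
  define I where "I t = (LBINT y. (1 + \<phi> t y) *\<^sub>R k ((p, z) - (y, \<psi> t y)))" for t
  define I0 where "I0 = (LBINT y. k (u y))"
  define I1 where "I1 = (LBINT y. \<phi>' y *\<^sub>R k (u y))"
  define I2 where "I2 = (LBINT y. k' (u y) (0, \<psi>' y))"
  define G where "G t = K * ((B / c)\<^sup>2 * t * (W + M * t) + N1 t / t + N2 t / t / c + M * t * (B / c))" for t
  have ub0: "norm (k (u y)) \<le> K * weight s y" for y
    using b0[OF nz[of y]] mult_left_mono[OF wu[of y] C] by (simp add: K_def mult.assoc)
  have ub1: "norm (k' (u y) h) \<le> K * norm h / c * weight s y" for y h
  proof -
    have "norm (k' (u y) h) \<le> C * norm h * (norm (u y) powr (- s) / c)"
      using b1[OF nz[of y], of h] mult_left_mono[OF powr_diff_le(1)[OF c lc[of y], of s], of "C * norm h"] C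
      by simp
    also have "\<dots> \<le> C * norm h * (c powr (- s) * weight s y / c)"
      using C c wu[of y] by (intro mult_left_mono divide_right_mono) auto
    finally show ?thesis by (simp add: K_def ac_simps)
  qed
  have ik: "integrable lborel (\<lambda>y. k (u y))"
    by (rule integrable_dominated[OF _ _ ub0]) (use w in simp_all)
  have i\<phi>': "integrable lborel (\<lambda>y. \<phi>' y *\<^sub>R k (u y))"
  proof (rule integrable_dominated)
    show "integrable lborel (\<lambda>y::'a. K * (\<bar>\<phi>' y\<bar> * weight s y))" using \<phi>'int by simp
    show "norm (\<phi>' y *\<^sub>R k (u y)) \<le> K * (\<bar>\<phi>' y\<bar> * weight s y)" for y
      using mult_left_mono[OF ub0[of y] abs_ge_zero[of "\<phi>' y"]] by (simp add: ac_simps)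
  qed measurable
  have i\<psi>': "integrable lborel (\<lambda>y. k' (u y) (0, \<psi>' y))"
  proof (rule integrable_dominated)
    show "integrable lborel (\<lambda>y::'a. K / c * (norm (\<psi>' y) * weight s y))" using \<psi>'int by simp
    show "norm (k' (u y) (0, \<psi>' y)) \<le> K / c * (norm (\<psi>' y) * weight s y)" for y
      using ub1[of y "(0, \<psi>' y)"] by (simp add: norm_Pair)
  qed (use k'm in simp)
  have main: "norm ((I t - I0) /\<^sub>R t - (I1 - I2)) \<le> G t" if t: "t \<in> {0<..<t0}" and ts: "2 * (B * t) \<le> c" for t
  proof -
    note [measurable] = \<phi>m[OF t] \<psi>m[OF t]
    have tp: "t > 0" using t by simp
    have pt: "norm (\<psi> t y) \<le> (B * t / c) * norm (u y)" "norm (\<psi> t y) \<le> norm (u y) / 2"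
      "(c / 2) * (1 + norm y) \<le> norm ((p, z) - (y, \<psi> t y))" for y
      using graph_point_weight[OF c low[unfolded u_def] \<psi>B[OF t] ts] unfolding u_def by auto
    have i1\<phi>: "integrable lborel (\<lambda>y. \<bar>1 + \<phi> t y\<bar> * weight s y)"
      using integrable_norm_diff_weight[of "\<lambda>_. 1" "\<phi> t" "\<lambda>y. weight s y" "-1"] w \<phi>int[OF t] by simp
    have iI: "integrable lborel (\<lambda>y. (1 + \<phi> t y) *\<^sub>R k ((p, z) - (y, \<psi> t y)))"
      using c by (intro integrable_kernel[OF tk s _ _ _ pt(3) i1\<phi>]) auto
    have d1: "integrable lborel (\<lambda>y. \<bar>\<phi> t y - t * \<phi>' y\<bar> * weight s y)"
      using integrable_norm_diff_weight[of "\<phi> t" \<phi>' "\<lambda>y. weight s y" t] \<phi>'int \<phi>int[OF t] by simp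
    have d2: "weighted_integrable s (\<lambda>y. \<psi> t y - t *\<^sub>R \<psi>' y)"
      using integrable_norm_diff_weight[of "\<psi> t" \<psi>' "\<lambda>y. weight s y" t] \<psi>'int \<psi>int[OF t] by simp
    let ?J = "\<lambda>y. (1 + \<phi> t y) *\<^sub>R k ((p, z) - (y, \<psi> t y)) - k (u y) - t *\<^sub>R (\<phi>' y *\<^sub>R k (u y)) + t *\<^sub>R k' (u y) (0, \<psi>' y)"
    let ?H = "\<lambda>y. K * ((B * t / c)\<^sup>2 * (weight s y + \<bar>\<phi> t y\<bar> * weight s y)
        + \<bar>\<phi> t y - t * \<phi>' y\<bar> * weight s y
        + norm (\<psi> t y - t *\<^sub>R \<psi>' y) * weight s y / c
        + \<bar>\<phi> t y\<bar> * weight s y * (B * t / c))"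
    have eq: "I t - I0 - t *\<^sub>R (I1 - I2) = (LBINT y. ?J y)"
    proof -
      have "(LBINT y. A y - B y - t *\<^sub>R C y + t *\<^sub>R D y)
          = integral\<^sup>L lborel A - integral\<^sup>L lborel B - t *\<^sub>R integral\<^sup>L lborel C + t *\<^sub>R integral\<^sup>L lborel D"
        if "integrable lborel A" "integrable lborel B" "integrable lborel C" "integrable lborel D"
        for A B C D :: "'a \<Rightarrow> 'c"
        using that by simp
      from this[OF iI ik i\<phi>' i\<psi>'] show ?thesis
        unfolding I_def I0_def I1_def I2_def by (simp add: scaleR_diff_right)
    qed
    have "norm (I t - I0 - t *\<^sub>R (I1 - I2)) \<le> (LBINT y. ?H y)"
      unfolding eq
    proof (rule norm_integral_le)
      show "integrable lborel ?J"
        by (intro Bochner_Integration.integrable_add Bochner_Integration.integrable_diff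
            integrable_scaleR_right iI ik i\<phi>' i\<psi>')
      show "integrable lborel ?H" using w \<phi>int[OF t] d1 d2 by simp
      fix y :: 'a
      define v where "v = (0::'a, \<psi> t y)"
      define R where "R = k (u y + - v) - k (u y) - k' (u y) (- v)"
      define \<omega> where "\<omega> = weight s y"
      have \<omega>: "\<omega> \<ge> 0" by (simp add: \<omega>_def)
      have nv: "norm v = norm (\<psi> t y)" by (simp add: v_def norm_Pair)
      have uv: "(p, z) - (y, \<psi> t y) = u y + - v" by (simp add: u_def v_def)
      \<comment> \<open>quadratic remainder, two linear errors, and the mixed term\<close>
      have e: "?J y = (1 + \<phi> t y) *\<^sub>R R + (\<phi> t y - t * \<phi>' y) *\<^sub>R k (u y)
          - k' (u y) (0, \<psi> t y - t *\<^sub>R \<psi>' y) - \<phi> t y *\<^sub>R k' (u y) v"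
      proof -
        have "(0, \<psi> t y - t *\<^sub>R \<psi>' y) = v - t *\<^sub>R (0, \<psi>' y)" by (simp add: v_def)
        then have "k' (u y) (0, \<psi> t y - t *\<^sub>R \<psi>' y) = k' (u y) v - t *\<^sub>R k' (u y) (0, \<psi>' y)"
          by (simp only: linear_diff[OF lin] linear_scale[OF lin])
        moreover have "k' (u y) (- v) = - k' (u y) v" by (rule linear_neg[OF lin])
        ultimately show ?thesis unfolding uv R_def by (simp add: algebra_simps)
      qed
      have Rb: "norm R \<le> K * (B * t / c)\<^sup>2 * \<omega>"
      proof -
        have "norm R \<le> C * (norm (- v))\<^sup>2 * norm (u y) powr (- s - 2)"
          unfolding R_def using pt(2)[of y] by (intro b2[OF nz]) (simp add: nv)
        also have "\<dots> \<le> C * ((B * t / c) * norm (u y))\<^sup>2 * norm (u y) powr (- s - 2)"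
          using C pt(1)[of y] by (intro mult_right_mono mult_left_mono power_mono) (auto simp: nv)
        also have "\<dots> = C * (B * t / c)\<^sup>2 * norm (u y) powr (- s)"
          using nu[of y] by (simp add: powr_diff power_mult_distrib power_divide)
        also have "\<dots> \<le> C * (B * t / c)\<^sup>2 * (c powr (- s) * \<omega>)"
          unfolding \<omega>_def using C wu by (intro mult_left_mono) auto
        finally show ?thesis by (simp add: K_def ac_simps)
      qed
      have vb: "norm (k' (u y) v) \<le> K * (B * t / c) * \<omega>"
      proof -
        have "norm (k' (u y) v) \<le> C * norm v * norm (u y) powr (- s - 1)" by (rule b1[OF nz])
        also have "\<dots> \<le> C * ((B * t / c) * norm (u y)) * norm (u y) powr (- s - 1)"
          using C pt(1)[of y] by (intro mult_right_mono mult_left_mono) (auto simp: nv)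
        also have "\<dots> = C * (B * t / c) * norm (u y) powr (- s)"
          using nu[of y] by (simp add: powr_diff)
        also have "\<dots> \<le> C * (B * t / c) * (c powr (- s) * \<omega>)"
          unfolding \<omega>_def using C c B tp wu by (intro mult_left_mono) auto
        finally show ?thesis by (simp add: K_def ac_simps)
      qed
      have "norm (?J y) \<le> \<bar>1 + \<phi> t y\<bar> * norm R + \<bar>\<phi> t y - t * \<phi>' y\<bar> * norm (k (u y))
          + norm (k' (u y) (0, \<psi> t y - t *\<^sub>R \<psi>' y)) + \<bar>\<phi> t y\<bar> * norm (k' (u y) v)"
      proof -
        have "norm (a + b - d - e) \<le> norm a + norm b + norm d + norm e" for a b d e :: 'c
          using norm_triangle_ineq4[of "a + b - d" e] norm_triangle_ineq4[of "a + b" d] norm_triangle_ineq[of a b]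
          by linarith
        from this[of "(1 + \<phi> t y) *\<^sub>R R" "(\<phi> t y - t * \<phi>' y) *\<^sub>R k (u y)"
            "k' (u y) (0, \<psi> t y - t *\<^sub>R \<psi>' y)" "\<phi> t y *\<^sub>R k' (u y) v"]
        show ?thesis unfolding e by simp
      qed
      also have "\<dots> \<le> (1 + \<bar>\<phi> t y\<bar>) * (K * (B * t / c)\<^sup>2 * \<omega>) + \<bar>\<phi> t y - t * \<phi>' y\<bar> * (K * \<omega>)
          + K * norm (\<psi> t y - t *\<^sub>R \<psi>' y) / c * \<omega> + \<bar>\<phi> t y\<bar> * (K * (B * t / c) * \<omega>)"
      proof (intro add_mono)
        have "\<bar>1 + \<phi> t y\<bar> * norm R \<le> (1 + \<bar>\<phi> t y\<bar>) * norm R"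
          by (rule mult_right_mono) auto
        also have "\<dots> \<le> (1 + \<bar>\<phi> t y\<bar>) * (K * (B * t / c)\<^sup>2 * \<omega>)"
          using Rb by (rule mult_left_mono) simp
        finally show "\<bar>1 + \<phi> t y\<bar> * norm R \<le> (1 + \<bar>\<phi> t y\<bar>) * (K * (B * t / c)\<^sup>2 * \<omega>)" .
        show "\<bar>\<phi> t y - t * \<phi>' y\<bar> * norm (k (u y)) \<le> \<bar>\<phi> t y - t * \<phi>' y\<bar> * (K * \<omega>)"
          using ub0[of y] unfolding \<omega>_def by (rule mult_left_mono) simp
        show "norm (k' (u y) (0, \<psi> t y - t *\<^sub>R \<psi>' y)) \<le> K * norm (\<psi> t y - t *\<^sub>R \<psi>' y) / c * \<omega>"
          using ub1[of y "(0, \<psi> t y - t *\<^sub>R \<psi>' y)"] unfolding \<omega>_def norm_Pair by simp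
        show "\<bar>\<phi> t y\<bar> * norm (k' (u y) v) \<le> \<bar>\<phi> t y\<bar> * (K * (B * t / c) * \<omega>)"
          using vb by (rule mult_left_mono) simp
      qed
      also have "\<dots> = ?H y"
      proof -
        have "(1 + a) * (K * X * w) + d * (K * w) + K * e / c * w + a * (K * Y * w)
            = K * (X * (w + a * w) + d * w + e * w / c + a * w * Y)" for a d e w X Y :: real
          by (simp add: algebra_simps)
        then show ?thesis unfolding \<omega>_def .
      qed
      finally show "norm (?J y) \<le> ?H y" .
    qed
    also have "\<dots> = K * ((B * t / c)\<^sup>2 * (W + (LBINT y. \<bar>\<phi> t y\<bar> * weight s y)) + N1 t + N2 t / c
        + (LBINT y. \<bar>\<phi> t y\<bar> * weight s y) * (B * t / c))"
    proof -
      have "(LBINT y. K * (X * (A y + F y) + D1 y + D2 y / c + F y * Y))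
          = K * (X * (integral\<^sup>L lborel A + integral\<^sup>L lborel F) + integral\<^sup>L lborel D1
              + integral\<^sup>L lborel D2 / c + integral\<^sup>L lborel F * Y)"
        if "integrable lborel A" "integrable lborel F" "integrable lborel D1" "integrable lborel D2"
        for A F D1 D2 :: "'a \<Rightarrow> real" and X Y
        using that by simp
      from this[OF w \<phi>int[OF t] d1 d2] show ?thesis unfolding W_def N1_def N2_def .
    qed
    also have "\<dots> \<le> K * ((B * t / c)\<^sup>2 * (W + M * t) + N1 t + N2 t / c + (M * t) * (B * t / c))"
      using \<phi>M[OF t] K B c tp by (intro mult_left_mono add_mono mult_right_mono) auto
    also have "\<dots> = t * G t"
      unfolding G_def using tp by (simp add: field_simps power2_eq_square)
    finally have "norm (I t - I0 - t *\<^sub>R (I1 - I2)) \<le> t * G t" .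
    moreover have "(I t - I0) /\<^sub>R t - (I1 - I2) = (I t - I0 - t *\<^sub>R (I1 - I2)) /\<^sub>R t"
      using tp by (simp add: scaleR_diff_right)
    ultimately show ?thesis using tp by (simp add: divide_simps) (simp add: mult.commute)
  qed
  have "(G \<longlongrightarrow> K * ((B / c)\<^sup>2 * 0 * (W + M * 0) + 0 + 0 / c + M * 0 * (B / c))) (at_right 0)"
    unfolding G_def using \<phi>lim \<psi>lim c
    by (intro tendsto_intros) (auto simp: N1_def N2_def)
  then have G0: "(G \<longlongrightarrow> 0) (at_right 0)" by simp
  have "min t0 (c / (2 * B + 1)) > 0" using t0 c B by simp
  then have "eventually (\<lambda>t. t < min t0 (c / (2 * B + 1))) (at_right 0)" "eventually (\<lambda>t::real. t > 0) (at_right 0)"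
    unfolding eventually_at_right_field by (intro exI[of _ "min t0 (c / (2 * B + 1))"], simp)+
  then have ev: "eventually (\<lambda>t. norm ((I t - I0) /\<^sub>R t - (I1 - I2)) \<le> G t) (at_right 0)"
  proof eventually_elim
    case (elim t)
    have "(2 * B + 1) * t < c" using elim B by (simp add: divide_simps mult.commute)
    then have "2 * (B * t) \<le> c" using elim by (simp add: algebra_simps)
    then show ?case using elim by (intro main) auto
  qed
  have "((\<lambda>t. (I t - I0) /\<^sub>R t - (I1 - I2)) \<longlongrightarrow> 0) (at_right 0)"
    by (rule Lim_null_comparison[OF ev G0])
  then have "((\<lambda>t. (I t - I0) /\<^sub>R t) \<longlongrightarrow> I1 - I2) (at_right 0)" by (simp add: LIM_zero_iff)
  then show ?lim
    unfolding I_def I0_def I1_def I2_def u_def by simp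
  show ?int
    using i\<psi>' unfolding u_def by simp
qed

section \<open>The equation as an identity between potentials\<close>

text \<open>With \<open>D = R powr (- 1 / \<alpha>)\<close> and \<open>V = \<nabla>R\<close>, the flux \<open>D powr q * \<nabla>D\<close> is a constant times \<open>R powr \<beta> * \<nabla>R\<close> with
  \<open>\<beta> = - (q + 1) / \<alpha> - 1\<close>, so that vanishing divergence means \<open>R * \<Delta>R + \<beta> * |\<nabla>R|\<^sup>2 = 0\<close>.\<close>

lemma elliptic_flux_equation:
  fixes R D :: "'v::euclidean_space \<Rightarrow> real" and V :: "'v \<Rightarrow> 'v"
  assumes S: "open S" "x \<in> S" and pos: "\<And>y. y \<in> S \<Longrightarrow> R y > 0" and \<alpha>: "\<alpha> \<noteq> 0"
    and dR: "\<And>y. y \<in> S \<Longrightarrow> (R has_derivative (\<lambda>h. V y \<bullet> h)) (at y)"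
    and dV: "(V has_derivative V') (at x)"
    and D: "\<And>y. D y = R y powr (- 1 / \<alpha>)"
    and eq: "divergence (\<lambda>z. D z powr q *\<^sub>R gradient D z) x = 0"
  shows "R x * (\<Sum>b\<in>Basis. V' b \<bullet> b) + (- (q + 1) / \<alpha> - 1) * (V x \<bullet> V x) = 0"
proof -
  define \<beta> where "\<beta> = - (q + 1) / \<alpha> - 1"
  define c where "c = - 1 / \<alpha>"
  have c: "c \<noteq> 0" using \<alpha> by (simp add: c_def)
  have fld: "D y powr q *\<^sub>R gradient D y = (c * R y powr \<beta>) *\<^sub>R V y" if y: "y \<in> S" for y
  proof -
    have "(D has_derivative (\<lambda>h. c * R y powr (c - 1) * (V y \<bullet> h))) (at y)"
      unfolding D[abs_def] c_def[symmetric]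
      using pos[OF y] by (auto intro!: derivative_eq_intros dR[OF y] simp: powr_diff field_simps)
    then have "frechet_derivative D (at y) = (\<lambda>h. c * R y powr (c - 1) * (V y \<bullet> h))"
      by (rule frechet_derivative_at[symmetric])
    then have "gradient D y = (\<Sum>b\<in>Basis. (c * R y powr (c - 1)) *\<^sub>R ((V y \<bullet> b) *\<^sub>R b))"
      unfolding gradient_def by simp
    also have "\<dots> = (c * R y powr (c - 1)) *\<^sub>R V y"
      by (simp only: scaleR_sum_right[symmetric] euclidean_representation)
    finally have g: "gradient D y = (c * R y powr (c - 1)) *\<^sub>R V y" .
    have "c * q + (c - 1) = \<beta>" using \<alpha> by (simp add: \<beta>_def c_def field_simps)
    then have "D y powr q * R y powr (c - 1) = R y powr \<beta>"
      unfolding D c_def[symmetric] by (simp add: powr_powr powr_add[symmetric])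
    then show ?thesis unfolding g by (simp add: ac_simps)
  qed
  have "((\<lambda>z. (c * R z powr \<beta>) *\<^sub>R V z) has_derivative
      (\<lambda>h. (c * R x powr \<beta>) *\<^sub>R V' h + (c * (\<beta> * R x powr (\<beta> - 1) * (V x \<bullet> h))) *\<^sub>R V x)) (at x)"
    using pos[OF S(2)] by (auto intro!: derivative_eq_intros dR[OF S(2)] dV simp: powr_diff field_simps)
  then have "((\<lambda>z. D z powr q *\<^sub>R gradient D z) has_derivative
      (\<lambda>h. (c * R x powr \<beta>) *\<^sub>R V' h + (c * (\<beta> * R x powr (\<beta> - 1) * (V x \<bullet> h))) *\<^sub>R V x)) (at x)"
    by (rule has_derivative_transform_within_open[OF _ S]) (simp add: fld)
  then have "frechet_derivative (\<lambda>z. D z powr q *\<^sub>R gradient D z) (at x)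
      = (\<lambda>h. (c * R x powr \<beta>) *\<^sub>R V' h + (c * (\<beta> * R x powr (\<beta> - 1) * (V x \<bullet> h))) *\<^sub>R V x)"
    by (rule frechet_derivative_at[symmetric])
  then have "0 = (\<Sum>b\<in>Basis. c * R x powr \<beta> * (V' b \<bullet> b) + c * \<beta> * R x powr (\<beta> - 1) * ((V x \<bullet> b) * (V x \<bullet> b)))"
    using eq unfolding divergence_def by (simp add: inner_add_left ac_simps)
  also have "\<dots> = c * R x powr \<beta> * (\<Sum>b\<in>Basis. V' b \<bullet> b) + c * \<beta> * R x powr (\<beta> - 1) * (V x \<bullet> V x)"
    unfolding euclidean_inner[of "V x" "V x"] by (simp add: sum.distrib sum_distrib_left)
  also have "\<dots> = c * R x powr (\<beta> - 1) * (R x * (\<Sum>b\<in>Basis. V' b \<bullet> b) + \<beta> * (V x \<bullet> V x))"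
    using pos[OF S(2)] by (simp add: powr_diff field_simps)
  finally have "R x * (\<Sum>b\<in>Basis. V' b \<bullet> b) + \<beta> * (V x \<bullet> V x) = 0"
    using c pos[OF S(2)] by simp
  then show ?thesis by (simp add: \<beta>_def)
qed

lemma integrable_weight_mono:
  fixes f :: "'a::euclidean_space \<Rightarrow> real"
  assumes [measurable]: "f \<in> borel_measurable borel"
    and "integrable lborel (\<lambda>y. \<bar>f y\<bar> * weight s y)" "s \<le> s'"
  shows "integrable lborel (\<lambda>y. \<bar>f y\<bar> * (1 + norm y) powr (- s'))"
proof (rule Bochner_Integration.integrable_bound[OF assms(2)])
  show "AE y in lborel. norm (\<bar>f y\<bar> * (1 + norm y) powr (- s')) \<le> norm (\<bar>f y\<bar> * weight s y)"
    using assms(3) by (intro AE_I2) (auto intro!: mult_left_mono powr_mono)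
qed measurable

text \<open>The equation at one point, in terms of integrals. The Laplacian of \<open>|v| powr (- a)\<close> is
  \<open>a * (a + 2 - n) * |v| powr (- a - 2)\<close>, and \<open>n - a - 2 = \<alpha> * \<beta>\<close> for the exponent \<open>\<beta>\<close> of the flux. The factor \<open>\<beta>\<close>, which is nonzero
  exactly when \<open>\<alpha> \<noteq> n - d - 2\<close>, cancels. The constant \<open>C\<close> cancels by homogeneity.\<close>

lemma graph_identity:
  fixes g :: "'a::euclidean_space \<Rightarrow> 'v::euclidean_space" and f :: "'a \<Rightarrow> real" and \<alpha> d C c :: real
  defines "a \<equiv> d + \<alpha>"
  assumes d: "d \<ge> 0" and \<alpha>: "\<alpha> > 0" "\<alpha> \<noteq> real DIM('v) - d - 2"
    and g[measurable]: "g \<in> borel_measurable borel" and f[measurable]: "f \<in> borel_measurable borel"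
    and c: "c > 0" and low: "\<And>y. norm (x - g y) \<ge> c * (1 + norm y)"
    and int: "integrable lborel (\<lambda>y. \<bar>f y\<bar> * weight a y)"
    and C: "C > 0" and D: "\<And>z. D z = (C * (LBINT y. f y * norm (z - g y) powr (- a))) powr (- 1 / \<alpha>)"
    and pos: "(LBINT y. f y * norm (x - g y) powr (- a)) > 0"
    and eq: "divergence (\<lambda>z. D z powr (- real DIM('v) + d + 1) *\<^sub>R gradient D z) x = 0"
  defines "V \<equiv> LBINT y. f y *\<^sub>R (norm (x - g y) powr (- (a + 2)) *\<^sub>R (x - g y))"
  shows "a * (V \<bullet> V) = \<alpha> * ((LBINT y. f y * norm (x - g y) powr (- a)) *
            (LBINT y. f y * norm (x - g y) powr (- (a + 2))))"
proof -
  have a: "a > 0" using d \<alpha> by (simp add: a_def)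
  define R where "R z = C * (LBINT y. f y * norm (z - g y) powr (- a))" for z
  define W where "W z = (LBINT y. f y *\<^sub>R (norm (z - g y) powr (- (a + 2)) *\<^sub>R (z - g y)))" for z
  define I2 where "I2 = (LBINT y. f y * norm (x - g y) powr (- (a + 2)))"
  let ?k' = "\<lambda>(v::'v) h. norm v powr (- (a + 2)) *\<^sub>R h + (- (a + 2) * norm v powr (- (a + 2) - 2) * (v \<bullet> h)) *\<^sub>R v"
  have tk0: "taylor_kernel a (\<lambda>v::'v. norm v powr (- a)) (\<lambda>v h. - a * norm v powr (- a - 2) * (v \<bullet> h))"
    using a by (intro taylor_kernel_norm_powr) simp
  have tk2: "taylor_kernel (a + 2) (\<lambda>v::'v. norm v powr (- (a + 2))) (\<lambda>v h. - (a + 2) * norm v powr (- (a + 2) - 2) * (v \<bullet> h))"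
    using a by (intro taylor_kernel_norm_powr) simp
  have tk1: "taylor_kernel (a + 1) (\<lambda>v::'v. norm v powr (- (a + 2)) *\<^sub>R v) ?k'"
  proof -
    have "a + 2 - 1 = a + 1" by simp
    then show ?thesis using taylor_kernel_scaleR[OF tk2] by (simp only:)
  qed
  have int1: "integrable lborel (\<lambda>y. \<bar>f y\<bar> * weight (a + 1) y)"
    and int2: "integrable lborel (\<lambda>y. \<bar>f y\<bar> * weight (a + 2) y)"
    by (rule integrable_weight_mono[OF f int], simp)+
  have lowS: "norm (z - g y) \<ge> c / 2 * (1 + norm y)" if z: "z \<in> ball x (c / 2)" for z y
  proof -
    have "norm (x - g y) \<le> norm (x - z) + norm (z - g y)"
      using norm_triangle_ineq[of "x - z" "z - g y"] by simp
    moreover have "c / 2 \<le> c / 2 * (1 + norm y)" using c by (simp add: distrib_left)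
    moreover have "norm (x - z) < c / 2" using z by (simp add: dist_norm)
    ultimately show ?thesis using low[of y] by (simp add: algebra_simps)
  qed
  have c2: "c / 2 > 0" using c by simp
  have dR: "(R has_derivative (\<lambda>h. ((- a * C) *\<^sub>R W z) \<bullet> h)) (at z)" if z: "z \<in> ball x (c / 2)" for z
  proof -
    have "((\<lambda>x. LBINT y. f y *\<^sub>R norm (x - g y) powr (- a)) has_derivative
        (\<lambda>h. LBINT y. f y *\<^sub>R (- a * norm (z - g y) powr (- a - 2) * ((z - g y) \<bullet> h)))) (at z)"
      using a by (intro has_derivative_kernel_integral[OF tk0 _ g f c2 lowS[OF z] int]) auto
    from has_derivative_mult_right[OF this, of C]
    have 1: "(R has_derivative
        (\<lambda>h. C * (LBINT y. f y * (- a * norm (z - g y) powr (- a - 2) * ((z - g y) \<bullet> h))))) (at z)"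
      unfolding R_def real_scaleR_def .
    have iW: "integrable lborel (\<lambda>y. f y *\<^sub>R (norm (z - g y) powr (- (a + 2)) *\<^sub>R (z - g y)))"
      using a by (intro integrable_kernel[OF tk1 _ g f c2 lowS[OF z] int1]) auto
    have e: "- (a + 2) = - a - 2" by simp
    have eqn: "C * (LBINT y. f y * (- a * norm (z - g y) powr (- a - 2) * ((z - g y) \<bullet> h)))
        = ((- a * C) *\<^sub>R W z) \<bullet> h" for h
    proof -
      have "W z \<bullet> h = (LBINT y. (f y *\<^sub>R (norm (z - g y) powr (- (a + 2)) *\<^sub>R (z - g y))) \<bullet> h)"
        unfolding W_def using iW by (intro integral_inner_left[symmetric])
      then have "((- a * C) *\<^sub>R W z) \<bullet> h
          = (LBINT y. (- a * C) * ((f y *\<^sub>R (norm (z - g y) powr (- (a + 2)) *\<^sub>R (z - g y))) \<bullet> h))"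
        by (simp only: inner_scaleR_left integral_mult_right_zero)
      also have "\<dots> = (LBINT y. C * (f y * (- a * norm (z - g y) powr (- a - 2) * ((z - g y) \<bullet> h))))"
        unfolding e by (intro Bochner_Integration.integral_cong) (simp_all add: inner_diff_left algebra_simps)
      also have "\<dots> = C * (LBINT y. f y * (- a * norm (z - g y) powr (- a - 2) * ((z - g y) \<bullet> h)))"
        by (rule integral_mult_right_zero)
      finally show ?thesis by (rule sym)
    qed
    show ?thesis using 1 unfolding eqn .
  qed
  have xb: "x \<in> ball x (c / 2)" using c by simp
  have "(W has_derivative (\<lambda>h. LBINT y. f y *\<^sub>R ?k' (x - g y) h)) (at x)"
    unfolding W_def using a by (intro has_derivative_kernel_integral[OF tk1 _ g f c low int1]) auto
  then have dV: "((\<lambda>z. (- a * C) *\<^sub>R W z) has_derivative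
      (\<lambda>h. (- a * C) *\<^sub>R (LBINT y. f y *\<^sub>R ?k' (x - g y) h))) (at x)"
    by (rule has_derivative_scaleR_right)
  have ik': "integrable lborel (\<lambda>y. f y *\<^sub>R ?k' (x - g y) h)" for h
    using a by (intro integrable_kernel_deriv[OF tk1 _ g f c low int1]) auto
  have "continuous_on (ball x (c / 2)) R"
    by (rule has_derivative_continuous_on, rule has_derivative_at_withinI, rule dR)
  then have opn: "open (ball x (c / 2) \<inter> R -` {0<..})"
    by (rule continuous_open_preimage) auto
  have Rx: "R x > 0" unfolding R_def using C pos by simp
  have trace: "(\<Sum>b\<in>Basis. ((- a * C) *\<^sub>R (LBINT y. f y *\<^sub>R ?k' (x - g y) b)) \<bullet> b)
      = - a * C * ((real DIM('v) - a - 2) * I2)"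
  proof -
    have "(\<Sum>b\<in>Basis. (LBINT y. f y *\<^sub>R ?k' (x - g y) b) \<bullet> b)
        = (\<Sum>b\<in>Basis. (LBINT y. (f y *\<^sub>R ?k' (x - g y) b) \<bullet> b))"
      using ik' by (intro sum.cong refl) (rule integral_inner_left[symmetric], simp)
    also have "\<dots> = (LBINT y. (\<Sum>b\<in>Basis. (f y *\<^sub>R ?k' (x - g y) b) \<bullet> b))"
      using ik' by (intro Bochner_Integration.integral_sum[symmetric] integrable_inner_left) auto
    also have "\<dots> = (LBINT y. (real DIM('v) - a - 2) * (f y * norm (x - g y) powr (- (a + 2))))"
    proof (intro Bochner_Integration.integral_cong refl)
      fix y
      define v where "v = x - g y"
      have "c * (1 + norm y) > 0" using c by (intro mult_pos_pos add_pos_nonneg) auto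
      then have v: "norm v > 0" using low[of y] unfolding v_def by linarith
      have e: "norm v powr (- (a + 2) - 2) * (v \<bullet> v) = norm v powr (- (a + 2))"
      proof -
        have "norm v powr (- (a + 2) - 2) = norm v powr (- (a + 2)) / norm v powr 2" by (rule powr_diff)
        also have "norm v powr 2 = v \<bullet> v" using v by (simp add: power2_norm_eq_inner)
        finally show ?thesis using v by (simp only: nonzero_eq_divide_eq inner_eq_zero_iff norm_eq_zero zero_less_norm_iff not_False_eq_True)
      qed
      have "(\<Sum>b\<in>Basis. (f y *\<^sub>R ?k' v b) \<bullet> b)
          = (\<Sum>b\<in>(Basis::'v set). f y * norm v powr (- (a + 2)) - f y * (a + 2) * norm v powr (- (a + 2) - 2) * ((v \<bullet> b) * (v \<bullet> b)))"
        by (intro sum.cong refl) (simp add: inner_add_left inner_Basis algebra_simps)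
      also have "\<dots> = real DIM('v) * (f y * norm v powr (- (a + 2)))
          - f y * (a + 2) * (norm v powr (- (a + 2) - 2) * (v \<bullet> v))"
        unfolding euclidean_inner[of v v] by (simp add: sum_subtractf sum_distrib_left mult.assoc)
      also have "\<dots> = (real DIM('v) - a - 2) * (f y * norm v powr (- (a + 2)))"
        unfolding e by (simp add: algebra_simps)
      finally show "(\<Sum>b\<in>Basis. (f y *\<^sub>R ?k' (x - g y) b) \<bullet> b)
          = (real DIM('v) - a - 2) * (f y * norm (x - g y) powr (- (a + 2)))" unfolding v_def .
    qed
    also have "\<dots> = (real DIM('v) - a - 2) * I2" unfolding I2_def by simp
    finally show ?thesis by (simp only: inner_scaleR_left sum_distrib_left[symmetric])
  qed
  have "R x * (- a * C * ((real DIM('v) - a - 2) * I2)) +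
      (- ((- real DIM('v) + d + 1) + 1) / \<alpha> - 1) * (((- a * C) *\<^sub>R W x) \<bullet> ((- a * C) *\<^sub>R W x)) = 0"
    unfolding trace[symmetric]
    by (rule elliptic_flux_equation[OF opn _ _ _ dR dV _ eq]) (use xb Rx \<alpha> D R_def in auto)
  moreover have "- ((- real DIM('v) + d + 1) + 1) / \<alpha> - 1 = (real DIM('v) - a - 2) / \<alpha>"
    using \<alpha> by (simp add: a_def field_simps)
  moreover have "((- a * C) *\<^sub>R W x) \<bullet> ((- a * C) *\<^sub>R W x) = (a * C)\<^sup>2 * (W x \<bullet> W x)"
    by (simp only: inner_scaleR_left inner_scaleR_right power2_eq_square mult_minus_left mult_minus_right minus_minus ac_simps)
  ultimately have e0: "R x * (- a * C * ((real DIM('v) - a - 2) * I2)) +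
      ((real DIM('v) - a - 2) / \<alpha>) * ((a * C)\<^sup>2 * (W x \<bullet> W x)) = 0"
    by (simp only:)
  have "\<alpha> * (r * (- a * C * (K * I)) + (K / \<alpha>) * ((a * C)\<^sup>2 * X)) = (K * (a * C)) * (a * C * X - \<alpha> * (r * I))"
    for K X r I
  proof -
    have "\<alpha> * ((K / \<alpha>) * ((a * C)\<^sup>2 * X)) = K * ((a * C)\<^sup>2 * X)" using \<alpha>(1) by simp
    then show ?thesis unfolding distrib_left by (simp add: right_diff_distrib power2_eq_square)
  qed
  from this[of "R x" "real DIM('v) - a - 2" I2 "W x \<bullet> W x"]
  have "((real DIM('v) - a - 2) * (a * C)) * (a * C * (W x \<bullet> W x) - \<alpha> * (R x * I2)) = 0"
    unfolding e0 mult_zero_right by (rule sym)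
  then have "(real DIM('v) - a - 2) * (a * C) = 0 \<or> a * C * (W x \<bullet> W x) - \<alpha> * (R x * I2) = 0"
    by (rule iffD1[OF mult_eq_0_iff])
  moreover have "(real DIM('v) - a - 2) * (a * C) \<noteq> 0" using a C \<alpha> by (simp add: a_def)
  ultimately have "a * C * (W x \<bullet> W x) - \<alpha> * (R x * I2) = 0" by blast
  then have "a * C * (W x \<bullet> W x) = \<alpha> * (R x * I2)" by (simp only: right_minus_eq)
  then have "C * (a * (W x \<bullet> W x)) = C * (\<alpha> * ((LBINT y. f y * norm (x - g y) powr (- a)) * I2))"
    unfolding R_def by (simp only: ac_simps)
  moreover have "V = W x" unfolding V_def W_def ..
  moreover have "C \<noteq> 0" using C by simp
  ultimately show ?thesis unfolding I2_def[symmetric] using mult_left_cancel by blast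
qed

section \<open>Hausdorff measure on Euclidean space\<close>

text \<open>Uniqueness of translation-invariant measures: both sides are the integral of
  \<open>indicator A x * indicator B (y + x)\<close> over \<open>M \<Otimes>\<^sub>M lborel\<close>.\<close>

lemma translation_invariant_eq_lborel:
  fixes M :: "'a::euclidean_space measure"
  assumes sets: "sets M = sets borel" and sf: "sigma_finite_measure M"
    and inv: "\<And>v. distr M borel ((+) v) = M" and A[measurable]: "A \<in> sets borel" and B[measurable]: "B \<in> sets borel"
  shows "emeasure M A * emeasure lborel B = emeasure lborel A * emeasure M B"
proof -
  interpret M: sigma_finite_measure M by fact
  interpret P: pair_sigma_finite M lborel ..
  have [measurable_cong]: "sets M = sets borel" by fact
  have sh: "(\<integral>\<^sup>+x. f (x + y) \<partial>M) = (\<integral>\<^sup>+x. f x \<partial>M)" if [measurable]: "f \<in> borel_measurable borel" for f and y :: 'a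
  proof -
    have "(\<integral>\<^sup>+x. f x \<partial>M) = (\<integral>\<^sup>+x. f x \<partial>distr M borel ((+) y))" by (simp add: inv)
    also have "\<dots> = (\<integral>\<^sup>+x. f (y + x) \<partial>M)" by (subst nn_integral_distr) auto
    finally show ?thesis by (simp add: add.commute)
  qed
  have shl: "(\<integral>\<^sup>+y. f (y + x) \<partial>lborel) = (\<integral>\<^sup>+y. f y \<partial>lborel)" if [measurable]: "f \<in> borel_measurable borel" for f and x :: 'a
  proof -
    have "(\<integral>\<^sup>+y. f y \<partial>lborel) = (\<integral>\<^sup>+y. f y \<partial>distr lborel borel ((+) x))" by (simp add: lborel_distr_plus)
    also have "\<dots> = (\<integral>\<^sup>+y. f (x + y) \<partial>lborel)" by (subst nn_integral_distr) auto
    finally show ?thesis by (simp add: add.commute)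
  qed
  have refl: "(\<integral>\<^sup>+y. f (x - y) \<partial>lborel) = (\<integral>\<^sup>+y. f y \<partial>lborel)" if [measurable]: "f \<in> borel_measurable borel" for f and x :: 'a
  proof -
    have "(\<integral>\<^sup>+y. f y \<partial>lborel) = (\<integral>\<^sup>+y. f (x + (-1) *\<^sub>R y) \<partial>lborel)"
      by (subst lborel_affine[of "-1" x]) (auto simp: nn_integral_density nn_integral_distr)
    then show ?thesis by simp
  qed
  have "emeasure M A * emeasure lborel B = (\<integral>\<^sup>+x. indicator A x * emeasure lborel B \<partial>M)"
    by (simp add: nn_integral_multc)
  also have "\<dots> = (\<integral>\<^sup>+x. \<integral>\<^sup>+y. indicator A x * indicator B (y + x) \<partial>lborel \<partial>M)"
  proof (rule nn_integral_cong)
    fix x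
    have "(\<integral>\<^sup>+y. indicator A x * indicator B (y + x) \<partial>lborel) = indicator A x * (\<integral>\<^sup>+y. indicator B (y + x) \<partial>lborel)"
      by (rule nn_integral_cmult) measurable
    also have "(\<integral>\<^sup>+y. indicator B (y + x) \<partial>lborel) = (\<integral>\<^sup>+y. indicator B y \<partial>lborel)"
      by (rule shl) measurable
    finally show "indicator A x * emeasure lborel B = (\<integral>\<^sup>+y. indicator A x * indicator B (y + x) \<partial>lborel)" by simp
  qed
  also have "\<dots> = (\<integral>\<^sup>+y. \<integral>\<^sup>+x. indicator A x * indicator B (y + x) \<partial>M \<partial>lborel)"
    by (rule P.Fubini'[symmetric]) measurable
  also have "\<dots> = (\<integral>\<^sup>+y. \<integral>\<^sup>+x. indicator A (x - y) * indicator B x \<partial>M \<partial>lborel)"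
  proof (rule nn_integral_cong)
    fix y :: 'a
    have "(\<integral>\<^sup>+x. (\<lambda>x. indicator A (x - y) * indicator B x) (x + y) \<partial>M) = (\<integral>\<^sup>+x. indicator A (x - y) * indicator B x \<partial>M)"
      by (rule sh) measurable
    then show "(\<integral>\<^sup>+x. indicator A x * indicator B (y + x) \<partial>M) = (\<integral>\<^sup>+x. indicator A (x - y) * indicator B x \<partial>M)"
      by (simp add: add.commute)
  qed
  also have "\<dots> = (\<integral>\<^sup>+x. \<integral>\<^sup>+y. indicator A (x - y) * indicator B x \<partial>lborel \<partial>M)"
    by (rule P.Fubini') measurable
  also have "\<dots> = (\<integral>\<^sup>+x. emeasure lborel A * indicator B x \<partial>M)"
  proof (rule nn_integral_cong)
    fix x :: 'a
    have "(\<integral>\<^sup>+y. indicator A (x - y) * indicator B x \<partial>lborel) = (\<integral>\<^sup>+y. indicator A (x - y) \<partial>lborel) * indicator B x"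
      by (rule nn_integral_multc) measurable
    also have "(\<integral>\<^sup>+y. indicator A (x - y) \<partial>lborel) = (\<integral>\<^sup>+y. indicator A y \<partial>lborel)"
      by (rule refl) measurable
    finally show "(\<integral>\<^sup>+y. indicator A (x - y) * indicator B x \<partial>lborel) = emeasure lborel A * indicator B x" by simp
  qed
  also have "\<dots> = emeasure lborel A * emeasure M B" by (simp add: nn_integral_cmult)
  finally show ?thesis .
qed

lemma diameter_translate: "diameter ((+) v ` U) = diameter (U :: 'a::euclidean_space set)"
proof -
  have "(\<lambda>x. dist (fst x) (snd x)) ` (((+) v ` U) \<times> ((+) v ` U)) = (\<lambda>x. dist (fst x) (snd x)) ` (U \<times> U)"
    by (force simp: image_iff)
  then show ?thesis unfolding diameter_def by (simp add: case_prod_beta)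
qed

lemma hausdorff_content_translate_le:
  "hausdorff_content s \<delta> ((+) v ` A) \<le> hausdorff_content s \<delta> (A :: 'a::euclidean_space set)"
  unfolding hausdorff_content_def
proof (rule INF_greatest)
  fix U :: "nat \<Rightarrow> 'a set"
  assume U: "U \<in> {U. A \<subseteq> (\<Union>i. U i) \<and> (\<forall>i. bounded (U i) \<and> diameter (U i) \<le> \<delta>)}"
  have "(\<lambda>i. (+) v ` U i) \<in> {U. (+) v ` A \<subseteq> (\<Union>i. U i) \<and> (\<forall>i. bounded (U i) \<and> diameter (U i) \<le> \<delta>)}"
  proof -
    have "(+) v ` A \<subseteq> (\<Union>i. (+) v ` U i)" unfolding image_UN[symmetric] using U by (intro image_mono) auto
    then show ?thesis using U by (simp add: diameter_translate bounded_translation)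
  qed
  then show "(INF U\<in>{U. (+) v ` A \<subseteq> (\<Union>i. U i) \<and> (\<forall>i. bounded (U i) \<and> diameter (U i) \<le> \<delta>)}.
      \<Sum>i. ennreal (unit_ball_vol s * (diameter (U i) / 2) powr s))
      \<le> (\<Sum>i. ennreal (unit_ball_vol s * (diameter (U i) / 2) powr s))"
    by (rule INF_lower2) (simp add: diameter_translate)
qed

lemma hausdorff_outer_translate:
  "hausdorff_outer s ((+) v ` A) = hausdorff_outer s (A :: 'a::euclidean_space set)"
proof (rule antisym)
  have le: "hausdorff_outer s ((+) v ` A) \<le> hausdorff_outer s A" for v and A :: "'a set"
    unfolding hausdorff_outer_def by (intro SUP_mono) (use hausdorff_content_translate_le in blast)
  show "hausdorff_outer s ((+) v ` A) \<le> hausdorff_outer s A" by (rule le)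
  have "hausdorff_outer s ((+) (- v) ` ((+) v ` A)) \<le> hausdorff_outer s ((+) v ` A)" by (rule le)
  then show "hausdorff_outer s A \<le> hausdorff_outer s ((+) v ` A)" by (simp add: image_image)
qed

text \<open>Subdividing a cube into \<open>k ^ d\<close> subcubes of diameter \<open>O(1 / k)\<close> bounds its Hausdorff measure.\<close>

lemma hausdorff_outer_cube_finite:
  assumes L: "L > 0"
  shows "hausdorff_outer (real CARD('d)) {y::real^'d. \<forall>i. \<bar>y $ i\<bar> \<le> L} < \<infinity>"
proof -
  let ?d = "real CARD('d)"
  define V where "V = unit_ball_vol ?d"
  have V: "V \<ge> 0" by (simp add: V_def)
  have "hausdorff_content ?d \<delta> {y::real^'d. \<forall>i. \<bar>y $ i\<bar> \<le> L} \<le> ennreal (V * (?d * L) ^ CARD('d))" if \<delta>: "\<delta> > 0" for \<delta>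
  proof -
    obtain k :: nat where k: "2 * ?d * L / \<delta> < real k" using reals_Archimedean2 by blast
    have "2 * ?d * L / \<delta> > 0" using L \<delta> by simp
    then have k0: "k > 0" using k by (cases k) auto
    have k\<delta>: "2 * ?d * L / k \<le> \<delta>" using k k0 \<delta> by (simp add: field_simps)
    define F :: "('d \<Rightarrow> nat) set" where "F = {f. \<forall>i. f i < k}"
    have FP: "F = PiE UNIV (\<lambda>_. {..<k})" by (auto simp: F_def PiE_def Pi_def)
    have finF: "finite F" and cardF: "card F = k ^ CARD('d)"
      unfolding FP by (auto intro: finite_PiE simp: card_PiE)
    define Q :: "('d \<Rightarrow> nat) \<Rightarrow> (real^'d) set" where
      "Q f = {y. \<forall>i. - L + 2 * L * real (f i) / k \<le> y $ i \<and> y $ i \<le> - L + 2 * L * (real (f i) + 1) / k}" for f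
    have diff: "norm (x - y) \<le> 2 * ?d * L / k" if "x \<in> Q f" "y \<in> Q f" for x y f
    proof -
      have "norm (x - y) \<le> (\<Sum>i\<in>UNIV. \<bar>(x - y) $ i\<bar>)" by (rule norm_le_l1_cart)
      also have "\<dots> \<le> (\<Sum>i\<in>(UNIV::'d set). 2 * L / k)"
      proof (rule sum_mono)
        fix i
        have e: "2 * L * (real (f i) + 1) / k = 2 * L * real (f i) / k + 2 * L / k"
          by (simp add: distrib_left add_divide_distrib)
        have "- L + 2 * L * real (f i) / k \<le> x $ i" "x $ i \<le> - L + 2 * L * (real (f i) + 1) / k"
          "- L + 2 * L * real (f i) / k \<le> y $ i" "y $ i \<le> - L + 2 * L * (real (f i) + 1) / k"
          using that unfolding Q_def by auto
        then show "\<bar>(x - y) $ i\<bar> \<le> 2 * L / k" unfolding e vector_minus_component by linarith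
      qed
      also have "\<dots> = 2 * ?d * L / k" by simp
      finally show ?thesis .
    qed
    have Qd: "diameter (Q f) \<le> 2 * ?d * L / k" for f
      using diff L by (intro diameter_le) auto
    have Qb: "bounded (Q f)" for f
      unfolding bounded_def dist_norm using diff by (cases "Q f = {}") blast+
    have cover: "{y::real^'d. \<forall>i. \<bar>y $ i\<bar> \<le> L} \<subseteq> (\<Union>f\<in>F. Q f)"
    proof
      fix y :: "real^'d" assume "y \<in> {y. \<forall>i. \<bar>y $ i\<bar> \<le> L}"
      then have y: "\<bar>y $ i\<bar> \<le> L" for i by simp
      define u where "u i = (y $ i + L) * k / (2 * L)" for i
      have u: "0 \<le> u i" "u i \<le> k" for i
      proof -
        have b: "0 \<le> y $ i + L" "y $ i + L \<le> 2 * L" using y[of i] by linarith+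
        show "0 \<le> u i" unfolding u_def using b(1) L by (intro divide_nonneg_pos mult_nonneg_nonneg) auto
        have "(y $ i + L) * k \<le> (2 * L) * k" using b(2) by (rule mult_right_mono) simp
        then show "u i \<le> k" unfolding u_def using L by (simp add: pos_divide_le_eq mult.commute)
      qed
      define f where "f i = min (nat \<lfloor>u i\<rfloor>) (k - 1)" for i
      have f: "f i < k" "real (f i) \<le> u i" "u i \<le> real (f i) + 1" for i
      proof -
        show "f i < k" using k0 by (simp add: f_def)
        have n: "real (nat \<lfloor>u i\<rfloor>) \<le> u i" "u i < real (nat \<lfloor>u i\<rfloor>) + 1"
        proof -
          have "real (nat \<lfloor>u i\<rfloor>) = of_int \<lfloor>u i\<rfloor>" using u(1)[of i] by simp
          then show "real (nat \<lfloor>u i\<rfloor>) \<le> u i" "u i < real (nat \<lfloor>u i\<rfloor>) + 1" by linarith+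
        qed
        show "real (f i) \<le> u i" unfolding f_def using n by linarith
        show "u i \<le> real (f i) + 1" unfolding f_def using n u(2)[of i] k0 by (cases "nat \<lfloor>u i\<rfloor> \<le> k - 1") auto
      qed
      have yu: "y $ i = - L + 2 * L * u i / k" for i
        unfolding u_def using L k0 by (simp add: field_simps)
      have "2 * L * real (f i) / k \<le> 2 * L * u i / k" "2 * L * u i / k \<le> 2 * L * (real (f i) + 1) / k" for i
        using f(2,3)[of i] L by (intro divide_right_mono mult_left_mono; simp)+
      then have "y \<in> Q f" unfolding Q_def mem_Collect_eq yu by simp
      then show "y \<in> (\<Union>f\<in>F. Q f)" using f(1) by (auto simp: F_def)
    qed
    obtain h where h: "bij_betw h {0..<card F} F" using ex_bij_betw_nat_finite[OF finF] by blast
    define U where "U i = (if i < card F then Q (h i) else {})" for i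
    have Ucov: "(\<Union>f\<in>F. Q f) \<subseteq> (\<Union>i. U i)"
    proof
      fix y assume "y \<in> (\<Union>f\<in>F. Q f)"
      then obtain f where f: "f \<in> F" "y \<in> Q f" by blast
      then obtain i where "i \<in> {0..<card F}" "f = h i" using h unfolding bij_betw_def by blast
      then show "y \<in> (\<Union>i. U i)" using f by (auto simp: U_def intro!: exI[of _ i])
    qed
    have Ub: "bounded (U i) \<and> diameter (U i) \<le> \<delta>" for i
      using Qb order_trans[OF Qd[of "h i"] k\<delta>] \<delta> by (simp add: U_def)
    have "U \<in> {U. {y::real^'d. \<forall>i. \<bar>y $ i\<bar> \<le> L} \<subseteq> (\<Union>i. U i) \<and> (\<forall>i. bounded (U i) \<and> diameter (U i) \<le> \<delta>)}"
      using order_trans[OF cover Ucov] Ub by simp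
    then have "hausdorff_content ?d \<delta> {y::real^'d. \<forall>i. \<bar>y $ i\<bar> \<le> L}
        \<le> (\<Sum>i. ennreal (unit_ball_vol ?d * (diameter (U i) / 2) powr ?d))"
      unfolding hausdorff_content_def by (rule INF_lower)
    also have "\<dots> = (\<Sum>i<card F. ennreal (unit_ball_vol ?d * (diameter (U i) / 2) powr ?d))"
      by (rule suminf_finite) (auto simp: U_def)
    also have "\<dots> \<le> (\<Sum>i<card F. ennreal (V * (?d * L / k) ^ CARD('d)))"
    proof (rule sum_mono)
      fix i assume i: "i \<in> {..<card F}"
      have "diameter (U i) \<ge> 0" using Qb by (auto simp: U_def intro: diameter_ge_0)
      moreover have "diameter (U i) / 2 \<le> ?d * L / k" using Qd[of "h i"] i by (simp add: U_def ac_simps)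
      ultimately have "(diameter (U i) / 2) powr ?d \<le> (?d * L / k) powr ?d" by (intro powr_mono2) auto
      also have "\<dots> = (?d * L / k) ^ CARD('d)" using L k0 by (intro powr_realpow) simp
      finally show "ennreal (unit_ball_vol ?d * (diameter (U i) / 2) powr ?d) \<le> ennreal (V * (?d * L / k) ^ CARD('d))"
        unfolding V_def[symmetric] using V by (intro ennreal_leI mult_left_mono)
    qed
    also have "\<dots> = ennreal (real (card F) * (V * (?d * L / k) ^ CARD('d)))"
      using V L by (simp add: ennreal_mult ennreal_of_nat_eq_real_of_nat)
    also have "real (card F) * (V * (?d * L / k) ^ CARD('d)) = V * (?d * L) ^ CARD('d)"
      unfolding cardF using k0 by (simp add: power_divide)
    finally show ?thesis .
  qed
  then have "hausdorff_outer ?d {y::real^'d. \<forall>i. \<bar>y $ i\<bar> \<le> L} \<le> ennreal (V * (?d * L) ^ CARD('d))"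
    unfolding hausdorff_outer_def by (intro SUP_least) auto
  then show ?thesis by (rule le_less_trans) simp
qed

lemma sets_hausdorff_measure: "sets (hausdorff_measure s :: 'a::metric_space measure) = sets borel"
proof -
  have "sigma_sets UNIV (sets borel) = sets (borel :: 'a measure)"
    by (metis sets.sigma_sets_eq space_borel)
  then show ?thesis unfolding hausdorff_measure_def by (simp add: sets_measure_of_conv)
qed

text \<open>The value of the constant is irrelevant below, so no isodiametric inequality is needed. Nor is Caratheodory's
  criterion: \<^const>\<open>measure_of\<close> returns the null measure if its argument is not countably additive, and this is excluded
  by the hypothesis.\<close>

lemma hausdorff_measure_eq_lborel:
  fixes M :: "(real^'d) measure"
  defines "M \<equiv> hausdorff_measure (real CARD('d))"
  assumes nz: "emeasure M UNIV \<noteq> 0"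
  shows "\<exists>c>0. M = density lborel (\<lambda>_. ennreal c)"
proof -
  let ?\<mu> = "hausdorff_outer (real CARD('d)) :: (real^'d) set \<Rightarrow> ennreal"
  have sb: "sigma_sets UNIV (sets borel) = sets (borel :: (real^'d) measure)"
    by (metis sets.sigma_sets_eq space_borel)
  have sets: "sets M = sets borel"
    unfolding M_def by (rule sets_hausdorff_measure)
  have em0: "emeasure M = (\<lambda>B. if B \<in> sets borel \<and> measure_space UNIV (sets borel) ?\<mu> then ?\<mu> B else 0)"
    unfolding M_def hausdorff_measure_def emeasure_measure_of_conv sb ..
  then have "measure_space UNIV (sets borel) ?\<mu>" using nz by (metis (mono_tags))
  then have em: "emeasure M A = ?\<mu> A" if "A \<in> sets borel" for A
    using that by (simp add: em0)
  have spM: "space M = UNIV" using sets_eq_imp_space_eq[OF sets] by simp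
  define Q where "Q n = {y::real^'d. \<forall>i. \<bar>y $ i\<bar> \<le> real (Suc n)}" for n
  have clQ: "closed (Q n)" for n
    unfolding Q_def by (intro closed_Collect_all closed_Collect_le continuous_intros)
  have Qm: "Q n \<in> sets borel" for n using clQ by (rule borel_closed)
  have Qfin: "emeasure M (Q n) \<noteq> \<infinity>" for n
    using hausdorff_outer_cube_finite[of "real (Suc n)", where 'd = 'd] em[OF Qm, of n] unfolding Q_def by auto
  have Qcov: "(\<Union>n. Q n) = UNIV"
  proof -
    have "y \<in> (\<Union>n. Q n)" for y :: "real^'d"
    proof -
      obtain n :: nat where "norm y \<le> real n" using real_arch_simple by blast
      then have "\<bar>y $ i\<bar> \<le> real (Suc n)" for i using component_le_norm_cart[of y i] by simp
      then have "y \<in> Q n" by (simp add: Q_def)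
      then show ?thesis by blast
    qed
    then show ?thesis by blast
  qed
  have sf: "sigma_finite_measure M"
    by standard (rule exI[of _ "range Q"], use Qm Qfin Qcov sets spM in auto)
  have inv: "distr M borel ((+) v) = M" for v
  proof (rule measure_eqI)
    fix A assume "A \<in> sets (distr M borel ((+) v))"
    then have A: "A \<in> sets borel" by simp
    have pre: "(+) v -` A = (+) (- v) ` A" by (force simp: image_iff intro: bexI[of _ "v + _"])
    have m: "(+) v \<in> measurable M borel" unfolding measurable_cong_sets[OF sets refl] by simp
    have preb: "(+) v -` A \<in> sets borel" using measurable_sets[OF m A] by (simp add: spM sets)
    have "emeasure (distr M borel ((+) v)) A = emeasure M ((+) v -` A)"
      using m A by (simp add: emeasure_distr spM)
    also have "\<dots> = ?\<mu> ((+) (- v) ` A)" using em[OF preb] by (simp only: pre)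
    also have "\<dots> = ?\<mu> A" by (rule hausdorff_outer_translate)
    also have "\<dots> = emeasure M A" using em[OF A] by simp
    finally show "emeasure (distr M borel ((+) v)) A = emeasure M A" .
  qed (simp add: sets)
  have lQ: "emeasure lborel (Q 0) \<noteq> 0" "emeasure lborel (Q 0) \<noteq> \<infinity>"
  proof -
    have "ball 0 1 \<subseteq> Q 0"
    proof
      fix y :: "real^'d" assume "y \<in> ball 0 1"
      then have "\<bar>y $ i\<bar> \<le> 1" for i using component_le_norm_cart[of y i] by simp
      then show "y \<in> Q 0" by (simp add: Q_def)
    qed
    then have "emeasure lborel (ball (0::real^'d) 1) \<le> emeasure lborel (Q 0)" using Qm by (intro emeasure_mono) auto
    moreover have "emeasure lborel (ball (0::real^'d) 1) \<noteq> 0"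
    proof
      assume "emeasure lborel (ball (0::real^'d) 1) = 0"
      then have "measure lborel (ball (0::real^'d) 1) = 0" by (simp add: measure_def)
      then show False using content_ball_gt_0_iff[of "0::real^'d" 1] by simp
    qed
    ultimately show "emeasure lborel (Q 0) \<noteq> 0" by auto
    have "bounded (Q 0)" unfolding Q_def
    proof (rule boundedI)
      fix y :: "real^'d" assume "y \<in> {y. \<forall>i. \<bar>y $ i\<bar> \<le> real (Suc 0)}"
      then have "(\<Sum>i\<in>UNIV. \<bar>y $ i\<bar>) \<le> (\<Sum>i\<in>(UNIV::'d set). 1)" by (intro sum_mono) auto
      then show "norm y \<le> real CARD('d)" using norm_le_l1_cart[of y] by simp
    qed
    then show "emeasure lborel (Q 0) \<noteq> \<infinity>" using emeasure_bounded_finite by fastforce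
  qed
  obtain l where l: "emeasure lborel (Q 0) = ennreal l" "l > 0"
    using lQ by (cases "emeasure lborel (Q 0)") (auto simp: less_le)
  obtain m where m: "emeasure M (Q 0) = ennreal m" "m \<ge> 0"
    using Qfin[of 0] by (cases "emeasure M (Q 0)") auto
  have eq: "emeasure M A = ennreal (m / l) * emeasure lborel A" if A: "A \<in> sets borel" for A
  proof -
    have "emeasure M A * ennreal l = emeasure lborel A * ennreal m"
      using translation_invariant_eq_lborel[OF sets sf inv A Qm[of 0]] unfolding l m .
    then have e: "emeasure M A * ennreal l * ennreal (1 / l) = emeasure lborel A * ennreal m * ennreal (1 / l)" by simp
    have "ennreal l * ennreal (1 / l) = 1" using l by (simp add: ennreal_mult[symmetric])
    then have "emeasure M A = emeasure M A * ennreal l * ennreal (1 / l)" by (simp add: mult.assoc)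
    also have "\<dots> = emeasure lborel A * (ennreal m * ennreal (1 / l))" unfolding e by (simp only: mult.assoc)
    also have "ennreal m * ennreal (1 / l) = ennreal (m / l)" using l m by (simp add: ennreal_mult[symmetric])
    finally show ?thesis by (simp only: mult.commute)
  qed
  have "M = density lborel (\<lambda>_. ennreal (m / l))"
    by (rule measure_eqI) (simp_all add: sets eq emeasure_density nn_integral_cmult)
  moreover have "m / l > 0"
  proof -
    have "m \<noteq> 0"
    proof
      assume "m = 0"
      then have "emeasure M UNIV = 0" using eq[of UNIV] by simp
      then show False using nz by simp
    qed
    then show ?thesis using m l by simp
  qed
  ultimately show ?thesis by blast
qed

section \<open>Functions with vanishing Poisson-type extension\<close>

lemma integrable_times_weight:
  fixes q :: "'a::euclidean_space \<Rightarrow> 'c::euclidean_space"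
  assumes q: "integrable lborel q" and s: "s \<ge> 0"
  shows "weighted_integrable s q"
proof (rule integrable_dominated)
  have [measurable]: "q \<in> borel_measurable borel" using q by auto
  show "(\<lambda>y. norm (q y) * weight s y) \<in> borel_measurable lborel" by measurable
  show "integrable lborel (\<lambda>y. norm (q y))" using q by simp
  fix y :: 'a
  have "weight s y \<le> (1 + norm y) powr 0" using s by (intro powr_mono) auto
  also have "\<dots> \<le> 1" by simp
  finally show "norm (norm (q y) * weight s y) \<le> norm (q y)"
    using mult_left_mono[of "weight s y" 1 "norm (q y)"] by simp
qed

lemma integral_lborel_pos:
  fixes f :: "'a::euclidean_space \<Rightarrow> real"
  assumes "integrable lborel f" "\<And>x. f x > 0"
  shows "integral\<^sup>L lborel f > 0"
proof -
  have "integral\<^sup>L lborel f \<noteq> 0"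
  proof
    assume "integral\<^sup>L lborel f = 0"
    then have "AE x in lborel. f x = 0"
      using assms by (subst (asm) integral_nonneg_eq_0_iff_AE) (auto simp: less_imp_le)
    then have "AE x in (lborel :: 'a measure). False"
      by eventually_elim (use assms(2) in \<open>metis less_irrefl\<close>)
    then show False by (simp add: eventually_False ae_filter_eq_bot_iff)
  qed
  moreover have "integral\<^sup>L lborel f \<ge> 0" using assms(2) by (intro Bochner_Integration.integral_nonneg) (simp add: less_imp_le)
  ultimately show ?thesis by simp
qed

lemma integral_lborel_affine:
  fixes f :: "'a::euclidean_space \<Rightarrow> real"
  assumes [measurable]: "f \<in> borel_measurable borel" and r: "r > 0"
  shows "(LBINT p. f p) = r ^ DIM('a) * (LBINT w. f (y + r *\<^sub>R w))"
proof -
  have "(LBINT p. f p) = (LINT p|density (distr lborel borel (\<lambda>x. y + r *\<^sub>R x)) (\<lambda>_. ennreal (\<bar>r\<bar> ^ DIM('a))). f p)"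
    using r by (subst lborel_affine[of r y]) auto
  also have "\<dots> = (LINT p|distr lborel borel (\<lambda>x. y + r *\<^sub>R x). \<bar>r\<bar> ^ DIM('a) * f p)"
    by (subst integral_density) auto
  also have "\<dots> = (LBINT w. \<bar>r\<bar> ^ DIM('a) * f (y + r *\<^sub>R w))"
    by (subst integral_distr) auto
  also have "\<dots> = r ^ DIM('a) * (LBINT w. f (y + r *\<^sub>R w))" using r by simp
  finally show ?thesis .
qed

text \<open>Indicators of closed sets are limits of continuous functions, and closed sets generate the Borel sets.\<close>

lemma AE_zero_if_integral_continuous_zero:
  fixes q :: "'a::euclidean_space \<Rightarrow> real"
  assumes q: "integrable lborel q"
    and z: "\<And>\<eta>. continuous_on UNIV \<eta> \<Longrightarrow> (\<And>y. 0 \<le> \<eta> y) \<Longrightarrow> (\<And>y. \<eta> y \<le> 1) \<Longrightarrow> (LBINT y. q y * \<eta> y) = (0::real)"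
  shows "AE y in lborel. q y = 0"
proof -
  have [measurable]: "q \<in> borel_measurable borel" using q by auto
  have qs: "set_integrable lborel A q" if "A \<in> sets borel" for A
    unfolding set_integrable_def using that q by (intro integrable_mult_indicator) auto
  have cl: "(LINT y:A|lborel. q y) = 0" if A: "closed A" for A
  proof (cases "A = {}")
    case False
    define \<eta> where "\<eta> k y = max 0 (1 - real k * infdist y A)" for k y
    have ec: "continuous_on UNIV (\<eta> k)" for k unfolding \<eta>_def by (intro continuous_intros)
    have [measurable]: "\<eta> k \<in> borel_measurable borel" for k
      using ec by (rule borel_measurable_continuous_onI)
    have e01: "0 \<le> \<eta> k y" "\<eta> k y \<le> 1" for k y
      unfolding \<eta>_def using infdist_nonneg[of y A] by auto
    have lim: "(\<lambda>k. \<eta> k y) \<longlonglongrightarrow> indicator A y" for y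
    proof (cases "y \<in> A")
      case True
      then show ?thesis by (simp add: \<eta>_def)
    next
      case nA: False
      have pos: "infdist y A > 0" by (rule infdist_pos_not_in_closed[OF A False nA])
      obtain N :: nat where N: "1 / infdist y A < real N" using reals_Archimedean2 by blast
      have "\<eta> k y = 0" if "k \<ge> N" for k
      proof -
        have "1 < real N * infdist y A" using N pos by (simp add: divide_simps mult.commute)
        also have "\<dots> \<le> real k * infdist y A" using that pos by (intro mult_right_mono) auto
        finally show ?thesis by (simp add: \<eta>_def)
      qed
      then have "eventually (\<lambda>k. \<eta> k y = 0) sequentially" unfolding eventually_sequentially by blast
      then show ?thesis using nA by (simp add: tendsto_eventually)
    qed
    have "(\<lambda>k. LBINT y. q y * \<eta> k y) \<longlonglongrightarrow> (LBINT y. q y * indicator A y)"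
    proof (rule integral_dominated_convergence[where w = "\<lambda>y. \<bar>q y\<bar>"])
      show "AE y in lborel. (\<lambda>k. q y * \<eta> k y) \<longlonglongrightarrow> q y * indicator A y"
        by (intro AE_I2 tendsto_mult_left lim)
      show "AE y in lborel. norm (q y * \<eta> k y) \<le> \<bar>q y\<bar>" for k
      proof (rule AE_I2)
        fix y
        have "\<bar>q y\<bar> * \<eta> k y \<le> \<bar>q y\<bar> * 1" by (intro mult_left_mono e01) simp
        then show "norm (q y * \<eta> k y) \<le> \<bar>q y\<bar>" using e01[of k y] by (simp add: abs_mult)
      qed
    qed (use q A in auto)
    moreover have "(LBINT y. q y * \<eta> k y) = 0" for k by (rule z[OF ec e01])
    ultimately have "(LBINT y. q y * indicator A y) = 0" by (simp add: LIMSEQ_const_iff)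
    then show ?thesis unfolding set_lebesgue_integral_def by (simp add: mult.commute)
  qed (simp add: set_lebesgue_integral_def)
  have all: "(LINT y:A|lborel. q y) = 0" if "A \<in> sets borel" for A :: "'a set"
  proof -
    have sb: "sets borel = sigma_sets UNIV (Collect (closed :: 'a set \<Rightarrow> bool))" by (simp add: borel_eq_closed)
    have "Int_stable (Collect (closed :: 'a set \<Rightarrow> bool))" by (auto simp: Int_stable_def)
    moreover have "Collect (closed :: 'a set \<Rightarrow> bool) \<subseteq> Pow UNIV" by simp
    moreover have "A \<in> sigma_sets UNIV (Collect closed)" using that unfolding sb .
    ultimately show ?thesis
    proof (induct A rule: sigma_sets_induct_disjoint)
      case (basic A) then show ?case using cl by simp
    next
      case empty show ?case by (simp add: set_lebesgue_integral_def)
    next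
      case (compl A)
      then have A: "A \<in> sets borel" using sb by simp
      have "(LINT y:A \<union> (UNIV - A)|lborel. q y) = (LINT y:A|lborel. q y) + (LINT y:UNIV - A|lborel. q y)"
        using A by (intro set_integral_Un qs) auto
      moreover have "(LINT y:UNIV|lborel. q y) = 0" using cl[of UNIV] by simp
      ultimately show ?case using compl by simp
    next
      case (union A)
      then have A: "A i \<in> sets borel" for i using sb by auto
      have "(LINT y:(\<Union>i. A i)|lborel. q y) = (\<Sum>i. (LINT y:A i|lborel. q y))"
        using A union by (intro lebesgue_integral_countable_add qs) (auto simp: disjoint_family_on_def)
      then show ?case using union by simp
    qed
  qed
  have sgn: "AE y in lborel. indicator A y * q y = 0"
    if A: "A \<in> sets borel" and "\<And>y. y \<in> A \<Longrightarrow> s * q y \<ge> 0" and s: "s \<noteq> 0" for A and s :: real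
  proof -
    have "(LBINT y. s * (indicator A y * q y)) = 0"
      using all[OF A] by (simp add: set_lebesgue_integral_def)
    moreover have "integrable lborel (\<lambda>y. s * (indicator A y * q y))"
      using qs[OF A] by (simp add: set_integrable_def)
    moreover have "AE y in lborel. 0 \<le> s * (indicator A y * q y)"
      using that by (intro AE_I2) (auto simp: indicator_def)
    ultimately have "AE y in lborel. s * (indicator A y * q y) = 0"
      by (subst (asm) integral_nonneg_eq_0_iff_AE) auto
    then show ?thesis using s by simp
  qed
  have "AE y in lborel. indicator {y. q y > 0} y * q y = 0" by (rule sgn[of _ 1]) auto
  moreover have "AE y in lborel. indicator {y. q y < 0} y * q y = 0" by (rule sgn[of _ "-1"]) auto
  ultimately show ?thesis by eventually_elim (auto simp: indicator_def split: if_splits)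
qed

text \<open>The kernels \<open>norm (w, r) powr (- b)\<close>, suitably normalized, form an approximate identity as \<open>r \<rightarrow> 0\<close>. Test functions
  make the limit elementary: for continuous bounded \<open>\<eta>\<close>, Fubini and the substitution \<open>p = y + r *\<^sub>R w\<close> move the limit onto \<open>\<eta>\<close>.\<close>

lemma AE_zero_if_poisson_zero:
  fixes q :: "'a::euclidean_space \<Rightarrow> real" and b :: real
  assumes q: "integrable lborel q" and b: "b > real DIM('a)"
    and z: "\<And>p r. r > 0 \<Longrightarrow> (LBINT y. q y * norm (p - y, r::real) powr (- b)) = 0"
  shows "AE y in lborel. q y = 0"
proof (rule AE_zero_if_integral_continuous_zero[OF q])
  fix \<eta> :: "'a \<Rightarrow> real"
  assume ec: "continuous_on UNIV \<eta>" and e0: "\<And>y. 0 \<le> \<eta> y" and e1: "\<And>y. \<eta> y \<le> 1"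
  have [measurable]: "q \<in> borel_measurable borel" using q by auto
  have [measurable]: "\<eta> \<in> borel_measurable borel" using ec by (rule borel_measurable_continuous_onI)
  define P where "P r w = norm (w::'a, r::real) powr (- b)" for r w
  have [measurable]: "P r \<in> borel_measurable borel" for r unfolding P_def by measurable
  have P0: "0 \<le> P r w" for r w by (simp add: P_def)
  have Pint: "integrable lborel (P r)" if r: "r > 0" for r
  proof -
    define c where "c = norm r / (1 + norm (0::'a) + norm r)"
    have c: "c > 0" and low: "\<And>y::'a. c * (1 + norm y) \<le> norm (0 - y, r)"
      unfolding c_def using r base_point_weight[of r "0::'a"] by auto
    show ?thesis
    proof (rule integrable_dominated)
      show "integrable lborel (\<lambda>w::'a. c powr (- b) * weight b w)"
        using integrable_weight[OF b] by simp
      fix w :: 'a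
      have "norm (0 - w, r) powr (- b) \<le> c powr (- b) * weight b w"
        using c low[of w] b by (intro powr_le_weight) auto
      then show "norm (P r w) \<le> c powr (- b) * weight b w" by (simp add: P_def norm_Pair)
    qed simp
  qed
  have Pscale: "P r (r *\<^sub>R w) = r powr (- b) * P 1 w" if r: "r > 0" for r w
  proof -
    have "(r *\<^sub>R w, r) = r *\<^sub>R (w, 1::real)" by simp
    then have "norm (r *\<^sub>R w, r) = r * norm (w, 1::real)" using r by (metis norm_scaleR abs_of_pos)
    then show ?thesis using r by (simp add: P_def powr_mult)
  qed
  define g where "g r y = (LBINT w. \<eta> (y + r *\<^sub>R w) * P 1 w)" for r y
  have conv: "(LBINT p. \<eta> p * P r (p - y)) = r ^ DIM('a) * r powr (- b) * g r y" if r: "r > 0" for r y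
  proof -
    have "(LBINT p. \<eta> p * P r (p - y))
        = r ^ DIM('a) * (LBINT w. \<eta> (y + r *\<^sub>R w) * P r ((y + r *\<^sub>R w) - y))"
      using r by (intro integral_lborel_affine) measurable
    also have "(\<lambda>w. \<eta> (y + r *\<^sub>R w) * P r ((y + r *\<^sub>R w) - y)) = (\<lambda>w. r powr (- b) * (\<eta> (y + r *\<^sub>R w) * P 1 w))"
      using Pscale[OF r] by (simp add: fun_eq_iff)
    finally show ?thesis by (simp add: g_def)
  qed
  have gz: "(LBINT y. q y * g r y) = 0" if r: "r > 0" for r
  proof -
    let ?f = "\<lambda>y p. q y * (\<eta> p * P r (p - y))"
    have Psh: "integrable lborel (\<lambda>p. P r (p - y))" "(LBINT p. P r (p - y)) = (LBINT p. P r p)" for y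
    proof -
      have s: "integrable (distr lborel borel ((+) (- y))) (P r)" unfolding lborel_distr_plus by (rule Pint[OF r])
      then show "integrable lborel (\<lambda>p. P r (p - y))" by (subst (asm) integrable_distr_eq) auto
      have "(LBINT p. P r p) = (LINT p|distr lborel borel ((+) (- y)). P r p)" unfolding lborel_distr_plus ..
      also have "\<dots> = (LBINT p. P r (p - y))" by (subst integral_distr) auto
      finally show "(LBINT p. P r (p - y)) = (LBINT p. P r p)" ..
    qed
    have eP: "norm (\<eta> p * P r (p - y)) \<le> P r (p - y)" for p y
      using e0[of p] e1[of p] P0[of r "p - y"] mult_right_mono[of "\<eta> p" 1 "P r (p - y)"] by (simp add: abs_mult)
    have i1: "integrable lborel (\<lambda>p. \<eta> p * P r (p - y))" for y
      by (rule integrable_dominated[OF _ Psh(1)[of y] eP]) simp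
    have m: "(\<lambda>(y, p). ?f y p) \<in> borel_measurable (lborel \<Otimes>\<^sub>M lborel)"
      unfolding P_def case_prod_beta by measurable
    have int: "integrable (lborel \<Otimes>\<^sub>M lborel) (\<lambda>(y, p). ?f y p)"
    proof (rule lborel_pair.Fubini_integrable[OF m])
      show "AE y in lborel. integrable lborel (\<lambda>p. (\<lambda>(y, p). ?f y p) (y, p))"
        using i1 by simp
      have mm: "(\<lambda>y. LBINT p. norm ((\<lambda>(y, p). ?f y p) (y, p))) \<in> borel_measurable lborel"
        using m by (intro lborel.borel_measurable_lebesgue_integral) simp
      show "integrable lborel (\<lambda>y. LBINT p. norm ((\<lambda>(y, p). ?f y p) (y, p)))"
      proof (rule integrable_dominated[OF mm])
        show "integrable lborel (\<lambda>y. \<bar>q y\<bar> * (LBINT p. P r p))" using q by simp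
        fix y
        have le: "norm (?f y p) \<le> \<bar>q y\<bar> * P r (p - y)" for p
          using mult_left_mono[OF eP abs_ge_zero] by (simp add: abs_mult)
        have "(LBINT p. norm (?f y p)) \<le> (LBINT p. \<bar>q y\<bar> * P r (p - y))"
          using i1[of y] Psh(1)[of y] le by (intro integral_mono) auto
        also have "\<dots> = \<bar>q y\<bar> * (LBINT p. P r p)" using Psh(2)[of y] by simp
        finally have "(LBINT p. norm (?f y p)) \<le> \<bar>q y\<bar> * (LBINT p. P r p)" .
        moreover have "0 \<le> (LBINT p. norm (?f y p))" by (intro Bochner_Integration.integral_nonneg) simp
        ultimately show "norm (LBINT p. norm ((\<lambda>(y, p). ?f y p) (y, p))) \<le> \<bar>q y\<bar> * (LBINT p. P r p)" by simp
      qed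
    qed
    have "(LBINT y. r ^ DIM('a) * r powr (- b) * (q y * g r y)) = (LBINT y. (LBINT p. ?f y p))"
    proof (intro Bochner_Integration.integral_cong refl)
      fix y
      have "(LBINT p. ?f y p) = q y * (LBINT p. \<eta> p * P r (p - y))" by (rule integral_mult_right_zero)
      then show "r ^ DIM('a) * r powr (- b) * (q y * g r y) = (LBINT p. ?f y p)" unfolding conv[OF r] by (simp only: ac_simps)
    qed
    also have "\<dots> = (LBINT p. (LBINT y. ?f y p))"
      by (rule lborel_pair.Fubini_integral[OF int, symmetric])
    also have "\<dots> = (LBINT p. \<eta> p * (LBINT y. q y * norm (p - y, r) powr (- b)))"
    proof (intro Bochner_Integration.integral_cong refl)
      fix p
      have "(LBINT y. ?f y p) = (LBINT y. \<eta> p * (q y * norm (p - y, r) powr (- b)))"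
        by (intro Bochner_Integration.integral_cong) (simp_all add: P_def ac_simps)
      then show "(LBINT y. ?f y p) = \<eta> p * (LBINT y. q y * norm (p - y, r) powr (- b))" by simp
    qed
    also have "\<dots> = 0" using z[OF r] by simp
    finally show ?thesis using r by simp
  qed
  define c1 where "c1 = (LBINT w. P 1 w)"
  have P1: "integrable lborel (P 1)" by (rule Pint) simp
  have c1: "c1 > 0"
    unfolding c1_def
  proof (rule integral_lborel_pos[OF P1])
    fix w :: 'a
    have "(w, 1::real) \<noteq> 0" by (simp add: zero_prod_def)
    then show "P 1 w > 0" unfolding P_def by simp
  qed
  have bd: "norm (\<eta> p * P 1 w) \<le> P 1 w" for p w
    using e0[of p] e1[of p] P0[of 1 w] mult_right_mono[of "\<eta> p" 1 "P 1 w"] by (simp add: abs_mult)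
  define rn where "rn n = inverse (real (Suc n))" for n
  have rn: "rn n > 0" "rn \<longlonglongrightarrow> 0" for n
    unfolding rn_def using LIMSEQ_inverse_real_of_nat by auto
  have glim: "(\<lambda>n. g (rn n) y) \<longlonglongrightarrow> \<eta> y * c1" for y
  proof -
    have "(\<lambda>n. g (rn n) y) \<longlonglongrightarrow> (LBINT w. \<eta> y * P 1 w)"
      unfolding g_def
    proof (rule integral_dominated_convergence[OF _ _ P1])
      show "AE w in lborel. (\<lambda>n. \<eta> (y + rn n *\<^sub>R w) * P 1 w) \<longlonglongrightarrow> \<eta> y * P 1 w"
      proof (rule AE_I2)
        fix w
        have "(\<lambda>n. y + rn n *\<^sub>R w) \<longlonglongrightarrow> y + 0 *\<^sub>R w" by (intro tendsto_intros rn)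
        moreover have "isCont \<eta> y" using ec by (simp add: continuous_on_eq_continuous_at)
        ultimately have "(\<lambda>n. \<eta> (y + rn n *\<^sub>R w)) \<longlonglongrightarrow> \<eta> y" using isCont_tendsto_compose by fastforce
        then show "(\<lambda>n. \<eta> (y + rn n *\<^sub>R w) * P 1 w) \<longlonglongrightarrow> \<eta> y * P 1 w" by (rule tendsto_mult_right)
      qed
      show "AE w in lborel. norm (\<eta> (y + rn n *\<^sub>R w) * P 1 w) \<le> P 1 w" for n by (intro AE_I2 bd)
    qed measurable
    then show ?thesis by (simp add: c1_def)
  qed
  have gb: "\<bar>g r y\<bar> \<le> c1" for r y
  proof -
    have "integrable lborel (\<lambda>w. \<eta> (y + r *\<^sub>R w) * P 1 w)"
      by (rule integrable_dominated[OF _ P1 bd]) simp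
    from norm_integral_le[OF this P1 bd] show ?thesis by (simp add: g_def c1_def)
  qed
  have gm: "g r \<in> borel_measurable lborel" for r
    unfolding g_def by (intro lborel.borel_measurable_lebesgue_integral) (simp add: P_def case_prod_beta)
  have "(\<lambda>n. LBINT y. q y * g (rn n) y) \<longlonglongrightarrow> (LBINT y. q y * (\<eta> y * c1))"
  proof (rule integral_dominated_convergence[where w = "\<lambda>y. \<bar>q y\<bar> * c1"])
    show "AE y in lborel. (\<lambda>n. q y * g (rn n) y) \<longlonglongrightarrow> q y * (\<eta> y * c1)"
      by (intro AE_I2 tendsto_mult_left glim)
    show "AE y in lborel. norm (q y * g (rn n) y) \<le> \<bar>q y\<bar> * c1" for n
      using gb by (intro AE_I2) (simp add: abs_mult mult_left_mono)
    show "(\<lambda>y. q y * g (rn n) y) \<in> borel_measurable lborel" for n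
      using gm[of "rn n"] by (intro borel_measurable_times) auto
  qed (use q in auto)
  then have "(LBINT y. q y * (\<eta> y * c1)) = 0" using gz rn by (simp add: LIMSEQ_const_iff)
  then have "c1 * (LBINT y. q y * \<eta> y) = 0"
    by (simp only: integral_mult_right_zero[symmetric] ac_simps)
  then show "(LBINT y. q y * \<eta> y) = 0" using c1 by simp
qed

text \<open>The equation says that \<open>r powr (b - d)\<close> times the extension \<open>F r\<close> of \<open>q\<close> at height \<open>r\<close> above \<open>p\<close> does not depend
  on \<open>r\<close>. As \<open>q\<close> is integrable this quantity is \<open>O(r powr (- d))\<close>, so it vanishes.\<close>

lemma AE_zero_if_first_order_equation:
  fixes q :: "'a::euclidean_space \<Rightarrow> real" and b :: real
  assumes q: "integrable lborel q" and b: "b > real DIM('a)"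
    and eq: "\<And>p r. r > 0 \<Longrightarrow> b * r\<^sup>2 * (LBINT y. q y * norm (p - y, r::real) powr (- b - 2))
      = (b - real DIM('a)) * (LBINT y. q y * norm (p - y, r) powr (- b))"
  shows "AE y in lborel. q y = 0"
proof (rule AE_zero_if_poisson_zero[OF q b])
  fix p :: 'a and r :: real assume r: "r > 0"
  have [measurable]: "q \<in> borel_measurable borel" using q by auto
  define F where "F r = (LBINT y. q y * norm (p - y, r::real) powr (- b))" for r
  define \<kappa> where "\<kappa> = b - real DIM('a)"
  define Nq where "Nq = (LBINT y. \<bar>q y\<bar>)"
  have b0: "b > 0" using b by simp
  have qi: "integrable lborel (\<lambda>y. \<bar>q y\<bar> * weight b y)"
    using integrable_times_weight[OF q, of b] b0 by simp
  have tk: "taylor_kernel b (\<lambda>v::'a \<times> real. norm v powr (- b)) (\<lambda>v h. - b * norm v powr (- b - 2) * (v \<bullet> h))"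
    using b0 by (intro taylor_kernel_norm_powr) simp
  have dF: "(F has_real_derivative (- b * r * (LBINT y. q y * norm (p - y, r) powr (- b - 2)))) (at r)"
    if r: "r > 0" for r
  proof -
    define c where "c = norm r / (1 + norm p + norm r)"
    have c: "c > 0" and low: "\<And>y. c * (1 + norm y) \<le> norm ((p, r) - (y, 0))"
      unfolding c_def using r base_point_weight[of r p] by auto
    have D: "((\<lambda>x. LBINT y. q y *\<^sub>R norm (x - (y, 0::real)) powr (- b)) has_derivative
        (\<lambda>h. LBINT y. q y *\<^sub>R (- b * norm ((p, r) - (y, 0)) powr (- b - 2) * (((p, r) - (y, 0)) \<bullet> h)))) (at (p, r))"
      using b0 by (intro has_derivative_kernel_integral[OF tk _ _ _ c low qi]) auto
    have g: "((\<lambda>r. (p, r)) has_derivative (\<lambda>h. (0, h))) (at r)" by (auto intro!: derivative_eq_intros)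
    from has_derivative_compose[OF g D]
    have "(F has_derivative (\<lambda>h. LBINT y. q y * (- b * norm (p - y, r) powr (- b - 2) * (r * h)))) (at r)"
      unfolding F_def by simp
    moreover have "(LBINT y. q y * (- b * norm (p - y, r) powr (- b - 2) * (r * h)))
        = (- b * r * (LBINT y. q y * norm (p - y, r) powr (- b - 2))) * h" for h
    proof -
      have "(LBINT y. q y * (- b * norm (p - y, r) powr (- b - 2) * (r * h)))
          = (LBINT y. (- b * r * h) * (q y * norm (p - y, r) powr (- b - 2)))"
        by (intro Bochner_Integration.integral_cong) (simp_all add: ac_simps)
      also have "\<dots> = (- b * r * h) * (LBINT y. q y * norm (p - y, r) powr (- b - 2))"
        by (rule integral_mult_right_zero)
      finally show ?thesis by (simp add: ac_simps)
    qed
    ultimately have "(F has_derivative (\<lambda>h. (- b * r * (LBINT y. q y * norm (p - y, r) powr (- b - 2))) * h)) (at r)"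
      by (simp only:)
    then show ?thesis unfolding has_field_derivative_def .
  qed
  have dG: "((\<lambda>r. r powr \<kappa> * F r) has_real_derivative 0) (at r)" if r: "r > 0" for r
  proof -
    let ?I = "LBINT y. q y * norm (p - y, r) powr (- b - 2)"
    have "((\<lambda>r. r powr \<kappa> * F r) has_real_derivative
        (\<kappa> * r powr (\<kappa> - 1) * F r + (- b * r * ?I) * r powr \<kappa>)) (at r)"
      using r by (auto intro!: derivative_eq_intros dF[OF r])
    moreover have "\<kappa> * r powr (\<kappa> - 1) * F r + (- b * r * ?I) * r powr \<kappa> = 0"
    proof -
      have "r powr \<kappa> = r powr (\<kappa> - 1) * r" using r powr_times_self[of r "\<kappa> - 1"] by simp
      then have "\<kappa> * r powr (\<kappa> - 1) * F r + (- b * r * ?I) * r powr \<kappa>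
          = r powr (\<kappa> - 1) * (\<kappa> * F r - b * r\<^sup>2 * ?I)" by (simp add: algebra_simps power2_eq_square)
      also have "\<kappa> * F r - b * r\<^sup>2 * ?I = 0" using eq[OF r, of p] unfolding \<kappa>_def F_def by simp
      finally show ?thesis by simp
    qed
    ultimately show ?thesis by (simp only:)
  qed
  have const: "R powr \<kappa> * F R = r powr \<kappa> * F r" if "R \<ge> r" for R
  proof -
    have "\<exists>c. \<forall>x\<in>{r..R}. x powr \<kappa> * F x = c"
      using dG r by (intro has_field_derivative_zero_constant) (auto intro: has_field_derivative_at_within)
    then obtain c where "\<And>x. x \<in> {r..R} \<Longrightarrow> x powr \<kappa> * F x = c" by blast
    from this[of R] this[of r] show ?thesis using that by simp
  qed
  have Fb: "\<bar>R powr \<kappa> * F R\<bar> \<le> Nq * R powr (- real DIM('a))" if R: "R > 0" for R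
  proof -
    have pt: "norm (q y * norm (p - y, R) powr (- b)) \<le> \<bar>q y\<bar> * R powr (- b)" for y
    proof -
      have "R \<le> norm (p - y, R)" using norm_snd_le[of R "p - y"] R by simp
      then have "norm (p - y, R) powr (- b) \<le> R powr (- b)" using R b0 by (intro powr_mono2') auto
      then show ?thesis by (simp add: abs_mult mult_left_mono)
    qed
    have i: "integrable lborel (\<lambda>y. \<bar>q y\<bar> * R powr (- b))" using q by simp
    have "integrable lborel (\<lambda>y. q y * norm (p - y, R) powr (- b))"
      by (rule integrable_dominated[OF _ i pt]) simp
    from norm_integral_le[OF this i pt] have "\<bar>F R\<bar> \<le> Nq * R powr (- b)" by (simp add: F_def Nq_def)
    then have "R powr \<kappa> * \<bar>F R\<bar> \<le> R powr \<kappa> * (Nq * R powr (- b))" by (intro mult_left_mono) auto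
    also have "\<dots> = Nq * R powr (- real DIM('a))" by (simp add: \<kappa>_def powr_add[symmetric])
    finally show ?thesis by (simp add: abs_mult)
  qed
  have "((\<lambda>R. Nq * R powr (- real DIM('a))) \<longlongrightarrow> Nq * 0) at_top"
    by (intro tendsto_mult_left tendsto_neg_powr filterlim_ident) simp
  then have lim0: "((\<lambda>R. Nq * R powr (- real DIM('a))) \<longlongrightarrow> 0) at_top" by simp
  have "eventually (\<lambda>R. norm (R powr \<kappa> * F R) \<le> Nq * R powr (- real DIM('a))) at_top"
    using eventually_gt_at_top[of "0::real"] by (rule eventually_mono) (simp only: real_norm_def Fb)
  from Lim_null_comparison[OF this lim0] have "((\<lambda>R. R powr \<kappa> * F R) \<longlongrightarrow> 0) at_top" .
  moreover have "((\<lambda>R. R powr \<kappa> * F R) \<longlongrightarrow> r powr \<kappa> * F r) at_top"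
    using eventually_ge_at_top[of r] by (intro tendsto_eventually, rule eventually_mono) (rule const)
  ultimately have "r powr \<kappa> * F r = 0" by (intro tendsto_unique[OF trivial_limit_at_top_linorder])
  then show "(LBINT y. q y * norm (p - y, r) powr (- b)) = 0" using r by (simp add: F_def)
qed

section \<open>Consequences of the hypotheses on a family of graph perturbations\<close>

lemma locally_integrable_diff:
  assumes f: "locally_integrable f" and g: "locally_integrable g"
  shows "locally_integrable (\<lambda>y. f y - t * g y)"
  unfolding locally_integrable_def
proof (intro allI impI)
  fix K :: "'a set" assume K: "compact K"
  have "set_integrable lborel K f" "set_integrable lborel K (\<lambda>y. t * g y)"
    using f g K unfolding locally_integrable_def by (auto intro: set_integrable_mult_right)
  then show "set_integrable lborel K (\<lambda>y. f y - t * g y)" by (rule set_integral_diff)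
qed

lemma weighted_derivative_scalar:
  fixes F :: "real \<Rightarrow> 'a::euclidean_space \<Rightarrow> real"
  assumes m: "\<And>t. t \<in> {0<..<t0} \<Longrightarrow> F t \<in> borel_measurable borel"
    and li: "\<And>t. t \<in> {0<..<t0} \<Longrightarrow> locally_integrable (F t)"
    and d: "bmo_differentiable_at_0 F F'" and l: "linearly_controlled t0 F F'" and t0: "t0 > 0"
  shows "weighted_derivative t0 F F'"
  unfolding weighted_derivative_def
proof (intro conjI allI impI ballI)
  have F': "integrable lborel F'" "BMO F'" using d by (auto simp: bmo_differentiable_at_0_def)
  show mF': "F' \<in> borel_measurable borel" using F' by auto
  fix s assume s: "s > real DIM('a)"
  have "s \<ge> 0" using s by simp
  then show "weighted_integrable s F'" by (rule integrable_times_weight[OF F'(1)])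
  obtain K where K0: "K \<ge> 0" and K: "\<forall>(f::'a \<Rightarrow> real) A. f \<in> borel_measurable borel \<longrightarrow> locally_integrable f \<longrightarrow> A \<ge> 0 \<longrightarrow>
       bmo_norm f \<le> ennreal A \<longrightarrow> \<bar>LINT y:ball 0 1|lborel. f y\<bar> \<le> A \<longrightarrow>
       integrable lborel (\<lambda>y. \<bar>f y\<bar> * weight s y) \<and>
       (LBINT y. \<bar>f y\<bar> * weight s y) \<le> K * A"
    using BMO_weighted_bound[OF s] by blast
  obtain C where C: "\<And>t. t \<in> {0..<t0} \<Longrightarrow> bmo_norm (F t) \<le> ennreal (C * t) \<and> \<bar>LINT y:ball 0 1|lborel. F t y\<bar> \<le> C * t"
    using l unfolding linearly_controlled_def by blast
  show "\<exists>M. \<forall>t\<in>{0<..<t0}. weighted_integrable s (F t) \<and>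
           weighted_norm s (F t) \<le> M * t"
  proof (intro exI[of _ "K * C"] ballI)
    fix t assume t: "t \<in> {0<..<t0}"
    then have t': "t \<in> {0..<t0}" by simp
    have "0 \<le> C * t" using C[OF t'] by linarith
    then show "weighted_integrable s (F t) \<and>
        weighted_norm s (F t) \<le> K * C * t"
      using K[rule_format, OF m[OF t] li[OF t] _ conjunct1[OF C[OF t']] conjunct2[OF C[OF t']]] by (simp add: mult.assoc)
  qed
  show "((\<lambda>t. weighted_norm s (\<lambda>y. F t y - t *\<^sub>R F' y) / t) \<longlongrightarrow> 0) (at_right 0)"
  proof (rule tendstoI)
    fix e :: real assume e: "e > 0"
    define \<epsilon> where "\<epsilon> = e / (K + 1)"
    have \<epsilon>: "\<epsilon> > 0" "K * \<epsilon> < e" using e K0 by (auto simp: \<epsilon>_def field_simps)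
    have 1: "\<forall>\<^sub>F t in at_right 0. bmo_norm (\<lambda>y. F t y - t * F' y) \<le> ennreal (\<epsilon> * t)"
      using d \<epsilon> unfolding bmo_differentiable_at_0_def by blast
    have 2: "\<forall>\<^sub>F t in at_right 0. \<bar>LINT y:ball 0 1|lborel. F t y - t * F' y\<bar> \<le> \<epsilon> * t"
      using l \<epsilon> unfolding linearly_controlled_def by blast
    have 3: "\<forall>\<^sub>F t in at_right 0. t \<in> {0<..<t0}" using t0 by (rule eventually_at_right_real)
    from 1 2 3 show "\<forall>\<^sub>F t in at_right 0. dist (weighted_norm s (\<lambda>y. F t y - t *\<^sub>R F' y) / t) 0 < e"
    proof eventually_elim
      case (elim t)
      have t: "t > 0" using elim(3) by simp
      have mm: "(\<lambda>y. F t y - t * F' y) \<in> borel_measurable borel" using m[OF elim(3)] mF' by simp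
      have ll: "locally_integrable (\<lambda>y. F t y - t * F' y)"
        using li[OF elim(3)] F'(2) by (intro locally_integrable_diff) (auto simp: BMO_def)
      have "(LBINT y. \<bar>F t y - t * F' y\<bar> * weight s y) \<le> K * (\<epsilon> * t)"
        using K[rule_format, OF mm ll _ elim(1,2)] \<epsilon> t by simp
      also have "\<dots> < e * t" using \<epsilon>(2) t by (simp add: mult.assoc[symmetric])
      finally have "(LBINT y. \<bar>F t y - t * F' y\<bar> * weight s y) / t < e"
        using t by (simp add: pos_divide_less_eq)
      moreover have "0 \<le> (LBINT y. \<bar>F t y - t * F' y\<bar> * weight s y) / t"
        using t by (intro divide_nonneg_pos Bochner_Integration.integral_nonneg) auto
      ultimately show ?case by (simp add: dist_real_def)
    qed
  qed
qed (rule m)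

lemma norm_weight_sum_le:
  fixes f :: "'a::euclidean_space \<Rightarrow> real^'m"
  assumes m: "f \<in> borel_measurable borel"
    and i: "\<And>i. weighted_integrable s (\<lambda>y. f y $ i)"
  shows "weighted_integrable s f"
    "weighted_norm s f \<le> (\<Sum>i\<in>UNIV. LBINT y. norm (f y $ i) * weight s y)"
proof -
  have [measurable]: "f \<in> borel_measurable borel" by fact
  have si: "integrable lborel (\<lambda>y. \<Sum>i\<in>UNIV. norm (f y $ i) * weight s y)"
    using i by (intro Bochner_Integration.integrable_sum)
  have le: "norm (f y) * weight s y \<le> (\<Sum>i\<in>UNIV. norm (f y $ i) * weight s y)" for y
    unfolding sum_distrib_right[symmetric] real_norm_def using norm_le_l1_cart[of "f y"] by (intro mult_right_mono) auto
  show int: "weighted_integrable s f"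
  proof (rule integrable_dominated[OF _ si])
    have "norm (norm (f y) * weight s y) = norm (f y) * weight s y" for y by simp
    then show "norm (norm (f y) * weight s y) \<le> (\<Sum>i\<in>UNIV. norm (f y $ i) * weight s y)" for y
      using le[of y] by (simp only:)
  qed measurable
  have "weighted_norm s f \<le> (LBINT y. (\<Sum>i\<in>UNIV. norm (f y $ i) * weight s y))"
    using int si le by (rule integral_mono)
  also have "\<dots> = (\<Sum>i\<in>UNIV. LBINT y. norm (f y $ i) * weight s y)"
    using i by (rule Bochner_Integration.integral_sum)
  finally show "weighted_norm s f \<le> (\<Sum>i\<in>UNIV. LBINT y. norm (f y $ i) * weight s y)" .
qed

lemma borel_measurable_vec_iff:
  fixes f :: "'a::euclidean_space \<Rightarrow> real^'m"
  assumes "\<And>i. (\<lambda>y. f y $ i) \<in> borel_measurable borel"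
  shows "f \<in> borel_measurable borel"
  using assms by (subst borel_measurable_euclidean_space) (auto simp: Basis_vec_def inner_axis)

lemma weighted_derivative_vec:
  fixes F :: "real \<Rightarrow> 'a::euclidean_space \<Rightarrow> real^'m"
  assumes w: "\<And>i. weighted_derivative t0 (\<lambda>t y. F t y $ i) (\<lambda>y. F' y $ i)" and t0: "t0 > 0"
  shows "weighted_derivative t0 F F'"
  unfolding weighted_derivative_def
proof (intro conjI allI impI ballI)
  show mF: "F t \<in> borel_measurable borel" if "t \<in> {0<..<t0}" for t
  proof (rule borel_measurable_vec_iff)
    show "(\<lambda>y. F t y $ i) \<in> borel_measurable borel" for i
      using w[of i] that unfolding weighted_derivative_def by (elim conjE) (rule bspec)
  qed
  show mF': "F' \<in> borel_measurable borel"
  proof (rule borel_measurable_vec_iff)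
    show "(\<lambda>y. F' y $ i) \<in> borel_measurable borel" for i
      using w[of i] unfolding weighted_derivative_def by (elim conjE)
  qed
  fix s assume s: "s > real DIM('a)"
  have "\<forall>i. \<exists>M. \<forall>t\<in>{0<..<t0}. weighted_integrable s (\<lambda>y. F t y $ i) \<and>
           weighted_norm s (\<lambda>y. F t y $ i) \<le> M * t"
    using w s unfolding weighted_derivative_def by blast
  from choice[OF this] obtain M where "\<forall>i. \<forall>t\<in>{0<..<t0}. weighted_integrable s (\<lambda>y. F t y $ i) \<and>
           weighted_norm s (\<lambda>y. F t y $ i) \<le> M i * t"
    by (rule exE)
  then have M: "weighted_integrable s (\<lambda>y. F t y $ i)"
    "weighted_norm s (\<lambda>y. F t y $ i) \<le> M i * t" if "t \<in> {0<..<t0}" for i t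
    using that by simp_all
  have F'i: "weighted_integrable s (\<lambda>y. F' y $ i)" for i
    using w s unfolding weighted_derivative_def by blast
  have lim: "((\<lambda>t. weighted_norm s (\<lambda>y. F t y $ i - t *\<^sub>R (F' y $ i)) / t) \<longlongrightarrow> 0) (at_right 0)" for i
    using w s unfolding weighted_derivative_def by blast
  show "weighted_integrable s F'"
    using F'i by (rule norm_weight_sum_le(1)[OF mF'])
  show "\<exists>M. \<forall>t\<in>{0<..<t0}. weighted_integrable s (F t) \<and>
           weighted_norm s (F t) \<le> M * t"
  proof (intro exI[of _ "\<Sum>i\<in>UNIV. M i"] ballI conjI)
    fix t assume t: "t \<in> {0<..<t0}"
    show "weighted_integrable s (F t)"
      by (rule norm_weight_sum_le(1)[OF mF[OF t] M(1)[OF t]])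
    have "weighted_norm s (F t) \<le> (\<Sum>i\<in>UNIV. LBINT y. norm (F t y $ i) * weight s y)"
      by (rule norm_weight_sum_le(2)[OF mF[OF t] M(1)[OF t]])
    also have "\<dots> \<le> (\<Sum>i\<in>UNIV. M i * t)" by (intro sum_mono M(2)[OF t])
    finally show "weighted_norm s (F t) \<le> (\<Sum>i\<in>UNIV. M i) * t"
      by (simp only: sum_distrib_right)
  qed
  show "((\<lambda>t. weighted_norm s (\<lambda>y. F t y - t *\<^sub>R F' y) / t) \<longlongrightarrow> 0) (at_right 0)"
  proof (rule Lim_null_comparison)
    show "((\<lambda>t. \<Sum>i\<in>UNIV. weighted_norm s (\<lambda>y. F t y $ i - t *\<^sub>R (F' y $ i)) / t) \<longlongrightarrow> 0) (at_right 0)"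
      by (rule tendsto_null_sum) (rule lim)
    have "\<forall>\<^sub>F t in at_right 0. t \<in> {0<..<t0}" using t0 by (rule eventually_at_right_real)
    then show "\<forall>\<^sub>F t in at_right 0. norm (weighted_norm s (\<lambda>y. F t y - t *\<^sub>R F' y) / t)
        \<le> (\<Sum>i\<in>UNIV. weighted_norm s (\<lambda>y. F t y $ i - t *\<^sub>R (F' y $ i)) / t)"
    proof eventually_elim
      case (elim t)
      have t: "t > 0" using elim by simp
      have mi: "(\<lambda>y. F t y $ i) \<in> borel_measurable borel" "(\<lambda>y. F' y $ i) \<in> borel_measurable borel" for i
        using w elim unfolding weighted_derivative_def by blast+
      have di: "weighted_integrable s (\<lambda>y. (F t y - t *\<^sub>R F' y) $ i)" for i
        using integrable_norm_diff_weight[OF mi(1)[of i] mi(2)[of i], of "\<lambda>y. weight s y" t] M(1)[OF elim, of i] F'i[of i] by simp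
      have md: "(\<lambda>y. F t y - t *\<^sub>R F' y) \<in> borel_measurable borel" using mF[OF elim] mF' by simp
      have "weighted_norm s (\<lambda>y. F t y - t *\<^sub>R F' y)
          \<le> (\<Sum>i\<in>UNIV. LBINT y. norm ((F t y - t *\<^sub>R F' y) $ i) * weight s y)"
        by (rule norm_weight_sum_le(2)[OF md di])
      then have "weighted_norm s (\<lambda>y. F t y - t *\<^sub>R F' y) / t
          \<le> (\<Sum>i\<in>UNIV. LBINT y. norm ((F t y - t *\<^sub>R F' y) $ i) * weight s y) / t"
        using t by (intro divide_right_mono) auto
      moreover have "0 \<le> weighted_norm s (\<lambda>y. F t y - t *\<^sub>R F' y) / t"
        using t by (intro divide_nonneg_pos Bochner_Integration.integral_nonneg) auto
      ultimately show ?case by (simp add: sum_divide_distrib)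
    qed
  qed
qed

text \<open>The mean over the unit ball bounds \<open>\<psi> t\<close> at the origin, and the Lipschitz constant bounds it elsewhere.\<close>

lemma lipschitz_growth:
  fixes \<psi> :: "real \<Rightarrow> 'a::euclidean_space \<Rightarrow> real^'m"
  assumes lip: "\<And>t. t \<in> {0..<t0} \<Longrightarrow> (C * t)-lipschitz_on UNIV (\<psi> t)"
    and mean: "\<And>i. \<exists>C. \<forall>t\<in>{0..<t0}. \<bar>LINT y:ball 0 1|lborel. \<psi> t y $ i\<bar> \<le> C * t"
  shows "\<exists>B\<ge>0. \<forall>t\<in>{0..<t0}. \<forall>y. norm (\<psi> t y) \<le> B * t * (1 + norm y)"
proof -
  obtain c where c: "\<And>i t. t \<in> {0..<t0} \<Longrightarrow> \<bar>LINT y:ball 0 1|lborel. \<psi> t y $ i\<bar> \<le> c i * t" using mean by metis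
  define V where "V = measure lborel (ball (0::'a) 1)"
  have V: "V > 0" by (simp add: V_def)
  define B0 where "B0 = (\<Sum>i\<in>UNIV. \<bar>c i\<bar> / V + \<bar>C\<bar>)"
  have B0: "B0 \<ge> 0" unfolding B0_def using V by (intro sum_nonneg add_nonneg_nonneg) auto
  have "norm (\<psi> t y) \<le> (B0 + \<bar>C\<bar>) * t * (1 + norm y)" if t: "t \<in> {0..<t0}" for t y
  proof -
    have t0': "t \<ge> 0" using t by simp
    have Ct: "C * t \<ge> 0" using lip[OF t] by (rule lipschitz_on_nonneg)
    have CC: "C * t \<le> \<bar>C\<bar> * t" using t0' by (intro mult_right_mono) auto
    have L: "norm (\<psi> t y - \<psi> t y') \<le> (C * t) * norm (y - y')" for y y'
      using lipschitz_onD[OF lip[OF t], of y y'] by (simp add: dist_norm)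
    have cont: "continuous_on A (\<psi> t)" for A
      using lipschitz_on_continuous_on[OF lip[OF t]] by (rule continuous_on_subset) simp
    have comp: "\<bar>\<psi> t 0 $ i\<bar> \<le> (\<bar>c i\<bar> / V + \<bar>C\<bar>) * t" for i
    proof -
      have si: "set_integrable lborel (ball 0 1) (\<lambda>y. \<psi> t y $ i)"
        by (rule set_integrable_subset[of _ "cball 0 1"])
           (unfold set_integrable_def, intro borel_integrable_compact compact_cball continuous_intros cont, auto)
      have ci: "set_integrable lborel (ball (0::'a) 1) (\<lambda>_. k)" for k :: real
        using emeasure_lborel_ball_finite[of "0::'a" 1] unfolding set_integrable_def
        by (intro integrable_scaleR_left integrable_real_indicator) auto
      have cv: "(LINT y:ball (0::'a) 1|lborel. k) = V * k" for k :: real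
        unfolding set_lebesgue_integral_def V_def by simp
      have e1: "V * (\<psi> t 0 $ i) = (LINT y:ball 0 1|lborel. \<psi> t y $ i) - (LINT y:ball 0 1|lborel. \<psi> t y $ i - \<psi> t 0 $ i)"
        using si ci by (simp add: set_integral_diff cv)
      have e2: "\<bar>LINT y:ball 0 1|lborel. \<psi> t y $ i - \<psi> t 0 $ i\<bar> \<le> V * (C * t)"
      proof -
        have sd: "set_integrable lborel (ball 0 1) (\<lambda>y. \<psi> t y $ i - \<psi> t 0 $ i)" using si ci by (rule set_integral_diff)
        have "norm (LINT y:ball 0 1|lborel. \<psi> t y $ i - \<psi> t 0 $ i) \<le> (LINT y:ball (0::'a) 1|lborel. C * t)"
          unfolding set_lebesgue_integral_def
        proof (rule norm_integral_le)
          fix y :: 'a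
          have "\<bar>\<psi> t y $ i - \<psi> t 0 $ i\<bar> \<le> C * t" if "y \<in> ball 0 1"
          proof -
            have "\<bar>\<psi> t y $ i - \<psi> t 0 $ i\<bar> \<le> norm (\<psi> t y - \<psi> t 0)"
              using component_le_norm_cart[of "\<psi> t y - \<psi> t 0" i] by simp
            also have "\<dots> \<le> (C * t) * norm (y - 0)" by (rule L)
            also have "\<dots> \<le> (C * t) * 1" using that Ct by (intro mult_left_mono) auto
            finally show ?thesis by simp
          qed
          then show "norm (indicator (ball 0 1) y *\<^sub>R (\<psi> t y $ i - \<psi> t 0 $ i)) \<le> indicator (ball 0 1) y *\<^sub>R (C * t)"
            by (simp add: indicator_def)
        qed (use sd ci[of "C * t"] in \<open>simp_all only: set_integrable_def\<close>)
        then show ?thesis unfolding cv by simp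
      qed
      have "V * \<bar>\<psi> t 0 $ i\<bar> = \<bar>V * (\<psi> t 0 $ i)\<bar>" using V by (simp add: abs_mult)
      also have "\<dots> \<le> c i * t + V * (C * t)" using c[OF t, of i] e1 e2 by linarith
      also have "\<dots> \<le> \<bar>c i\<bar> * t + V * (\<bar>C\<bar> * t)"
        using CC V t0' by (intro add_mono mult_right_mono mult_left_mono) auto
      also have "\<dots> = V * ((\<bar>c i\<bar> / V + \<bar>C\<bar>) * t)" using V by (simp add: field_simps)
      finally show ?thesis using V by simp
    qed
    have "norm (\<psi> t 0) \<le> (\<Sum>i\<in>UNIV. \<bar>\<psi> t 0 $ i\<bar>)" by (rule norm_le_l1_cart)
    also have "\<dots> \<le> (\<Sum>i\<in>UNIV. (\<bar>c i\<bar> / V + \<bar>C\<bar>) * t)" by (intro sum_mono comp)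
    also have "\<dots> = B0 * t" unfolding B0_def by (simp only: sum_distrib_right)
    finally have 0: "norm (\<psi> t 0) \<le> B0 * t" .
    have "norm (\<psi> t y) \<le> norm (\<psi> t 0) + norm (\<psi> t y - \<psi> t 0)" by (metis norm_triangle_sub)
    also have "\<dots> \<le> B0 * t + (C * t) * norm (y - 0)" using 0 L[of y 0] by (rule add_mono)
    also have "\<dots> \<le> B0 * t * (1 + norm y) + (\<bar>C\<bar> * t) * (1 + norm y)"
    proof (rule add_mono)
      show "B0 * t \<le> B0 * t * (1 + norm y)" using B0 t0' by (simp add: distrib_left)
      show "(C * t) * norm (y - 0) \<le> (\<bar>C\<bar> * t) * (1 + norm y)" using CC Ct t0' by (intro mult_mono) auto
    qed
    also have "\<dots> = (B0 + \<bar>C\<bar>) * t * (1 + norm y)" by (simp add: algebra_simps)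
    finally show ?thesis .
  qed
  then show ?thesis using B0 by (intro exI[of _ "B0 + \<bar>C\<bar>"]) auto
qed

text \<open>The regularized distance as an integral over \<open>\<real>\<^sup>d\<close>. The measure is concentrated on its support, so the restriction
  of the integral to the support has no effect.\<close>

lemma reg_dist_graph:
  fixes \<phi> :: "'a::euclidean_space \<Rightarrow> real" and \<psi> :: "'a \<Rightarrow> 'b::euclidean_space" and d :: nat
  assumes c: "c > 0" and [measurable]: "\<phi> \<in> borel_measurable borel" and nn: "AE y in lborel. 0 \<le> 1 + \<phi> y"
    and \<psi>: "continuous_on UNIV \<psi>" and cl: "closed (range (graph_map \<psi>))"
    and \<mu>: "\<mu> = distr (density (density lborel (\<lambda>_. ennreal c)) (\<lambda>y. ennreal (1 + \<phi> y))) borel (graph_map \<psi>)"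
    and supp: "closed_support \<mu> = range (graph_map \<psi>)"
  shows "reg_dist d \<alpha> \<mu> x =
    (c * (LBINT y. (1 + \<phi> y) * norm (x - graph_map \<psi> y) powr (- (real d + \<alpha>)))) powr (- 1 / \<alpha>)"
proof -
  have [measurable]: "\<psi> \<in> borel_measurable borel" using \<psi> by (rule borel_measurable_continuous_onI)
  have gm[measurable]: "graph_map \<psi> \<in> borel_measurable borel" unfolding graph_map_def[abs_def] by measurable
  have [measurable]: "range (graph_map \<psi>) \<in> sets borel" using cl by (rule borel_closed)
  let ?h = "\<lambda>y. norm (x - y) powr (- real d - \<alpha>)"
  have "(LINT y:closed_support \<mu>|\<mu>. ?h y)
      = (LINT y|density (density lborel (\<lambda>_. ennreal c)) (\<lambda>y. ennreal (1 + \<phi> y)).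
           indicator (range (graph_map \<psi>)) (graph_map \<psi> y) *\<^sub>R ?h (graph_map \<psi> y))"
    unfolding supp set_lebesgue_integral_def unfolding \<mu> by (subst integral_distr) auto
  also have "\<dots> = (LINT y|density (density lborel (\<lambda>_. ennreal c)) (\<lambda>y. ennreal (1 + \<phi> y)). ?h (graph_map \<psi> y))"
    by simp
  also have "\<dots> = (LINT y|density lborel (\<lambda>_. ennreal c). (1 + \<phi> y) *\<^sub>R ?h (graph_map \<psi> y))"
    using nn by (subst integral_density) (auto simp: AE_density)
  also have "\<dots> = (LBINT y. c *\<^sub>R ((1 + \<phi> y) *\<^sub>R ?h (graph_map \<psi> y)))"
    using c by (subst integral_density) auto
  also have "\<dots> = c * (LBINT y. (1 + \<phi> y) * norm (x - graph_map \<psi> y) powr (- (real d + \<alpha>)))"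
    by simp
  finally show ?thesis unfolding reg_dist_def by simp
qed

lemma tendsto_of_difference_quotient:
  fixes f :: "real \<Rightarrow> 'a::real_normed_vector"
  assumes "((\<lambda>t. (f t - f0) /\<^sub>R t) \<longlongrightarrow> f') (at_right 0)"
  shows "(f \<longlongrightarrow> f0) (at_right 0)"
proof -
  have "((\<lambda>t. f0 + t *\<^sub>R ((f t - f0) /\<^sub>R t)) \<longlongrightarrow> f0 + 0 *\<^sub>R f') (at_right 0)"
    by (intro tendsto_intros assms)
  moreover have "\<forall>\<^sub>F t in at_right 0. f0 + t *\<^sub>R ((f t - f0) /\<^sub>R t) = f t"
    using eventually_at_right_less[of "0::real"] by (rule eventually_mono) simp
  ultimately show ?thesis by (simp add: tendsto_cong)
qed

text \<open>The product rule for one-sided difference quotients at \<open>0\<close>, applied to both sides of an identity that holds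
  for small \<open>t > 0\<close> and for the values at \<open>0\<close>.\<close>

lemma limit_product_identity:
  fixes I J :: "real \<Rightarrow> real" and V :: "real \<Rightarrow> 'v::euclidean_space"
  assumes I: "((\<lambda>t. (I t - I0) /\<^sub>R t) \<longlongrightarrow> I') (at_right 0)" and J: "((\<lambda>t. (J t - J0) /\<^sub>R t) \<longlongrightarrow> J') (at_right 0)"
    and V: "((\<lambda>t. (V t - V0) /\<^sub>R t) \<longlongrightarrow> V') (at_right 0)"
    and ev: "\<forall>\<^sub>F t in at_right 0. a * (V t \<bullet> V t) = \<alpha> * (I t * J t)" and e0: "a * (V0 \<bullet> V0) = \<alpha> * (I0 * J0)"
  shows "2 * a * (V0 \<bullet> V') = \<alpha> * (I' * J0 + I0 * J')"
proof -
  have L1: "((\<lambda>t. a * (((V t - V0) /\<^sub>R t) \<bullet> V t + V0 \<bullet> ((V t - V0) /\<^sub>R t))) \<longlongrightarrow> a * (V' \<bullet> V0 + V0 \<bullet> V')) (at_right 0)"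
    by (intro tendsto_intros V tendsto_of_difference_quotient[OF V])
  have L2: "((\<lambda>t. \<alpha> * (((I t - I0) /\<^sub>R t) * J t + I0 * ((J t - J0) /\<^sub>R t))) \<longlongrightarrow> \<alpha> * (I' * J0 + I0 * J')) (at_right 0)"
    by (intro tendsto_intros I J tendsto_of_difference_quotient[OF J])
  have E: "\<forall>\<^sub>F t in at_right 0. a * (((V t - V0) /\<^sub>R t) \<bullet> V t + V0 \<bullet> ((V t - V0) /\<^sub>R t))
      = \<alpha> * (((I t - I0) /\<^sub>R t) * J t + I0 * ((J t - J0) /\<^sub>R t))"
    using ev
  proof eventually_elim
    case (elim t)
    have "a * (((V t - V0) /\<^sub>R t) \<bullet> V t + V0 \<bullet> ((V t - V0) /\<^sub>R t)) = (a * (V t \<bullet> V t) - a * (V0 \<bullet> V0)) / t"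
      by (simp add: inner_diff_left inner_diff_right divide_inverse algebra_simps inner_commute)
    also have "\<dots> = (\<alpha> * (I t * J t) - \<alpha> * (I0 * J0)) / t" unfolding elim e0 ..
    also have "\<dots> = \<alpha> * (((I t - I0) /\<^sub>R t) * J t + I0 * ((J t - J0) /\<^sub>R t))"
      by (simp add: divide_inverse algebra_simps)
    finally show ?case .
  qed
  have "a * (V' \<bullet> V0 + V0 \<bullet> V') = \<alpha> * (I' * J0 + I0 * J')"
    by (rule tendsto_unique[OF trivial_limit_at_right_real Lim_transform_eventually[OF L1 E] L2])
  then show ?thesis by (simp add: inner_commute)
qed

section \<open>The linearized equation\<close>

lemma integral_lborel_reflect:
  fixes f :: "'a::euclidean_space \<Rightarrow> real"
  assumes [measurable]: "f \<in> borel_measurable borel"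
  shows "(LBINT y. f (c - y)) = (LBINT y. f y)"
proof -
  have "(LBINT y. f y) = (LINT y|distr lborel borel (\<lambda>x. c + (-1) *\<^sub>R x). f y)"
    using lborel_affine[of "-1" c] by (simp add: density_1)
  also have "\<dots> = (LBINT y. f (c - y))" by (subst integral_distr) auto
  finally show ?thesis ..
qed

lemma flat_graph_integral:
  fixes \<phi> :: "'a::euclidean_space \<Rightarrow> real" and \<psi> :: "'a \<Rightarrow> 'b::euclidean_space" and k :: "'a \<times> 'b \<Rightarrow> 'c::euclidean_space"
  assumes [measurable]: "k \<in> borel_measurable borel" "\<phi> \<in> borel_measurable borel"
    and \<phi>: "AE y in lborel. \<phi> y = 0" and \<psi>: "\<And>y. \<psi> y = 0"
  shows "(LBINT y. (1 + \<phi> y) *\<^sub>R k (x - (y, \<psi> y))) = (LBINT y. k (x - (y, 0)))"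
  unfolding \<psi>
proof (rule integral_cong_AE)
  show "AE y in lborel. (1 + \<phi> y) *\<^sub>R k (x - (y, 0)) = k (x - (y, 0))"
    using \<phi> by eventually_elim simp
qed measurable

text \<open>The linearization at \<open>t = 0\<close> of the identity \<open>a * |V|\<^sup>2 = \<alpha> * I * J\<close> at the point \<open>(p, z)\<close>, after division by the
  potential \<open>J\<close> of the flat solution.\<close>

abbreviation linear_relation ::
  "real \<Rightarrow> real \<Rightarrow> ('a::euclidean_space \<Rightarrow> real) \<Rightarrow> ('a \<Rightarrow> 'b::euclidean_space) \<Rightarrow> 'a \<Rightarrow> 'b \<Rightarrow> bool" where
  "linear_relation a \<alpha> \<phi>' \<psi>' p z \<equiv>
      2 * a * ((norm z)\<^sup>2 * potential (a + 2) \<phi>' p z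
        - potential (a + 2) (\<lambda>y. z \<bullet> \<psi>' y) p z
        + (a + 2) * (norm z)\<^sup>2 * potential (a + 4) (\<lambda>y. z \<bullet> \<psi>' y) p z)
      = \<alpha> * potential a \<phi>' p z
        + \<alpha> * a * potential (a + 2) (\<lambda>y. z \<bullet> \<psi>' y) p z
        + a * (norm z)\<^sup>2 * potential (a + 2) \<phi>' p z
        + a * (a + 2) * (norm z)\<^sup>2 * potential (a + 4) (\<lambda>y. z \<bullet> \<psi>' y) p z"

text \<open>The derivative at \<open>t = 0\<close> of the identity \<open>a * |V|\<^sup>2 = \<alpha> * I * J\<close> of \<^emph>\<open>graph_identity\<close>, at \<open>(p, z)\<close>. For the flat solution
  \<open>V = J *\<^sub>R (0, z)\<close>, and the identity itself gives \<open>\<alpha> * I = a * |z|\<^sup>2 * J\<close>; hence a factor \<open>J > 0\<close> can be divided out.\<close>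

lemma linearized_equation:
  fixes p :: "'a::euclidean_space" and z :: "'b::euclidean_space" and a \<alpha> :: real
    and \<phi> :: "real \<Rightarrow> 'a \<Rightarrow> real" and \<psi> :: "real \<Rightarrow> 'a \<Rightarrow> 'b"
  assumes a: "a = real DIM('a) + \<alpha>" and \<alpha>: "\<alpha> > 0" and z: "z \<noteq> 0" and t0: "t0 > 0" and B: "B \<ge> 0"
    and w\<phi>: "weighted_derivative t0 \<phi> \<phi>'" and w\<psi>: "weighted_derivative t0 \<psi> \<psi>'"
    and \<psi>B: "\<forall>t\<in>{0<..<t0}. \<forall>y. norm (\<psi> t y) \<le> B * t * (1 + norm y)"
    and ev: "\<forall>\<^sub>F t in at_right 0.
      a * (graph_field (a + 2) (\<phi> t) (\<psi> t) (p, z) \<bullet>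
           graph_field (a + 2) (\<phi> t) (\<psi> t) (p, z))
      = \<alpha> * (graph_potential a (\<phi> t) (\<psi> t) (p, z) *
             graph_potential (a + 2) (\<phi> t) (\<psi> t) (p, z))"
    and e0: "a * ((LBINT y. norm ((p, z) - (y, 0)) powr (- (a + 2)) *\<^sub>R ((p, z) - (y, 0))) \<bullet>
           (LBINT y. norm ((p, z) - (y, 0)) powr (- (a + 2)) *\<^sub>R ((p, z) - (y, 0))))
      = \<alpha> * ((LBINT y. norm ((p, z) - (y, 0)) powr (- a)) *
             (LBINT y. norm ((p, z) - (y, 0)) powr (- (a + 2))))"
  defines "\<Phi> s \<equiv> LBINT y. \<phi>' y * norm (p - y, z) powr (- s)"
    and "S s \<equiv> LBINT y. (z \<bullet> \<psi>' y) * norm (p - y, z) powr (- s)"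
  shows "2 * a * ((norm z)\<^sup>2 * \<Phi> (a + 2) - S (a + 2) + (a + 2) * (norm z)\<^sup>2 * S (a + 4))
    = \<alpha> * \<Phi> a + \<alpha> * a * S (a + 2) + a * (norm z)\<^sup>2 * \<Phi> (a + 2) + a * (a + 2) * (norm z)\<^sup>2 * S (a + 4)"
proof -
  define u where "u y = (p - y, z)" for y
  have uu: "(p, z) - (y, 0) = u y" for y by (simp add: u_def)
  have [measurable]: "u \<in> borel_measurable borel" unfolding u_def by measurable
  have a0: "a > 0" using \<alpha> by (simp add: a add_nonneg_pos)
  have sa: "a > real DIM('a)" "a + 2 > real DIM('a)" "a + 1 > real DIM('a)" "a + 4 > real DIM('a)"
    using \<alpha> by (simp_all add: a)
  have tk0: "taylor_kernel s (\<lambda>v::'a \<times> 'b. norm v powr (- s)) (\<lambda>v h. - s * norm v powr (- s - 2) * (v \<bullet> h))"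
    if "s > real DIM('a)" for s
    using that by (intro taylor_kernel_norm_powr) simp
  let ?k' = "\<lambda>(v::'a \<times> 'b) h. norm v powr (- (a + 2)) *\<^sub>R h + (- (a + 2) * norm v powr (- (a + 2) - 2) * (v \<bullet> h)) *\<^sub>R v"
  have tk1: "taylor_kernel (a + 1) (\<lambda>v::'a \<times> 'b. norm v powr (- (a + 2)) *\<^sub>R v) ?k'"
  proof -
    have "a + 2 - 1 = a + 1" by simp
    then show ?thesis using taylor_kernel_scaleR[OF tk0[OF sa(2)]] by (simp only:)
  qed
  note facts = z t0 B w\<phi> w\<psi> \<psi>B
  have \<phi>'m[measurable]: "\<phi>' \<in> borel_measurable borel" and \<psi>'m[measurable]: "\<psi>' \<in> borel_measurable borel"
    using w\<phi> w\<psi> unfolding weighted_derivative_def by simp_all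
  have \<phi>'i: "integrable lborel (\<lambda>y. \<bar>\<phi>' y\<bar> * weight s y)"
    and \<psi>'i: "weighted_integrable s \<psi>'" if "s > real DIM('a)" for s
    using w\<phi> w\<psi> that unfolding weighted_derivative_def by simp_all
  have z\<psi>i: "integrable lborel (\<lambda>y. \<bar>z \<bullet> \<psi>' y\<bar> * weight s y)" if s: "s > real DIM('a)" for s
  proof (rule integrable_dominated)
    show "integrable lborel (\<lambda>y. norm z * (norm (\<psi>' y) * weight s y))" using \<psi>'i[OF s] by simp
    show "norm (\<bar>z \<bullet> \<psi>' y\<bar> * weight s y) \<le> norm z * (norm (\<psi>' y) * weight s y)" for y
      using mult_right_mono[OF Cauchy_Schwarz_ineq2[of z "\<psi>' y"], of "weight s y"] by (simp add: abs_mult mult.assoc)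
  qed measurable
  define c where "c = norm z / (1 + norm p + norm z)"
  have c: "c > 0" and low: "\<And>y. norm ((p, z) - (y, 0)) \<ge> c * (1 + norm y)"
    unfolding c_def using z base_point_weight[of z p] by auto
  have gm: "(\<lambda>y::'a. (y, 0::'b)) \<in> borel_measurable borel" by measurable
  have wi: "integrable lborel (\<lambda>y::'a. \<bar>1\<bar> * weight s y)" if "s > real DIM('a)" for s
    using integrable_weight[OF that] by simp
  have \<Phi>i: "integrable lborel (\<lambda>y. \<phi>' y * norm (u y) powr (- s))" if "s > real DIM('a)" for s
    using integrable_kernel[OF tk0[OF that] _ gm \<phi>'m c low \<phi>'i[OF that]] that unfolding uu by simp
  have Si: "integrable lborel (\<lambda>y. (z \<bullet> \<psi>' y) * norm (u y) powr (- s))" if "s > real DIM('a)" for s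
    using integrable_kernel[OF tk0[OF that] _ gm _ c low z\<psi>i[OF that]] that unfolding uu by simp
  have Ji: "integrable lborel (\<lambda>y. norm (u y) powr (- s))" if "s > real DIM('a)" for s
    using integrable_kernel[OF tk0[OF that] _ gm _ c low wi[OF that]] that unfolding uu by simp
  have \<Phi>: "\<Phi> s = (LBINT y. \<phi>' y * norm (u y) powr (- s))" and S: "S s = (LBINT y. (z \<bullet> \<psi>' y) * norm (u y) powr (- s))" for s
    by (simp_all add: \<Phi>_def S_def u_def)
  define J where "J = (LBINT y. norm (u y) powr (- (a + 2)))"
  define I where "I = (LBINT y. norm (u y) powr (- a))"
  define V where "V = (LBINT y. norm (u y) powr (- (a + 2)) *\<^sub>R u y)"
  define V' where "V' = (LBINT y. \<phi>' y *\<^sub>R (norm (u y) powr (- (a + 2)) *\<^sub>R u y)) - (LBINT y. ?k' (u y) (0, \<psi>' y))"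
  have uz: "u y \<bullet> (0, h) = z \<bullet> h" "(0, h) \<bullet> u y = h \<bullet> z" for y h by (simp_all add: u_def)
  have ex1: "- a - 2 = - (a + 2)" "- (a + 2) - 2 = - (a + 4)" by simp_all
  have lin: "(LBINT y. - s * norm (u y) powr (- r) * (u y \<bullet> (0, \<psi>' y))) = - s * S r" for s r
  proof -
    have "(LBINT y. - s * norm (u y) powr (- r) * (u y \<bullet> (0, \<psi>' y)))
        = (LBINT y. - s * ((z \<bullet> \<psi>' y) * norm (u y) powr (- r)))"
      by (intro Bochner_Integration.integral_cong refl) (simp add: uz ac_simps)
    also have "\<dots> = - s * S r" unfolding S by (rule integral_mult_right_zero)
    finally show ?thesis .
  qed
  have L1: "((\<lambda>t. (graph_potential a (\<phi> t) (\<psi> t) (p, z) - I) /\<^sub>R t)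
      \<longlongrightarrow> \<Phi> a - (- a * S (a + 2))) (at_right 0)"
    using family_expansion[where p = p, OF tk0[OF sa(1)] sa(1) facts] unfolding uu real_scaleR_def ex1 lin \<Phi>[symmetric] I_def .
  have L2: "((\<lambda>t. (graph_potential (a + 2) (\<phi> t) (\<psi> t) (p, z) - J) /\<^sub>R t)
      \<longlongrightarrow> \<Phi> (a + 2) - (- (a + 2) * S (a + 4))) (at_right 0)"
    using family_expansion[where p = p, OF tk0[OF sa(2)] sa(2) facts] unfolding uu real_scaleR_def ex1 lin \<Phi>[symmetric] J_def .
  have L3: "((\<lambda>t. (graph_field (a + 2) (\<phi> t) (\<psi> t) (p, z) - V) /\<^sub>R t)
      \<longlongrightarrow> V') (at_right 0)"
    using family_expansion[where p = p, OF tk1 sa(3) facts] unfolding uu V_def V'_def .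
  have main: "2 * a * (V \<bullet> V') = \<alpha> * ((\<Phi> a - (- a * S (a + 2))) * J + I * (\<Phi> (a + 2) - (- (a + 2) * S (a + 4))))"
    using limit_product_identity[OF L1 L2 L3 ev] e0 unfolding uu V_def I_def J_def .
  have Vi: "integrable lborel (\<lambda>y. norm (u y) powr (- (a + 2)) *\<^sub>R u y)"
    using integrable_kernel[OF tk1 _ gm _ c low wi[OF sa(3)]] a0 unfolding uu by simp
  \<comment> \<open>the horizontal component vanishes because its integrand is odd about \<open>p\<close>\<close>
  have V: "V = J *\<^sub>R (0, z)"
  proof -
    have "h \<bullet> V = h \<bullet> (J *\<^sub>R (0, z))" for h :: "'a \<times> 'b"
    proof -
      obtain e f where h: "h = (e, f)" by (cases h)
      let ?X = "\<lambda>y. norm (u y) powr (- (a + 2)) * (e \<bullet> (p - y))"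
      have Xi: "integrable lborel ?X"
      proof -
        have "integrable lborel (\<lambda>y. (e, 0) \<bullet> (norm (u y) powr (- (a + 2)) *\<^sub>R u y))"
          using Vi by (rule integrable_inner_right)
        then show ?thesis by (simp add: u_def)
      qed
      have "(LBINT y. ?X y) = (LBINT y. ?X ((p + p) - y))"
        by (rule integral_lborel_reflect[symmetric]) measurable
      also have "\<dots> = (LBINT y. - ?X y)"
      proof (intro Bochner_Integration.integral_cong refl)
        fix y
        have "norm (u ((p + p) - y)) = norm (u y)" by (simp add: u_def norm_Pair norm_minus_commute)
        moreover have "e \<bullet> (p - ((p + p) - y)) = - (e \<bullet> (p - y))" by (simp add: inner_diff_right inner_add_right)
        ultimately show "?X ((p + p) - y) = - ?X y" by simp
      qed
      also have "\<dots> = - (LBINT y. ?X y)" by (rule Bochner_Integration.integral_minus)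
      finally have X0: "(LBINT y. ?X y) = 0" by simp
      have "h \<bullet> V = (LBINT y. h \<bullet> (norm (u y) powr (- (a + 2)) *\<^sub>R u y))"
        unfolding V_def using Vi by (intro integral_inner_right[symmetric])
      also have "\<dots> = (LBINT y. ?X y + (f \<bullet> z) * norm (u y) powr (- (a + 2)))"
        by (intro Bochner_Integration.integral_cong refl) (simp add: h u_def algebra_simps)
      also have "\<dots> = (f \<bullet> z) * J"
        using Xi Ji[OF sa(2)] X0 by (simp add: J_def)
      finally show ?thesis by (simp add: h)
    qed
    then show ?thesis using vector_eq_ldot by blast
  qed
  have zV': "(0, z) \<bullet> V' = (norm z)\<^sup>2 * \<Phi> (a + 2) - (S (a + 2) - (a + 2) * (norm z)\<^sup>2 * S (a + 4))"
  proof -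
    have i1: "integrable lborel (\<lambda>y. \<phi>' y *\<^sub>R (norm (u y) powr (- (a + 2)) *\<^sub>R u y))"
      using integrable_kernel[OF tk1 _ gm \<phi>'m c low \<phi>'i[OF sa(3)]] a0 unfolding uu by simp
    have i2: "integrable lborel (\<lambda>y. ?k' (u y) (0, \<psi>' y))"
      using integrable_linear_term[where p = p, OF tk1 sa(3) facts] unfolding uu .
    have "(0, z) \<bullet> (LBINT y. \<phi>' y *\<^sub>R (norm (u y) powr (- (a + 2)) *\<^sub>R u y))
        = (LBINT y. (0, z) \<bullet> (\<phi>' y *\<^sub>R (norm (u y) powr (- (a + 2)) *\<^sub>R u y)))"
      using i1 by (intro integral_inner_right[symmetric])
    also have "\<dots> = (LBINT y. (norm z)\<^sup>2 * (\<phi>' y * norm (u y) powr (- (a + 2))))"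
      by (intro Bochner_Integration.integral_cong refl) (simp add: uz power2_norm_eq_inner ac_simps)
    also have "\<dots> = (norm z)\<^sup>2 * \<Phi> (a + 2)" unfolding \<Phi> by (rule integral_mult_right_zero)
    finally have A: "(0, z) \<bullet> (LBINT y. \<phi>' y *\<^sub>R (norm (u y) powr (- (a + 2)) *\<^sub>R u y)) = (norm z)\<^sup>2 * \<Phi> (a + 2)" .
    have "(0, z) \<bullet> (LBINT y. ?k' (u y) (0, \<psi>' y)) = (LBINT y. (0, z) \<bullet> ?k' (u y) (0, \<psi>' y))"
      using i2 by (intro integral_inner_right[symmetric])
    also have "\<dots> = (LBINT y. (z \<bullet> \<psi>' y) * norm (u y) powr (- (a + 2))
        - (a + 2) * (norm z)\<^sup>2 * ((z \<bullet> \<psi>' y) * norm (u y) powr (- (a + 4))))"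
      unfolding ex1
      by (intro Bochner_Integration.integral_cong refl)
         (simp only: inner_add_right inner_scaleR_right uz power2_norm_eq_inner inner_Pair, simp add: algebra_simps)
    also have "\<dots> = S (a + 2) - (a + 2) * (norm z)\<^sup>2 * S (a + 4)"
      unfolding S using Si[OF sa(2)] Si[OF sa(4)]
      by (subst Bochner_Integration.integral_diff) (simp_all only: integral_mult_right_zero integrable_mult_right)
    finally show ?thesis unfolding V'_def inner_diff_right A by simp
  qed
  have J0: "J > 0"
    unfolding J_def
  proof (rule integral_lborel_pos[OF Ji[OF sa(2)]])
    fix y
    have "u y \<noteq> 0" using z by (simp add: u_def zero_prod_def)
    then show "norm (u y) powr (- (a + 2)) > 0" by simp
  qed
  have I: "\<alpha> * I = a * (norm z)\<^sup>2 * J"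
  proof -
    have "a * (V \<bullet> V) = \<alpha> * (I * J)" using e0 unfolding uu V_def I_def J_def .
    moreover have "V \<bullet> V = J * ((norm z)\<^sup>2 * J)" unfolding V by (simp add: power2_norm_eq_inner)
    ultimately have "(a * (norm z)\<^sup>2 * J) * J = (\<alpha> * I) * J" by (simp add: ac_simps)
    then show ?thesis using J0 by simp
  qed
  have "J * (2 * a * ((0, z) \<bullet> V')) = \<alpha> * ((\<Phi> a - (- a * S (a + 2))) * J) + (\<alpha> * I) * (\<Phi> (a + 2) - (- (a + 2) * S (a + 4)))"
    using main unfolding V by (simp only: inner_scaleR_left distrib_left ac_simps)
  also have "\<dots> = J * (\<alpha> * (\<Phi> a - (- a * S (a + 2))) + a * (norm z)\<^sup>2 * (\<Phi> (a + 2) - (- (a + 2) * S (a + 4))))"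
    unfolding I by (simp only: distrib_left ac_simps)
  finally have "2 * a * ((0, z) \<bullet> V') = \<alpha> * (\<Phi> a - (- a * S (a + 2))) + a * (norm z)\<^sup>2 * (\<Phi> (a + 2) - (- (a + 2) * S (a + 4)))"
    using J0 by simp
  then show ?thesis unfolding zV' by (simp add: algebra_simps)
qed

text \<open>The terms with \<open>\<phi>'\<close> are even in \<open>z\<close> and those with \<open>\<psi>'\<close> are odd, so subtracting the equation at \<open>- z\<close> removes
  \<open>\<phi>'\<close>. What remains involves only two powers of the distance and is of first order in \<open>|z|\<close>.\<close>

lemma linearized_first_order:
  fixes a \<alpha> :: real and z :: "'b::euclidean_space" and \<psi>' :: "'a::euclidean_space \<Rightarrow> 'b"
  assumes a: "a > 0"
    and eq: "\<And>z. z \<noteq> 0 \<Longrightarrow>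
      linear_relation a \<alpha> \<phi>' \<psi>' p z"
    and z: "z \<noteq> 0"
  shows "(a + 2) * (norm z)\<^sup>2 * potential (a + 4) (\<lambda>y. z \<bullet> \<psi>' y) p z
    = (\<alpha> + 2) * potential (a + 2) (\<lambda>y. z \<bullet> \<psi>' y) p z"
proof -
  have n: "norm (p - y, - z) = norm (p - y, z)" for y by (simp add: norm_Pair)
  have m: "(LBINT y. (- z \<bullet> \<psi>' y) * norm (p - y, z) powr (- s)) = - potential s (\<lambda>y. z \<bullet> \<psi>' y) p z" for s
    unfolding inner_minus_left mult_minus_left by (rule Bochner_Integration.integral_minus)
  define \<Phi> where "\<Phi> s = potential s \<phi>' p z" for s
  define S where "S s = potential s (\<lambda>y. z \<bullet> \<psi>' y) p z" for s
  define r where "r = (norm z)\<^sup>2"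
  have e1: "2 * a * (r * \<Phi> (a + 2) - S (a + 2) + (a + 2) * r * S (a + 4))
    = \<alpha> * \<Phi> a + \<alpha> * a * S (a + 2) + a * r * \<Phi> (a + 2) + a * (a + 2) * r * S (a + 4)"
    using eq[OF z] unfolding \<Phi>_def S_def r_def .
  have "- z \<noteq> 0" using z by simp
  from eq[OF this] have e2: "2 * a * (r * \<Phi> (a + 2) - (- S (a + 2)) + (a + 2) * r * (- S (a + 4)))
    = \<alpha> * \<Phi> a + \<alpha> * a * (- S (a + 2)) + a * r * \<Phi> (a + 2) + a * (a + 2) * r * (- S (a + 4))"
    unfolding n m norm_minus_cancel \<Phi>_def S_def r_def .
  have "(2 * a) * ((a + 2) * r * S (a + 4) - (\<alpha> + 2) * S (a + 2))
      = (2 * a * (r * \<Phi> (a + 2) - S (a + 2) + (a + 2) * r * S (a + 4))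
         - (\<alpha> * \<Phi> a + \<alpha> * a * S (a + 2) + a * r * \<Phi> (a + 2) + a * (a + 2) * r * S (a + 4)))
       - (2 * a * (r * \<Phi> (a + 2) - (- S (a + 2)) + (a + 2) * r * (- S (a + 4)))
         - (\<alpha> * \<Phi> a + \<alpha> * a * (- S (a + 2)) + a * r * \<Phi> (a + 2) + a * (a + 2) * r * (- S (a + 4))))"
    by (simp add: algebra_simps)
  also have "\<dots> = 0" unfolding e1 e2 by simp
  finally show ?thesis using a unfolding S_def r_def by simp
qed

section \<open>Non-existence of perturbations\<close>

lemma L_infinity_locally_integrable:
  assumes "L_infinity f"
  shows "locally_integrable f"
  unfolding locally_integrable_def
proof (intro allI impI)
  fix K :: "'a set" assume K: "compact K"
  have [measurable]: "f \<in> borel_measurable borel" using assms by (simp add: L_infinity_def)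
  have Km[measurable]: "K \<in> sets borel" using K by (intro borel_closed compact_imp_closed)
  obtain M where M: "AE y in lborel. \<bar>f y\<bar> \<le> M" using assms by (auto simp: L_infinity_def)
  have "emeasure lborel K < \<infinity>" using K by (intro emeasure_bounded_finite compact_imp_bounded)
  then have "integrable lborel (\<lambda>y. indicator K y *\<^sub>R \<bar>M\<bar>)"
    by (intro integrable_scaleR_left integrable_real_indicator) auto
  then show "set_integrable lborel K f"
    unfolding set_integrable_def
  proof (rule Bochner_Integration.integrable_bound)
    show "AE y in lborel. norm (indicator K y *\<^sub>R f y) \<le> norm (indicator K y *\<^sub>R \<bar>M\<bar>)"
      using M by eventually_elim (simp add: indicator_def)
  qed measurable
qed

lemma continuous_locally_integrable:
  assumes "continuous_on UNIV f"
  shows "locally_integrable f"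
  unfolding locally_integrable_def set_integrable_def
  using assms by (intro allI impI borel_integrable_compact) (auto intro: continuous_on_subset)

text \<open>A push-forward of a density with respect to the null measure has empty support.\<close>

lemma hausdorff_measure_nonzero:
  fixes \<mu> :: "'b::metric_space measure" and g :: "'a::metric_space \<Rightarrow> 'b"
  assumes g: "g \<in> borel_measurable borel" and f: "f \<in> borel_measurable borel"
    and \<mu>: "\<mu> = distr (density (hausdorff_measure s) f) borel g" and supp: "closed_support \<mu> = range g"
  shows "emeasure (hausdorff_measure s :: 'a measure) UNIV \<noteq> 0"
proof
  let ?H = "hausdorff_measure s :: 'a measure"
  assume z: "emeasure ?H UNIV = 0"
  have sH: "sets ?H = sets borel" by (rule sets_hausdorff_measure)
  have spH: "space ?H = UNIV" using sets_eq_imp_space_eq[OF sH] by simp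
  obtain y :: 'a where True by blast
  have "g y \<in> closed_support \<mu>" unfolding supp by simp
  then have pos: "emeasure \<mu> (ball (g y) 1) > 0" by (simp add: closed_support_def)
  have gH: "g \<in> measurable (density ?H f) borel" using g by (simp add: measurable_cong_sets[OF sH])
  have fH: "f \<in> borel_measurable ?H" using f by (simp add: measurable_cong_sets[OF sH])
  have "UNIV \<in> null_sets ?H" using z sH by (intro null_setsI) auto
  then have ae: "AE x in ?H. False" using AE_not_in by fastforce
  have A: "g -` ball (g y) 1 \<in> sets ?H" using measurable_sets[OF g, of "ball (g y) 1"] by (simp add: sH)
  have "emeasure \<mu> (ball (g y) 1) = emeasure (density ?H f) (g -` ball (g y) 1)"
    unfolding \<mu> using gH by (simp add: emeasure_distr spH)
  also have "\<dots> = (\<integral>\<^sup>+x. f x * indicator (g -` ball (g y) 1) x \<partial>?H)"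
    using fH A by (rule emeasure_density)
  also have "\<dots> = (\<integral>\<^sup>+x. 0 \<partial>?H)" using ae by (intro nn_integral_cong_AE) auto
  finally show False using pos by simp
qed

theorem theorem2:
  fixes n d :: nat and \<alpha> :: real
  assumes "d = CARD('d::finite)" and "n = CARD('d) + CARD('m::finite)"
    and "1 \<le> d" and "d < n - 2"
    and "\<alpha> > 0" and "\<alpha> \<noteq> real n - real d - 2"
  shows "\<not> (\<exists>(t0::real) (\<mu> :: real \<Rightarrow> ((real^'d) \<times> (real^'m)) measure).
            nontrivial_graph_perturbations \<alpha> t0 \<mu>)"
proof
  assume "\<exists>(t0::real) (\<mu> :: real \<Rightarrow> ((real^'d) \<times> (real^'m)) measure). nontrivial_graph_perturbations \<alpha> t0 \<mu>"
  then obtain t0 and \<mu> :: "real \<Rightarrow> ((real^'d) \<times> (real^'m)) measure"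
    and \<phi> :: "real \<Rightarrow> real^'d \<Rightarrow> real" and \<psi> :: "real \<Rightarrow> real^'d \<Rightarrow> real^'m" and \<phi>' \<psi>' C
    where t0: "t0 > 0"
      and lipC: "\<forall>t\<in>{0..<t0}. (C * t)-lipschitz_on UNIV (\<psi> t)"
      and all: "\<forall>t\<in>{0..<t0}.
           L_infinity (\<phi> t) \<and> (AE y in lborel. 0 \<le> 1 + \<phi> t y) \<and>
           \<mu> t = distr (density (hausdorff_measure (real CARD('d))) (\<lambda>y. ennreal (1 + \<phi> t y)))
                    borel (graph_map (\<psi> t)) \<and>
           ahlfors_regular CARD('d) (\<mu> t) (range (graph_map (\<psi> t))) \<and>
           (\<forall>x \<in> - closed_support (\<mu> t).
              elliptic_op CARD('d) \<alpha> (\<mu> t) (reg_dist CARD('d) \<alpha> (\<mu> t)) x = 0)"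
      and \<phi>0: "AE y in lborel. \<phi> 0 y = 0" and \<psi>0: "\<forall>y. \<psi> 0 y = 0"
      and \<phi>d: "bmo_differentiable_at_0 \<phi> \<phi>'" and \<psi>d: "\<forall>i. bmo_differentiable_at_0 (\<lambda>t y. \<psi> t y $ i) (\<lambda>y. \<psi>' y $ i)"
      and nc: "\<not> (\<exists>c. AE y in lborel. \<psi>' y = c)"
      and \<phi>l: "linearly_controlled t0 \<phi> \<phi>'" and \<psi>l: "\<forall>i. linearly_controlled t0 (\<lambda>t y. \<psi> t y $ i) (\<lambda>y. \<psi>' y $ i)"
    unfolding nontrivial_graph_perturbations_def by (elim exE conjE) (rule that)
  have lip: "(C * t)-lipschitz_on UNIV (\<psi> t)" if "t \<in> {0..<t0}" for t using lipC that by blast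
  have \<alpha>: "\<alpha> > 0" and \<alpha>2: "\<alpha> \<noteq> real DIM((real^'d) \<times> (real^'m)) - real CARD('d) - 2" using assms by simp_all
  have cont: "continuous_on UNIV (\<psi> t)" if "t \<in> {0..<t0}" for t
    using lip[OF that] by (rule lipschitz_on_continuous_on)
  have \<phi>m: "\<phi> t \<in> borel_measurable borel" if "t \<in> {0..<t0}" for t
    using all that unfolding L_infinity_def by blast
  have \<psi>m: "\<psi> t \<in> borel_measurable borel" if "t \<in> {0..<t0}" for t
    using cont[OF that] by (rule borel_measurable_continuous_onI)
  have gm: "graph_map (\<psi> t) \<in> borel_measurable borel" if "t \<in> {0..<t0}" for t
    using \<psi>m[OF that] unfolding graph_map_def[abs_def] by measurable
  have nn: "AE y in lborel. 0 \<le> 1 + \<phi> t y" if "t \<in> {0..<t0}" for t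
    using all that by blast
  have \<mu>: "\<mu> t = distr (density (hausdorff_measure (real CARD('d))) (\<lambda>y. ennreal (1 + \<phi> t y))) borel (graph_map (\<psi> t))"
    if "t \<in> {0..<t0}" for t using all that by blast
  have supp: "closed_support (\<mu> t) = range (graph_map (\<psi> t))" and cl: "closed (range (graph_map (\<psi> t)))"
    if "t \<in> {0..<t0}" for t using all that unfolding ahlfors_regular_def by blast+
  have z0: "0 \<in> {0..<t0}" using t0 by simp
  \<comment> \<open>the support of \<open>\<mu> 0\<close> is nonempty, so the Hausdorff measure is not the null measure\<close>
  have "emeasure (hausdorff_measure (real CARD('d)) :: (real^'d) measure) UNIV \<noteq> 0"
    using \<phi>m[OF z0] by (intro hausdorff_measure_nonzero[OF gm[OF z0] _ \<mu>[OF z0] supp[OF z0]]) measurable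
  from hausdorff_measure_eq_lborel[OF this]
  obtain h where h: "h > 0" and H: "hausdorff_measure (real CARD('d)) = density (lborel :: (real^'d) measure) (\<lambda>_. ennreal h)"
    by blast
  define a where "a = real CARD('d) + \<alpha>"
  have a: "a = real DIM(real^'d) + \<alpha>" "a > real DIM(real^'d)" "a > 0" using \<alpha> by (simp_all add: a_def add_pos_pos)
  have rd: "reg_dist CARD('d) \<alpha> (\<mu> t) x =
      (h * (LBINT y. (1 + \<phi> t y) * norm (x - graph_map (\<psi> t) y) powr (- a))) powr (- 1 / \<alpha>)"
    if t: "t \<in> {0..<t0}" for t x
    using reg_dist_graph[OF h \<phi>m[OF t] nn[OF t] cont[OF t] cl[OF t] \<mu>[OF t, unfolded H] supp[OF t]] by (simp add: a_def)
  have w\<phi>: "weighted_derivative t0 \<phi> \<phi>'"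
    using all \<phi>m by (intro weighted_derivative_scalar[OF _ _ \<phi>d \<phi>l t0]) (simp_all add: L_infinity_locally_integrable)
  have w\<psi>: "weighted_derivative t0 \<psi> \<psi>'"
  proof (rule weighted_derivative_vec[OF weighted_derivative_scalar t0])
    fix i
    show "bmo_differentiable_at_0 (\<lambda>t y. \<psi> t y $ i) (\<lambda>y. \<psi>' y $ i)" "linearly_controlled t0 (\<lambda>t y. \<psi> t y $ i) (\<lambda>y. \<psi>' y $ i)"
      using \<psi>d \<psi>l by blast+
    fix t assume "t \<in> {0<..<t0}"
    then have t: "t \<in> {0..<t0}" by simp
    have "continuous_on UNIV (\<lambda>y. \<psi> t y $ i)" using cont[OF t] by (intro continuous_intros)
    then show "(\<lambda>y. \<psi> t y $ i) \<in> borel_measurable borel" "locally_integrable (\<lambda>y. \<psi> t y $ i)"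
      by (rule borel_measurable_continuous_onI, rule continuous_locally_integrable)
  qed (rule t0)
  have "\<exists>C. \<forall>t\<in>{0..<t0}. \<bar>LINT y:ball 0 1|lborel. \<psi> t y $ i\<bar> \<le> C * t" for i
    using \<psi>l unfolding linearly_controlled_def by blast
  from lipschitz_growth[OF lip this] obtain B where B: "B \<ge> 0"
    and \<psi>B: "\<forall>t\<in>{0..<t0}. \<forall>y. norm (\<psi> t y) \<le> B * t * (1 + norm y)" by blast
  have \<psi>B': "\<forall>t\<in>{0<..<t0}. \<forall>y. norm (\<psi> t y) \<le> B * t * (1 + norm y)" using \<psi>B by simp
  \<comment> \<open>the first-order equation, from the identity for all small \<open>t\<close> and for \<open>t = 0\<close>\<close>
  have fo: "(a + 2) * (norm z)\<^sup>2 * potential (a + 4) (\<lambda>y. z \<bullet> \<psi>' y) p z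
    = (\<alpha> + 2) * potential (a + 2) (\<lambda>y. z \<bullet> \<psi>' y) p z"
    if z: "z \<noteq> 0" for p and z :: "real^'m"
  proof (rule linearized_first_order[OF a(3) _ z])
    fix z :: "real^'m" assume z: "z \<noteq> 0"
    define c where "c = norm z / (1 + norm p + norm z)"
    have c: "c > 0" and low: "\<And>y. c * (1 + norm y) \<le> norm (p - y, z)"
      unfolding c_def using base_point_weight[OF z] by auto
    have identity: "a * (graph_field (a + 2) (\<phi> t) (\<psi> t) (p, z) \<bullet>
           graph_field (a + 2) (\<phi> t) (\<psi> t) (p, z))
      = \<alpha> * (graph_potential a (\<phi> t) (\<psi> t) (p, z) *
             graph_potential (a + 2) (\<phi> t) (\<psi> t) (p, z))"
      if t: "t \<in> {0..<t0}" and ts: "2 * (B * t) \<le> c"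
        and int: "integrable lborel (\<lambda>y. \<bar>1 + \<phi> t y\<bar> * weight a y)"
        and pos: "graph_potential a (\<phi> t) (\<psi> t) (p, z) > 0" for t
    proof -
      have low2: "norm ((p, z) - graph_map (\<psi> t) y) \<ge> c / 2 * (1 + norm y)" for y
        unfolding graph_map_def using graph_point_weight(3)[OF c low _ ts, of "\<psi> t y" y] \<psi>B t by blast
      have "(p, z) \<notin> closed_support (\<mu> t)"
      proof
        assume "(p, z) \<in> closed_support (\<mu> t)"
        then obtain y where "(p, z) = graph_map (\<psi> t) y" unfolding supp[OF t] by blast
        then have "c / 2 * (1 + norm y) \<le> 0" using low2[of y] by simp
        moreover have "c / 2 * (1 + norm y) > 0" using c by (intro mult_pos_pos add_pos_nonneg) auto
        ultimately show False by linarith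
      qed
      then have "elliptic_op CARD('d) \<alpha> (\<mu> t) (reg_dist CARD('d) \<alpha> (\<mu> t)) (p, z) = 0" using all t by blast
      then have eq: "divergence (\<lambda>x. reg_dist CARD('d) \<alpha> (\<mu> t) x powr (- real DIM((real^'d) \<times> (real^'m)) + real CARD('d) + 1)
          *\<^sub>R gradient (reg_dist CARD('d) \<alpha> (\<mu> t)) x) (p, z) = 0"
        unfolding elliptic_op_def by (simp only: neg_equal_0_iff_equal)
      have f: "(\<lambda>y. 1 + \<phi> t y) \<in> borel_measurable borel" using \<phi>m[OF t] by measurable
      have c2: "c / 2 > 0" using c by simp
      show ?thesis
        using graph_identity[OF _ \<alpha> \<alpha>2 gm[OF t] f c2 low2 int[unfolded a_def] h rd[OF t, unfolded a_def] pos[unfolded a_def, folded graph_map_def] eq]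
        unfolding a_def graph_map_def by simp
    qed
    have tk: "taylor_kernel a (\<lambda>v::(real^'d) \<times> (real^'m). norm v powr (- a)) (\<lambda>v h. - a * norm v powr (- a - 2) * (v \<bullet> h))"
      using a by (intro taylor_kernel_norm_powr) simp
    have I0: "(LBINT y. norm ((p, z) - (y, 0)) powr (- a)) > 0"
    proof (rule integral_lborel_pos)
      have "integrable lborel (\<lambda>y. 1 *\<^sub>R norm ((p, z) - (y, 0)) powr (- a))"
        using a c low integrable_weight[OF a(2)] by (intro integrable_kernel[OF tk, where c = c]) auto
      then show "integrable lborel (\<lambda>y. norm ((p, z) - (y, 0)) powr (- a))" by simp
      fix y
      have "(p, z) - (y, 0) \<noteq> 0" using z by (simp add: zero_prod_def)
      then show "norm ((p, z) - (y, 0)) powr (- a) > 0" by simp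
    qed
    show "linear_relation a \<alpha> \<phi>' \<psi>' p z"
    proof (rule linearized_equation[OF a(1) \<alpha> z t0 B w\<phi> w\<psi> \<psi>B'])
      have "((\<lambda>t. LBINT y. (1 + \<phi> t y) *\<^sub>R norm ((p, z) - (y, \<psi> t y)) powr (- a))
          \<longlongrightarrow> (LBINT y. norm ((p, z) - (y, 0)) powr (- a))) (at_right 0)"
        by (rule tendsto_of_difference_quotient[OF family_expansion[OF tk a(2) z t0 B w\<phi> w\<psi> \<psi>B']])
      then have ev1: "\<forall>\<^sub>F t in at_right 0. graph_potential a (\<phi> t) (\<psi> t) (p, z) > 0"
        unfolding real_scaleR_def using I0 by (rule order_tendstoD(1))
      have "min t0 (c / (2 * B + 1)) > 0" using t0 c B by simp
      then have ev2: "\<forall>\<^sub>F t in at_right 0. t \<in> {0<..<min t0 (c / (2 * B + 1))}" by (rule eventually_at_right_real)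
      from ev1 ev2 show "\<forall>\<^sub>F t in at_right 0.
        a * (graph_field (a + 2) (\<phi> t) (\<psi> t) (p, z) \<bullet>
             graph_field (a + 2) (\<phi> t) (\<psi> t) (p, z))
        = \<alpha> * (graph_potential a (\<phi> t) (\<psi> t) (p, z) *
               graph_potential (a + 2) (\<phi> t) (\<psi> t) (p, z))"
      proof eventually_elim
        case (elim t)
        then have t: "t \<in> {0<..<t0}" "t \<in> {0..<t0}" and tc: "t < c / (2 * B + 1)" by auto
        have "(2 * B + 1) * t < c" using tc B by (simp add: pos_less_divide_eq mult.commute)
        then have ts: "2 * (B * t) \<le> c" using t by (simp add: distrib_right)
        have "weighted_integrable a (\<phi> t)"
          using w\<phi> t(1) a(2) unfolding weighted_derivative_def by blast
        then have int: "integrable lborel (\<lambda>y. \<bar>1 + \<phi> t y\<bar> * weight a y)"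
          using integrable_norm_diff_weight[of "\<lambda>_. 1" "\<phi> t" "\<lambda>y. weight a y" "-1"]
            integrable_weight[OF a(2)] \<phi>m[OF t(2)] by simp
        show ?case by (rule identity[OF t(2) ts int elim(1)])
      qed
      have flat: "(LBINT y. (1 + \<phi> 0 y) * norm ((p, z) - (y, \<psi> 0 y)) powr (- s)) = (LBINT y. norm ((p, z) - (y, 0)) powr (- s))"
        "(LBINT y. (1 + \<phi> 0 y) *\<^sub>R (norm ((p, z) - (y, \<psi> 0 y)) powr (- s) *\<^sub>R ((p, z) - (y, \<psi> 0 y))))
          = (LBINT y. norm ((p, z) - (y, 0)) powr (- s) *\<^sub>R ((p, z) - (y, 0)))" for s
        using flat_graph_integral[OF _ \<phi>m[OF z0] \<phi>0, of "\<lambda>v. norm v powr (- s)" "\<psi> 0" "(p, z)"]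
          flat_graph_integral[OF _ \<phi>m[OF z0] \<phi>0, of "\<lambda>v. norm v powr (- s) *\<^sub>R v" "\<psi> 0" "(p, z)"] \<psi>0
        by simp_all
      have int0: "integrable lborel (\<lambda>y. \<bar>1 + \<phi> 0 y\<bar> * weight a y)"
      proof (rule integrable_cong_AE_imp[OF integrable_weight[OF a(2)]])
        show "(\<lambda>y. \<bar>1 + \<phi> 0 y\<bar> * weight a y) \<in> borel_measurable lborel" using \<phi>m[OF z0] by measurable
        show "AE y in lborel. weight a y = \<bar>1 + \<phi> 0 y\<bar> * weight a y"
          using \<phi>0 by eventually_elim simp
      qed
      show "a * ((LBINT y. norm ((p, z) - (y, 0)) powr (- (a + 2)) *\<^sub>R ((p, z) - (y, 0))) \<bullet>
             (LBINT y. norm ((p, z) - (y, 0)) powr (- (a + 2)) *\<^sub>R ((p, z) - (y, 0))))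
        = \<alpha> * ((LBINT y. norm ((p, z) - (y, 0)) powr (- a)) *
               (LBINT y. norm ((p, z) - (y, 0)) powr (- (a + 2))))"
        using identity[OF z0 _ int0] I0 c unfolding flat by simp
    qed
  qed
  have "AE y in lborel. \<psi>' y $ i = 0" for i
  proof (rule AE_zero_if_first_order_equation[where b = "a + 2"])
    show "integrable lborel (\<lambda>y. \<psi>' y $ i)" using \<psi>d unfolding bmo_differentiable_at_0_def by blast
    show "real DIM(real^'d) < a + 2" using a by simp
    fix p :: "real^'d" and r :: real assume r: "r > 0"
    \<comment> \<open>the point at height \<open>r\<close> in direction \<open>i\<close> isolates the component \<open>i\<close> of \<open>\<psi>'\<close>\<close>
    let ?z = "r *\<^sub>R (axis i 1 :: real^'m)"
    have z: "?z \<noteq> 0" "norm ?z = r" using r by (simp_all add: axis_eq_0_iff)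
    have nz: "norm (p - y, ?z) = norm (p - y, r)" for y using r by (simp add: norm_Pair)
    have in': "?z \<bullet> \<psi>' y = r * \<psi>' y $ i" for y by (simp add: inner_axis')
    have S: "(LBINT y. (?z \<bullet> \<psi>' y) * norm (p - y, ?z) powr (- s)) = r * (LBINT y. \<psi>' y $ i * norm (p - y, r) powr (- s))" for s
      unfolding in' nz mult.assoc by (rule integral_mult_right_zero)
    have e: "- (a + 2) - 2 = - (a + 4)" "a + 2 - real DIM(real^'d) = \<alpha> + 2" using a(1) by simp_all
    have "r * ((a + 2) * r\<^sup>2 * (LBINT y. \<psi>' y $ i * norm (p - y, r) powr (- (a + 4))))
        = r * ((\<alpha> + 2) * (LBINT y. \<psi>' y $ i * norm (p - y, r) powr (- (a + 2))))"
      using fo[OF z(1), of p] unfolding S z(2) by (simp only: ac_simps)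
    then show "(a + 2) * r\<^sup>2 * (LBINT y. \<psi>' y $ i * norm (p - y, r) powr (- (a + 2) - 2))
      = (a + 2 - real DIM(real^'d)) * (LBINT y. \<psi>' y $ i * norm (p - y, r) powr (- (a + 2)))"
      unfolding e using r by simp
  qed
  then have "AE y in lborel. \<forall>i\<in>UNIV. \<psi>' y $ i = 0" by (intro AE_finite_allI) auto
  then have "AE y in lborel. \<psi>' y = 0" by eventually_elim (simp add: vec_eq_iff)
  then show False using nc by blast
qed

end
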